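(* Let $b,c,d$ be comonoids in $\mathbf{Poly}$, let $m$ be a monad on $c$ in $\mathbb{C}\mathbf{at}^\sharp$, let $p$ be a $(d,c)$-bicomodule, and let $x$ be a $(c,b)$-bicomodule with the structure of a left $m$-module $\psi\colon m\triangleleft_c x\to x$. Let $u\colon p\to\begin{bmatrix}p\triangleleft_c m\\ p\end{bmatrix}\triangleleft_d p\triangleleft_c m$ be the universal transformation (unit of the coclosure adjunction). Then the composite transformation of $(d,b)$-bicomodules $$p\triangleleft_c x\xrightarrow{\;u\,\triangleleft_c x\;}\begin{bmatrix}p\triangleleft_c m\\ p\end{bmatrix}\triangleleft_d p\triangleleft_c m\triangleleft_c x\xrightarrow{\;\cdots\triangleleft_c\psi\;}\begin{bmatrix}p\triangleleft_c m\\ p\end{bmatrix}\triangleleft_d p\triangleleft_c x$$ endows $p\triangleleft_c x$ with the structure of a left $\begin{bmatrix}p\triangleleft_c m\\ p\end{bmatrix}$-comodule.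
   Context: **Polynomials, comonoids, bicomodules.** A polynomial is a functor $p=\sum_{I\in p(1)}y^{p[I]}\colon\mathbf{Set}\to\mathbf{Set}$ (a coproduct of representables; $p(1)$ and all $p[I]$ are sets); morphisms are natural transformations. The category $\mathbf{Poly}$ is monoidal under composition $\triangleleft$ with unit $y$. Comonoids $(c,\epsilon,\delta)$ in $(\mathbf{Poly},y,\triangleleft)$ correspond to small categories (objects: elements of $c(1)$; $c[C]$: the set of morphisms with source $C$; $\epsilon$ encodes identities, $\delta$ encodes codomains and composition). A $(c,d)$-bicomodule is a polynomial $p$ (the carrier) with compatible counital coassociative left $c$- and right $d$-coactions $c\triangleleft p\leftarrow p\to p\triangleleft d$. A $(c,d)$-bicomodule $p$ and a $(d,e)$-bicomodule $q$ compose to $p\triangleleft_d q=\mathrm{eq}(p\triangleleft q\rightrightarrows p\triangleleft d\triangleleft q)$, and $c$ itself (with coactions $\delta$) is the identity $(c,c)$-bicomodule. $\mathbb{C}\mathbf{at}^\sharp$ is the double category of comonoids in $\mathbf{Poly}$, homomorphisms (vertical) and bicomodules (horizontal); unitors and associators are suppressed. For a $(c,d)$-bicomodule $p$ and object $C\in c(1)$, $p_C(1)\subseteq p(1)$ is the set of positions sent to $C$ by $p(1)\to(c\triangleleft p)(1)\to c(1)$, and for $I\in p(1)$ the set $p[I]$ carries a $d$-copresheaf structure, equivalently is a $(d,0)$-bicomodule; here $0$ is the empty category. **Monads, comonads, modules, comodules.** A monad (resp. comonad) on $c$ in $\mathbb{C}\mathbf{at}^\sharp$ is a monoid (resp. comonoid)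 in the monoidal category of $(c,c)$-bicomodules under $\triangleleft_c$ with unit $c$; write $\eta,\mu$ for the unit and multiplication of $m$. A left $m$-module structure on a $(c,b)$-bicomodule $x$ is a bicomodule morphism $m\triangleleft_c x\to x$ satisfying the unit and associativity laws. For a comonad $e$ on $d$, a left $e$-comodule structure on a $(d,b)$-bicomodule $z$ is a bicomodule morphism $z\to e\triangleleft_d z$ satisfying the counit and coassociativity laws. **Right coclosure.** For a $(d,e)$-bicomodule $q$, the functor $-\triangleleft_d q$ from $(c,d)$-bicomodules to $(c,e)$-bicomodules has a left adjoint, written $p\mapsto\begin{bmatrix}q\\ p\end{bmatrix}$, with carrier $\sum_{C\in c(1)}\sum_{I\in p_C(1)}y^{q\triangleleft_e p[I]}$ (it is the left Kan extension of $p$ along $q$). For $p$ a $(d,c)$-bicomodule, write $L=\begin{bmatrix}p\triangleleft_c m\\ p\end{bmatrix}$, a $(d,d)$-bicomodule, with unit $u\colon p\to L\triangleleft_d p\triangleleft_c m$. It is a comonad on $d$: its counit $L\to d$ is adjoint to $p\triangleleft_c\eta\colon p\to p\triangleleft_c m$, and its comultiplication $L\to L\triangleleft_d L$ is adjoint to $(L\triangleleft_d L\triangleleft_d p\triangleleft_c\mu)\circ(L\triangleleft_d u\triangleleft_c m)\circ u\colon p\to L\triangleleft_d L\triangleleft_d p\triangleleft_c m$. *)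

theory Defs
  imports Main "HOL-Library.FuncSet"
begin

section \<open>Polynomials\<close>

text \<open>
  A polynomial functor, the coproduct over \<open>I \<in> pos P\<close> of the representables \<open>y\<^bsup>dirs P I\<^esup>\<close>, is
  represented by its set of positions \<open>p(1)\<close> and its sets of directions \<open>p[I]\<close>.  Sets are
  arbitrary subsets of arbitrary HOL types; the value of \<open>dirs P\<close> outside \<open>pos P\<close> is irrelevant.
\<close>

record ('i, 'a) poly =
  pos :: "'i set"
  dirs :: "'i \<Rightarrow> 'a set"

text \<open>
  By the Yoneda lemma a natural transformation \<open>p \<rightarrow> q\<close> is a map \<open>f\<^sub>1 : p(1) \<rightarrow> q(1)\<close> together
  with a map \<open>q[f\<^sub>1 I] \<rightarrow> p[I]\<close> for each \<open>I \<in> p(1)\<close>.  Both components are extensional functions,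
  so that HOL equality of polynomial maps is equality of natural transformations.
\<close>

record ('i, 'a, 'j, 'b) pmap =
  pdom :: "('i, 'a) poly"
  pcod :: "('j, 'b) poly"
  onpos :: "'i \<Rightarrow> 'j"
  ondir :: "'i \<Rightarrow> 'b \<Rightarrow> 'a"

definition phom :: "('i, 'a) poly \<Rightarrow> ('j, 'b) poly \<Rightarrow> ('i, 'a, 'j, 'b) pmap set" where
  "phom P Q = {f. pdom f = P \<and> pcod f = Q
     \<and> onpos f \<in> pos P \<rightarrow>\<^sub>E pos Q
     \<and> ondir f \<in> (\<Pi>\<^sub>E I\<in>pos P. dirs Q (onpos f I) \<rightarrow>\<^sub>E dirs P I)}"

definition mk_pmap ::
  "('i, 'a) poly \<Rightarrow> ('j, 'b) poly \<Rightarrow> ('i \<Rightarrow> 'j) \<Rightarrow> ('i \<Rightarrow> 'b \<Rightarrow> 'a) \<Rightarrow> ('i, 'a, 'j, 'b) pmap" where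
  "mk_pmap P Q f g = \<lparr>pdom = P, pcod = Q, onpos = restrict f (pos P),
     ondir = (\<lambda>I\<in>pos P. restrict (g I) (dirs Q (f I)))\<rparr>"

definition pid :: "('i, 'a) poly \<Rightarrow> ('i, 'a, 'i, 'a) pmap" where
  "pid P = mk_pmap P P (\<lambda>I. I) (\<lambda>I i. i)"

definition pcomp ::
  "('j, 'b, 'k, 'e) pmap \<Rightarrow> ('i, 'a, 'j, 'b) pmap \<Rightarrow> ('i, 'a, 'k, 'e) pmap" (infixl "\<circ>\<^sub>p" 55) where
  "g \<circ>\<^sub>p f = mk_pmap (pdom f) (pcod g) (\<lambda>I. onpos g (onpos f I))
     (\<lambda>I k. ondir f I (ondir g (onpos f I) k))"

subsection \<open>The composition product\<close>

definition yon :: "(unit, unit) poly" where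
  "yon = \<lparr>pos = {()}, dirs = (\<lambda>_. {()})\<rparr>"

definition ptri ::
  "('i, 'a) poly \<Rightarrow> ('j, 'b) poly \<Rightarrow> ('i \<times> ('a \<Rightarrow> 'j), 'a \<times> 'b) poly" (infixl "\<lhd>" 70) where
  "P \<lhd> Q = \<lparr>pos = (SIGMA I:pos P. dirs P I \<rightarrow>\<^sub>E pos Q),
     dirs = (\<lambda>(I, J). SIGMA i:dirs P I. dirs Q (J i))\<rparr>"

definition ptrim ::
  "('i, 'a, 'k, 'e) pmap \<Rightarrow> ('j, 'b, 'l, 'f) pmap \<Rightarrow>
   ('i \<times> ('a \<Rightarrow> 'j), 'a \<times> 'b, 'k \<times> ('e \<Rightarrow> 'l), 'e \<times> 'f) pmap" (infixl "\<lhd>\<^sub>m" 70) where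
  "f \<lhd>\<^sub>m g = mk_pmap (pdom f \<lhd> pdom g) (pcod f \<lhd> pcod g)
     (\<lambda>(I, J). (onpos f I, \<lambda>k\<in>dirs (pcod f) (onpos f I). onpos g (J (ondir f I k))))
     (\<lambda>(I, J) (k, l). (ondir f I k, ondir g (J (ondir f I k)) l))"

definition plunit :: "('i, 'a) poly \<Rightarrow> (unit \<times> (unit \<Rightarrow> 'i), unit \<times> 'a, 'i, 'a) pmap" where
  "plunit P = mk_pmap (yon \<lhd> P) P (\<lambda>(_, J). J ()) (\<lambda>_ i. ((), i))"

definition prunit :: "('i, 'a) poly \<Rightarrow> ('i \<times> ('a \<Rightarrow> unit), 'a \<times> unit, 'i, 'a) pmap" where
  "prunit P = mk_pmap (P \<lhd> yon) P (\<lambda>(I, _). I) (\<lambda>_ i. (i, ()))"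

definition passoc ::
  "('i, 'a) poly \<Rightarrow> ('j, 'b) poly \<Rightarrow> ('k, 'e) poly \<Rightarrow>
   (('i \<times> ('a \<Rightarrow> 'j)) \<times> ('a \<times> 'b \<Rightarrow> 'k), ('a \<times> 'b) \<times> 'e,
    'i \<times> ('a \<Rightarrow> 'j \<times> ('b \<Rightarrow> 'k)), 'a \<times> 'b \<times> 'e) pmap" where
  "passoc P Q R = mk_pmap ((P \<lhd> Q) \<lhd> R) (P \<lhd> (Q \<lhd> R))
     (\<lambda>((I, J), K). (I, \<lambda>i\<in>dirs P I. (J i, \<lambda>j\<in>dirs Q (J i). K (i, j))))
     (\<lambda>_ (i, j, k). ((i, j), k))"

definition passoc_inv ::
  "('i, 'a) poly \<Rightarrow> ('j, 'b) poly \<Rightarrow> ('k, 'e) poly \<Rightarrow>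
   ('i \<times> ('a \<Rightarrow> 'j \<times> ('b \<Rightarrow> 'k)), 'a \<times> 'b \<times> 'e,
    ('i \<times> ('a \<Rightarrow> 'j)) \<times> ('a \<times> 'b \<Rightarrow> 'k), ('a \<times> 'b) \<times> 'e) pmap" where
  "passoc_inv P Q R = mk_pmap (P \<lhd> (Q \<lhd> R)) ((P \<lhd> Q) \<lhd> R)
     (\<lambda>(I, H). ((I, \<lambda>i\<in>dirs P I. fst (H i)),
        \<lambda>(i, j)\<in>(SIGMA i:dirs P I. dirs Q (fst (H i))). snd (H i) j))
     (\<lambda>_ ((i, j), k). (i, j, k))"

subsection \<open>Equalizers\<close>

text \<open>
  The equalizer of \<open>f, g : P \<rightarrow> Q\<close> has the positions on which \<open>f\<close> and \<open>g\<close> agree; since directions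
  are contravariant, its directions form the coequalizer of the maps \<open>Q[f\<^sub>1 I] \<rightarrow> P[I]\<close>, that is, the
  quotient by the least equivalence relation identifying the two images of each element.
\<close>

definition eq_rel ::
  "('i, 'a, 'j, 'b) pmap \<Rightarrow> ('i, 'a, 'j, 'b) pmap \<Rightarrow> 'i \<Rightarrow> ('a \<times> 'a) set" where
  "eq_rel f g I = \<Inter> {E. equiv (dirs (pdom f) I) E \<and>
     (\<forall>k \<in> dirs (pcod f) (onpos f I). (ondir f I k, ondir g I k) \<in> E)}"

definition peq ::
  "('i, 'a, 'j, 'b) pmap \<Rightarrow> ('i, 'a, 'j, 'b) pmap \<Rightarrow> ('i, 'a set) poly" where
  "peq f g = \<lparr>pos = {I \<in> pos (pdom f). onpos f I = onpos g I},
     dirs = (\<lambda>I. dirs (pdom f) I // eq_rel f g I)\<rparr>"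

definition peq_incl ::
  "('i, 'a, 'j, 'b) pmap \<Rightarrow> ('i, 'a, 'j, 'b) pmap \<Rightarrow> ('i, 'a set, 'i, 'a) pmap" where
  "peq_incl f g = mk_pmap (peq f g) (pdom f) (\<lambda>I. I) (\<lambda>I i. eq_rel f g I `` {i})"

text \<open>The unique factorization of \<open>h\<close> through a monomorphism \<open>i\<close>.\<close>

definition pfactor ::
  "('j, 'b, 'k, 'e) pmap \<Rightarrow> ('i, 'a, 'k, 'e) pmap \<Rightarrow> ('i, 'a, 'j, 'b) pmap" where
  "pfactor i h = (THE g. g \<in> phom (pdom h) (pdom i) \<and> i \<circ>\<^sub>p g = h)"

section \<open>Comonoids and bicomodules\<close>

record ('o, 'm) comonoid =
  cpoly :: "('o, 'm) poly"
  counit :: "('o, 'm, unit, unit) pmap"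
  comult :: "('o, 'm, 'o \<times> ('m \<Rightarrow> 'o), 'm \<times> 'm) pmap"

definition comonoid :: "('o, 'm) comonoid \<Rightarrow> bool" where
  "comonoid c \<longleftrightarrow>
     counit c \<in> phom (cpoly c) yon \<and>
     comult c \<in> phom (cpoly c) (cpoly c \<lhd> cpoly c) \<and>
     plunit (cpoly c) \<circ>\<^sub>p (counit c \<lhd>\<^sub>m pid (cpoly c)) \<circ>\<^sub>p comult c = pid (cpoly c) \<and>
     prunit (cpoly c) \<circ>\<^sub>p (pid (cpoly c) \<lhd>\<^sub>m counit c) \<circ>\<^sub>p comult c = pid (cpoly c) \<and>
     passoc (cpoly c) (cpoly c) (cpoly c) \<circ>\<^sub>p (comult c \<lhd>\<^sub>m pid (cpoly c)) \<circ>\<^sub>p comult c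
       = (pid (cpoly c) \<lhd>\<^sub>m comult c) \<circ>\<^sub>p comult c"

record ('i, 'a, 'c, 'f, 'd, 'g) bicom =
  lbase :: "('c, 'f) comonoid"
  rbase :: "('d, 'g) comonoid"
  carrier :: "('i, 'a) poly"
  lcoact :: "('i, 'a, 'c \<times> ('f \<Rightarrow> 'i), 'f \<times> 'a) pmap"
  rcoact :: "('i, 'a, 'i \<times> ('a \<Rightarrow> 'd), 'a \<times> 'g) pmap"

definition bicomodule ::
  "('c, 'f) comonoid \<Rightarrow> ('d, 'g) comonoid \<Rightarrow> ('i, 'a, 'c, 'f, 'd, 'g) bicom \<Rightarrow> bool" where
  "bicomodule c d p \<longleftrightarrow>
     comonoid c \<and> comonoid d \<and> lbase p = c \<and> rbase p = d \<and>
     lcoact p \<in> phom (carrier p) (cpoly c \<lhd> carrier p) \<and>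
     rcoact p \<in> phom (carrier p) (carrier p \<lhd> cpoly d) \<and>
     plunit (carrier p) \<circ>\<^sub>p (counit c \<lhd>\<^sub>m pid (carrier p)) \<circ>\<^sub>p lcoact p = pid (carrier p) \<and>
     passoc (cpoly c) (cpoly c) (carrier p) \<circ>\<^sub>p (comult c \<lhd>\<^sub>m pid (carrier p)) \<circ>\<^sub>p lcoact p
       = (pid (cpoly c) \<lhd>\<^sub>m lcoact p) \<circ>\<^sub>p lcoact p \<and>
     prunit (carrier p) \<circ>\<^sub>p (pid (carrier p) \<lhd>\<^sub>m counit d) \<circ>\<^sub>p rcoact p = pid (carrier p) \<and>
     passoc (carrier p) (cpoly d) (cpoly d) \<circ>\<^sub>p (rcoact p \<lhd>\<^sub>m pid (cpoly d)) \<circ>\<^sub>p rcoact p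
       = (pid (carrier p) \<lhd>\<^sub>m comult d) \<circ>\<^sub>p rcoact p \<and>
     passoc (cpoly c) (carrier p) (cpoly d) \<circ>\<^sub>p (lcoact p \<lhd>\<^sub>m pid (cpoly d)) \<circ>\<^sub>p rcoact p
       = (pid (cpoly c) \<lhd>\<^sub>m rcoact p) \<circ>\<^sub>p lcoact p"

definition bid :: "('o, 'm) comonoid \<Rightarrow> ('o, 'm, 'o, 'm, 'o, 'm) bicom" where
  "bid c = \<lparr>lbase = c, rbase = c, carrier = cpoly c, lcoact = comult c, rcoact = comult c\<rparr>"

subsection \<open>Composition of bicomodules\<close>

text \<open>
  For a \<open>(c, d)\<close>-bicomodule \<open>p\<close> and a \<open>(d, e)\<close>-bicomodule \<open>q\<close>, \<open>bpar1 p q\<close> and \<open>bpar2 p q\<close> are the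
  two maps from \<open>p \<lhd> q\<close> to \<open>p \<lhd> d \<lhd> q\<close>, and \<open>p \<odot> q\<close> is the composite over \<open>d\<close>; the comonoid \<open>d\<close> is
  read off from the arguments.  The outer coactions are the unique ones compatible with the
  inclusion \<open>bincl p q\<close> of the equalizer into \<open>p \<lhd> q\<close>.
\<close>

definition bpar1 ::
  "('i, 'a, 'c, 'f, 'd, 'g) bicom \<Rightarrow> ('j, 'b, 'd, 'g, 'e, 'h) bicom \<Rightarrow>
   ('i \<times> ('a \<Rightarrow> 'j), 'a \<times> 'b, 'i \<times> ('a \<Rightarrow> 'd \<times> ('g \<Rightarrow> 'j)), 'a \<times> 'g \<times> 'b) pmap" where
  "bpar1 p q = passoc (carrier p) (cpoly (rbase p)) (carrier q) \<circ>\<^sub>p (rcoact p \<lhd>\<^sub>m pid (carrier q))"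

definition bpar2 ::
  "('i, 'a, 'c, 'f, 'd, 'g) bicom \<Rightarrow> ('j, 'b, 'd, 'g, 'e, 'h) bicom \<Rightarrow>
   ('i \<times> ('a \<Rightarrow> 'j), 'a \<times> 'b, 'i \<times> ('a \<Rightarrow> 'd \<times> ('g \<Rightarrow> 'j)), 'a \<times> 'g \<times> 'b) pmap" where
  "bpar2 p q = pid (carrier p) \<lhd>\<^sub>m lcoact q"

definition bincl ::
  "('i, 'a, 'c, 'f, 'd, 'g) bicom \<Rightarrow> ('j, 'b, 'd, 'g, 'e, 'h) bicom \<Rightarrow>
   ('i \<times> ('a \<Rightarrow> 'j), ('a \<times> 'b) set, 'i \<times> ('a \<Rightarrow> 'j), 'a \<times> 'b) pmap" where
  "bincl p q = peq_incl (bpar1 p q) (bpar2 p q)"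

definition bcomp ::
  "('i, 'a, 'c, 'f, 'd, 'g) bicom \<Rightarrow> ('j, 'b, 'd, 'g, 'e, 'h) bicom \<Rightarrow>
   ('i \<times> ('a \<Rightarrow> 'j), ('a \<times> 'b) set, 'c, 'f, 'e, 'h) bicom" (infixl "\<odot>" 70) where
  "p \<odot> q = \<lparr>lbase = lbase p, rbase = rbase q, carrier = peq (bpar1 p q) (bpar2 p q),
     lcoact = pfactor (pid (cpoly (lbase p)) \<lhd>\<^sub>m bincl p q)
       (passoc (cpoly (lbase p)) (carrier p) (carrier q) \<circ>\<^sub>p (lcoact p \<lhd>\<^sub>m pid (carrier q))
          \<circ>\<^sub>p bincl p q),
     rcoact = pfactor (bincl p q \<lhd>\<^sub>m pid (cpoly (rbase q)))
       (passoc_inv (carrier p) (carrier q) (cpoly (rbase q)) \<circ>\<^sub>p (pid (carrier p) \<lhd>\<^sub>m rcoact q)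
          \<circ>\<^sub>p bincl p q)\<rparr>"

subsection \<open>Bicomodule morphisms\<close>

record ('i, 'a, 'j, 'b, 'c, 'f, 'd, 'g) bicell =
  bdom :: "('i, 'a, 'c, 'f, 'd, 'g) bicom"
  bcod :: "('j, 'b, 'c, 'f, 'd, 'g) bicom"
  bmap :: "('i, 'a, 'j, 'b) pmap"

definition bicells ::
  "('i, 'a, 'c, 'f, 'd, 'g) bicom \<Rightarrow> ('j, 'b, 'c, 'f, 'd, 'g) bicom \<Rightarrow>
   ('i, 'a, 'j, 'b, 'c, 'f, 'd, 'g) bicell set" where
  "bicells p q = {\<phi>. bdom \<phi> = p \<and> bcod \<phi> = q \<and> bmap \<phi> \<in> phom (carrier p) (carrier q) \<and>
     lcoact q \<circ>\<^sub>p bmap \<phi> = (pid (cpoly (lbase p)) \<lhd>\<^sub>m bmap \<phi>) \<circ>\<^sub>p lcoact p \<and>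
     rcoact q \<circ>\<^sub>p bmap \<phi> = (bmap \<phi> \<lhd>\<^sub>m pid (cpoly (rbase p))) \<circ>\<^sub>p rcoact p}"

definition cid ::
  "('i, 'a, 'c, 'f, 'd, 'g) bicom \<Rightarrow> ('i, 'a, 'i, 'a, 'c, 'f, 'd, 'g) bicell" where
  "cid p = \<lparr>bdom = p, bcod = p, bmap = pid (carrier p)\<rparr>"

definition vcomp ::
  "('j, 'b, 'k, 'e, 'c, 'f, 'd, 'g) bicell \<Rightarrow> ('i, 'a, 'j, 'b, 'c, 'f, 'd, 'g) bicell \<Rightarrow>
   ('i, 'a, 'k, 'e, 'c, 'f, 'd, 'g) bicell" (infixl "\<circ>\<^sub>b" 55) where
  "\<psi> \<circ>\<^sub>b \<phi> = \<lparr>bdom = bdom \<phi>, bcod = bcod \<psi>, bmap = bmap \<psi> \<circ>\<^sub>p bmap \<phi>\<rparr>"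

definition hcomp ::
  "('i, 'a, 'j, 'b, 'c, 'f, 'd, 'g) bicell \<Rightarrow> ('k, 'u, 'l, 'v, 'd, 'g, 'e, 'h) bicell \<Rightarrow>
   ('i \<times> ('a \<Rightarrow> 'k), ('a \<times> 'u) set, 'j \<times> ('b \<Rightarrow> 'l), ('b \<times> 'v) set, 'c, 'f, 'e, 'h) bicell"
  (infixl "\<odot>\<^sub>b" 70) where
  "\<phi> \<odot>\<^sub>b \<psi> = \<lparr>bdom = bdom \<phi> \<odot> bdom \<psi>, bcod = bcod \<phi> \<odot> bcod \<psi>,
     bmap = pfactor (bincl (bcod \<phi>) (bcod \<psi>))
       ((bmap \<phi> \<lhd>\<^sub>m bmap \<psi>) \<circ>\<^sub>p bincl (bdom \<phi>) (bdom \<psi>))\<rparr>"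

text \<open>
  The structural isomorphisms; all are induced by those of the composition product.
  \<open>lunitor_inv p\<close> goes from \<open>p\<close> to \<open>c \<odot> p\<close> and \<open>runitor_inv p\<close> from \<open>p\<close> to \<open>p \<odot> d\<close>.
\<close>

definition lunitor_inv ::
  "('i, 'a, 'c, 'f, 'd, 'g) bicom \<Rightarrow>
   ('i, 'a, 'c \<times> ('f \<Rightarrow> 'i), ('f \<times> 'a) set, 'c, 'f, 'd, 'g) bicell" where
  "lunitor_inv p = \<lparr>bdom = p, bcod = bid (lbase p) \<odot> p,
     bmap = pfactor (bincl (bid (lbase p)) p) (lcoact p)\<rparr>"

definition runitor_inv ::
  "('i, 'a, 'c, 'f, 'd, 'g) bicom \<Rightarrow>
   ('i, 'a, 'i \<times> ('a \<Rightarrow> 'd), ('a \<times> 'g) set, 'c, 'f, 'd, 'g) bicell" where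
  "runitor_inv p = \<lparr>bdom = p, bcod = p \<odot> bid (rbase p),
     bmap = pfactor (bincl p (bid (rbase p))) (rcoact p)\<rparr>"

definition assoc ::
  "('i, 'a, 'c, 'f, 'd, 'g) bicom \<Rightarrow> ('j, 'b, 'd, 'g, 'e, 'h) bicom \<Rightarrow>
   ('k, 'u, 'e, 'h, 'l, 'v) bicom \<Rightarrow>
   (('i \<times> ('a \<Rightarrow> 'j)) \<times> (('a \<times> 'b) set \<Rightarrow> 'k), (('a \<times> 'b) set \<times> 'u) set,
    'i \<times> ('a \<Rightarrow> 'j \<times> ('b \<Rightarrow> 'k)), ('a \<times> ('b \<times> 'u) set) set, 'c, 'f, 'l, 'v) bicell" where
  "assoc p q r = \<lparr>bdom = (p \<odot> q) \<odot> r, bcod = p \<odot> (q \<odot> r),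
     bmap = pfactor ((pid (carrier p) \<lhd>\<^sub>m bincl q r) \<circ>\<^sub>p bincl p (q \<odot> r))
       (passoc (carrier p) (carrier q) (carrier r)
          \<circ>\<^sub>p (bincl p q \<lhd>\<^sub>m pid (carrier r)) \<circ>\<^sub>p bincl (p \<odot> q) r)\<rparr>"

definition assoc_inv ::
  "('i, 'a, 'c, 'f, 'd, 'g) bicom \<Rightarrow> ('j, 'b, 'd, 'g, 'e, 'h) bicom \<Rightarrow>
   ('k, 'u, 'e, 'h, 'l, 'v) bicom \<Rightarrow>
   ('i \<times> ('a \<Rightarrow> 'j \<times> ('b \<Rightarrow> 'k)), ('a \<times> ('b \<times> 'u) set) set,
    ('i \<times> ('a \<Rightarrow> 'j)) \<times> (('a \<times> 'b) set \<Rightarrow> 'k), (('a \<times> 'b) set \<times> 'u) set, 'c, 'f, 'l, 'v) bicell" where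
  "assoc_inv p q r = \<lparr>bdom = p \<odot> (q \<odot> r), bcod = (p \<odot> q) \<odot> r,
     bmap = pfactor ((bincl p q \<lhd>\<^sub>m pid (carrier r)) \<circ>\<^sub>p bincl (p \<odot> q) r)
       (passoc_inv (carrier p) (carrier q) (carrier r)
          \<circ>\<^sub>p (pid (carrier p) \<lhd>\<^sub>m bincl q r) \<circ>\<^sub>p bincl p (q \<odot> r))\<rparr>"

section \<open>Monads, modules, comonads, comodules\<close>

definition monad_on ::
  "('c, 'f) comonoid \<Rightarrow> ('i, 'a, 'c, 'f, 'c, 'f) bicom \<Rightarrow>
   ('c, 'f, 'i, 'a, 'c, 'f, 'c, 'f) bicell \<Rightarrow>
   ('i \<times> ('a \<Rightarrow> 'i), ('a \<times> 'a) set, 'i, 'a, 'c, 'f, 'c, 'f) bicell \<Rightarrow> bool" where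
  "monad_on c m \<eta> \<mu> \<longleftrightarrow>
     bicomodule c c m \<and> \<eta> \<in> bicells (bid c) m \<and> \<mu> \<in> bicells (m \<odot> m) m \<and>
     \<mu> \<circ>\<^sub>b (\<eta> \<odot>\<^sub>b cid m) \<circ>\<^sub>b lunitor_inv m = cid m \<and>
     \<mu> \<circ>\<^sub>b (cid m \<odot>\<^sub>b \<eta>) \<circ>\<^sub>b runitor_inv m = cid m \<and>
     \<mu> \<circ>\<^sub>b (\<mu> \<odot>\<^sub>b cid m) = \<mu> \<circ>\<^sub>b (cid m \<odot>\<^sub>b \<mu>) \<circ>\<^sub>b assoc m m m"

definition comonad_on ::
  "('d, 'g) comonoid \<Rightarrow> ('i, 'a, 'd, 'g, 'd, 'g) bicom \<Rightarrow>
   ('i, 'a, 'd, 'g, 'd, 'g, 'd, 'g) bicell \<Rightarrow>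
   ('i, 'a, 'i \<times> ('a \<Rightarrow> 'i), ('a \<times> 'a) set, 'd, 'g, 'd, 'g) bicell \<Rightarrow> bool" where
  "comonad_on d e \<epsilon> \<delta> \<longleftrightarrow>
     bicomodule d d e \<and> \<epsilon> \<in> bicells e (bid d) \<and> \<delta> \<in> bicells e (e \<odot> e) \<and>
     (\<epsilon> \<odot>\<^sub>b cid e) \<circ>\<^sub>b \<delta> = lunitor_inv e \<and>
     (cid e \<odot>\<^sub>b \<epsilon>) \<circ>\<^sub>b \<delta> = runitor_inv e \<and>
     assoc e e e \<circ>\<^sub>b (\<delta> \<odot>\<^sub>b cid e) \<circ>\<^sub>b \<delta> = (cid e \<odot>\<^sub>b \<delta>) \<circ>\<^sub>b \<delta>"

definition left_module ::
  "('c, 'f) comonoid \<Rightarrow> ('d, 'g) comonoid \<Rightarrow> ('i, 'a, 'c, 'f, 'c, 'f) bicom \<Rightarrow>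
   ('c, 'f, 'i, 'a, 'c, 'f, 'c, 'f) bicell \<Rightarrow>
   ('i \<times> ('a \<Rightarrow> 'i), ('a \<times> 'a) set, 'i, 'a, 'c, 'f, 'c, 'f) bicell \<Rightarrow>
   ('j, 'b, 'c, 'f, 'd, 'g) bicom \<Rightarrow>
   ('i \<times> ('a \<Rightarrow> 'j), ('a \<times> 'b) set, 'j, 'b, 'c, 'f, 'd, 'g) bicell \<Rightarrow> bool" where
  "left_module c b m \<eta> \<mu> x \<psi> \<longleftrightarrow>
     monad_on c m \<eta> \<mu> \<and> bicomodule c b x \<and> \<psi> \<in> bicells (m \<odot> x) x \<and>
     \<psi> \<circ>\<^sub>b (\<eta> \<odot>\<^sub>b cid x) \<circ>\<^sub>b lunitor_inv x = cid x \<and>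
     \<psi> \<circ>\<^sub>b (\<mu> \<odot>\<^sub>b cid x) = \<psi> \<circ>\<^sub>b (cid m \<odot>\<^sub>b \<psi>) \<circ>\<^sub>b assoc m m x"

definition left_comodule ::
  "('d, 'g) comonoid \<Rightarrow> ('e, 'h) comonoid \<Rightarrow> ('i, 'a, 'd, 'g, 'd, 'g) bicom \<Rightarrow>
   ('i, 'a, 'd, 'g, 'd, 'g, 'd, 'g) bicell \<Rightarrow>
   ('i, 'a, 'i \<times> ('a \<Rightarrow> 'i), ('a \<times> 'a) set, 'd, 'g, 'd, 'g) bicell \<Rightarrow>
   ('j, 'b, 'd, 'g, 'e, 'h) bicom \<Rightarrow>
   ('j, 'b, 'i \<times> ('a \<Rightarrow> 'j), ('a \<times> 'b) set, 'd, 'g, 'e, 'h) bicell \<Rightarrow> bool" where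
  "left_comodule d b e \<epsilon> \<delta> z \<sigma> \<longleftrightarrow>
     comonad_on d e \<epsilon> \<delta> \<and> bicomodule d b z \<and> \<sigma> \<in> bicells z (e \<odot> z) \<and>
     (\<epsilon> \<odot>\<^sub>b cid z) \<circ>\<^sub>b \<sigma> = lunitor_inv z \<and>
     assoc e e z \<circ>\<^sub>b (\<delta> \<odot>\<^sub>b cid z) \<circ>\<^sub>b \<sigma> = (cid e \<odot>\<^sub>b \<sigma>) \<circ>\<^sub>b \<sigma>"

section \<open>The right coclosure\<close>

text \<open>The empty category \<open>0\<close>.\<close>

definition zero_comonoid :: "(unit, unit) comonoid" where
  "zero_comonoid = (let z = \<lparr>pos = {}, dirs = (\<lambda>_. {})\<rparr> in
     \<lparr>cpoly = z, counit = mk_pmap z yon (\<lambda>I. I) (\<lambda>_ i. i),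
      comult = mk_pmap z (z \<lhd> z) (\<lambda>I. (I, \<lambda>_. I)) (\<lambda>_. fst)\<rparr>)"

text \<open>
  For a \<open>(c, d)\<close>-bicomodule \<open>p\<close> and \<open>I \<in> p(1)\<close>, the right coaction sends the position \<open>I\<close> to
  \<open>(I, cod)\<close>, where \<open>cod i\<close> is the object over which \<open>i \<in> p[I]\<close> lies, and a direction \<open>(i, f)\<close> to
  the action of the morphism \<open>f\<close> on \<open>i\<close>.  This is the \<open>d\<close>-copresheaf structure on \<open>p[I]\<close>, here as a
  \<open>(d, 0)\<close>-bicomodule whose carrier is the constant polynomial \<open>p[I]\<close>.
\<close>

definition fiber ::
  "('i, 'a, 'c, 'f, 'd, 'g) bicom \<Rightarrow> 'i \<Rightarrow> ('a, unit, 'd, 'g, unit, unit) bicom" where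
  "fiber p I = (let S = \<lparr>pos = dirs (carrier p) I, dirs = (\<lambda>_. {})\<rparr>; d = rbase p in
     \<lparr>lbase = d, rbase = zero_comonoid, carrier = S,
      lcoact = mk_pmap S (cpoly d \<lhd> S)
        (\<lambda>i. let D = snd (onpos (rcoact p) I) i
             in (D, \<lambda>f\<in>dirs (cpoly d) D. ondir (rcoact p) I (i, f))) (\<lambda>_. snd),
      rcoact = mk_pmap S (S \<lhd> cpoly zero_comonoid) (\<lambda>i. (i, \<lambda>_. undefined)) (\<lambda>_. fst)\<rparr>)"

text \<open>
  The coclosure of a \<open>(d, e)\<close>-bicomodule \<open>q\<close> and a \<open>(c, e)\<close>-bicomodule \<open>p\<close>, a \<open>(c, d)\<close>-bicomodule.
  Its positions are those of \<open>p\<close>, \<open>p(1)\<close> being the disjoint union of the \<open>p\<^sub>C(1)\<close> over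
  \<open>C \<in> c(1)\<close>.  A direction at \<open>I\<close> is an element \<open>(Q, h)\<close> of the copresheaf \<open>q \<odot> fiber p I\<close>: a position
  \<open>Q\<close> of \<open>q\<close> with a map \<open>h\<close> of copresheaves from \<open>q[Q]\<close> to \<open>p[I]\<close>.  On the left, a morphism \<open>f\<close> out of
  \<open>C\<close> acts on positions as it does for \<open>p\<close>, and contravariantly on directions by postcomposition with
  the map from \<open>p[I f]\<close> to \<open>p[I]\<close> given by the coaction of \<open>p\<close>; on the right, \<open>d\<close> acts by the
  copresheaf structure of \<open>q \<odot> fiber p I\<close>.
\<close>

definition coclosure ::
  "('j, 'b, 'd, 'g, 'e, 'h) bicom \<Rightarrow> ('i, 'a, 'c, 'f, 'e, 'h) bicom \<Rightarrow>
   ('i, 'j \<times> ('b \<Rightarrow> 'a), 'c, 'f, 'd, 'g) bicom" where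
  "coclosure q p = (let
       L = \<lparr>pos = pos (carrier p), dirs = (\<lambda>I. pos (carrier (q \<odot> fiber p I)))\<rparr>;
       c = lbase p; d = lbase q
     in \<lparr>lbase = c, rbase = d, carrier = L,
      lcoact = mk_pmap L (cpoly c \<lhd> L) (onpos (lcoact p))
        (\<lambda>I (f, Q, h). (Q, \<lambda>j\<in>dirs (carrier q) Q. ondir (lcoact p) I (f, h j))),
      rcoact = mk_pmap L (L \<lhd> cpoly d)
        (\<lambda>I. (I, \<lambda>s\<in>dirs L I. fst (onpos (lcoact (q \<odot> fiber p I)) s)))
        (\<lambda>I (s, f). snd (onpos (lcoact (q \<odot> fiber p I)) s) f)\<rparr>)"

text \<open>
  The unit \<open>p \<rightarrow> coclosure q p \<odot> q\<close>: a position \<open>I\<close> goes to \<open>(I, (Q, h) \<mapsto> Q)\<close>, and on directions it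
  is the evaluation \<open>((Q, h), j) \<mapsto> h j\<close>.
\<close>

definition coclosure_unit ::
  "('j, 'b, 'd, 'g, 'e, 'h) bicom \<Rightarrow> ('i, 'a, 'c, 'f, 'e, 'h) bicom \<Rightarrow>
   ('i, 'a, 'i \<times> ('j \<times> ('b \<Rightarrow> 'a) \<Rightarrow> 'j), (('j \<times> ('b \<Rightarrow> 'a)) \<times> 'b) set, 'c, 'f, 'e, 'h) bicell" where
  "coclosure_unit q p = (let L = coclosure q p in
     \<lparr>bdom = p, bcod = L \<odot> q,
      bmap = pfactor (bincl L q)
        (mk_pmap (carrier p) (carrier L \<lhd> carrier q)
          (\<lambda>I. (I, \<lambda>s\<in>dirs (carrier L) I. fst s)) (\<lambda>I (s, j). snd s j))\<rparr>)"

text \<open>The unique morphism \<open>coclosure q p \<rightarrow> r\<close> adjoint to \<open>\<phi> : p \<rightarrow> r \<odot> q\<close>.\<close>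

definition coclosure_adj ::
  "('j, 'b, 'd, 'g, 'e, 'h) bicom \<Rightarrow> ('i, 'a, 'c, 'f, 'e, 'h) bicom \<Rightarrow>
   ('k, 'l, 'c, 'f, 'd, 'g) bicom \<Rightarrow>
   ('i, 'a, 'k \<times> ('l \<Rightarrow> 'j), ('l \<times> 'b) set, 'c, 'f, 'e, 'h) bicell \<Rightarrow>
   ('i, 'j \<times> ('b \<Rightarrow> 'a), 'k, 'l, 'c, 'f, 'd, 'g) bicell" where
  "coclosure_adj q p r \<phi> =
     (THE \<theta>. \<theta> \<in> bicells (coclosure q p) r \<and> (\<theta> \<odot>\<^sub>b cid q) \<circ>\<^sub>b coclosure_unit q p = \<phi>)"

subsection \<open>The comonad structure\<close>

text \<open>
  For a \<open>(d, c)\<close>-bicomodule \<open>p\<close> and a monad \<open>m\<close> on \<open>c\<close> with unit \<open>\<eta>\<close> and multiplication \<open>\<mu>\<close>, the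
  counit and comultiplication of \<open>coclosure (p \<odot> m) p\<close>.
\<close>

definition coclosure_counit where
  "coclosure_counit p m \<eta> = coclosure_adj (p \<odot> m) p (bid (lbase p))
     (lunitor_inv (p \<odot> m) \<circ>\<^sub>b (cid p \<odot>\<^sub>b \<eta>) \<circ>\<^sub>b runitor_inv p)"

definition coclosure_comult where
  "coclosure_comult p m \<mu> = (let L = coclosure (p \<odot> m) p; u = coclosure_unit (p \<odot> m) p in
     coclosure_adj (p \<odot> m) p (L \<odot> L)
       (assoc_inv L L (p \<odot> m)
        \<circ>\<^sub>b (cid L \<odot>\<^sub>b (cid L \<odot>\<^sub>b (cid p \<odot>\<^sub>b \<mu>)))
        \<circ>\<^sub>b (cid L \<odot>\<^sub>b (cid L \<odot>\<^sub>b assoc p m m))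
        \<circ>\<^sub>b (cid L \<odot>\<^sub>b assoc L (p \<odot> m) m)
        \<circ>\<^sub>b (cid L \<odot>\<^sub>b (u \<odot>\<^sub>b cid m))
        \<circ>\<^sub>b u))"

end

theory Submission
  imports Defs
begin

text \<open>
  A \<open>(c, d)\<close>-bicomodule \<open>p\<close> sends a \<open>d\<close>-copresheaf \<open>X\<close> to the \<open>c\<close>-copresheaf \<open>p\<langle>X\<rangle>\<close> of pairs of a position
  \<open>I\<close> and a map \<open>p[I] \<rightarrow> X\<close>.  By the Yoneda lemma a bicomodule morphism is determined by its
  components \<open>p\<langle>X\<rangle> \<rightarrow> q\<langle>X\<rangle>\<close>; moreover \<open>(p \<odot> q)\<langle>X\<rangle> \<cong> p\<langle>q\<langle>X\<rangle>\<rangle>\<close>, and this identification turns associators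
  into identities, so every law becomes an equation between functions on sets.

  For \<open>L = coclosure (p \<odot> m) p\<close> one has \<open>L[I] = (p \<odot> m)\<langle>p[I]\<rangle>\<close>, and the unit becomes
  \<open>u : p\<langle>X\<rangle> \<rightarrow> L\<langle>p\<langle>m\<langle>X\<rangle>\<rangle>\<rangle>\<close>, \<open>(I, f) \<mapsto> (I, p\<langle>m\<langle>f\<rangle>\<rangle>)\<close>.  It sends the universal element of \<open>p\<close> at \<open>I\<close> to that
  of \<open>L\<close>, so morphisms out of \<open>L\<close> are determined by their restriction along \<open>u\<close>.  The coaction is
  \<open>\<sigma> = L\<langle>p\<langle>\<psi>\<rangle>\<rangle> \<circ> u\<close>, and the comultiplication satisfies \<open>\<delta> \<circ> u = L\<langle>L\<langle>p\<langle>\<mu>\<rangle>\<rangle> \<circ> u\<rangle> \<circ> u\<close>.  By naturality of \<open>u\<close> and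
  \<open>\<psi> \<circ> \<mu> = \<psi> \<circ> m\<langle>\<psi>\<rangle>\<close>, both \<open>\<delta> \<circ> \<sigma>\<close> and \<open>L\<langle>\<sigma>\<rangle> \<circ> \<sigma>\<close> equal \<open>L\<langle>L\<langle>p\<langle>\<psi> \<circ> \<mu>\<rangle>\<rangle> \<circ> u\<rangle> \<circ> u\<close>.  The comonad laws of
  \<open>L\<close>, restricted along \<open>u\<close>, are the case \<open>x = m\<close> of the comodule laws.
\<close>

section \<open>Polynomial maps and their evaluation\<close>

text \<open>Two features of the definitions force this detour. A composite is an equalizer, so its
  directions are quotient sets; and every coaction or structural cell of a composite is a definite
  description of a factorization, about which nothing is known until a factorization has been
  exhibited. Doing this with nested equivalence classes would be unmanageable. A map out of a
  quotient, by contrast, is just a compatible map, which is why the classes disappear under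
  evaluation at \<open>X\<close>.

  HOL does not quantify over types inside a statement, so a hypothesis ranging over all copresheaves
  cannot be written. The criteria for cells therefore test at the copresheaves
  \<open>fib p I\<close> only, on the type of directions of the source; this suffices because
  \<open>p\<langle>p[I]\<rangle>\<close> contains the universal element at \<open>I\<close>.

  One comonad law is not a comodule law for \<open>x = m\<close>: applying the counit to the first
  factor of \<open>L \<odot> L\<close> leads to the right unit law of the monad, whereas a left
  module only knows the left unit law and associativity.\<close>

text \<open>
  The value \<open>P(X)\<close> consists of pairs \<open>(I, f)\<close> with \<open>f : dirs P I \<rightarrow> X\<close>; here \<open>X\<close> is a whole type, so
  that \<open>pelts P\<close> only asks \<open>f\<close> to be extensional.  \<open>peval \<phi>\<close> is the component at \<open>X\<close> of the natural
  transformation \<open>\<phi>\<close>, \<open>papp P h\<close> is \<open>P(h)\<close>, \<open>pgen P I\<close> is the universal element of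
  \<open>P(dirs P I)\<close>, and \<open>nest\<close> is the isomorphism \<open>(P \<lhd> Q)(X) \<cong> P(Q(X))\<close>.
\<close>

definition peval :: "('i, 'a, 'j, 'b) pmap \<Rightarrow> 'i \<times> ('a \<Rightarrow> 'x) \<Rightarrow> 'j \<times> ('b \<Rightarrow> 'x)" where
  "peval \<phi> = (\<lambda>(I, f). (onpos \<phi> I, \<lambda>j\<in>dirs (pcod \<phi>) (onpos \<phi> I). f (ondir \<phi> I j)))"

definition papp :: "('i, 'a) poly \<Rightarrow> ('x \<Rightarrow> 'y) \<Rightarrow> 'i \<times> ('a \<Rightarrow> 'x) \<Rightarrow> 'i \<times> ('a \<Rightarrow> 'y)" where
  "papp P h = (\<lambda>(I, f). (I, \<lambda>i\<in>dirs P I. h (f i)))"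

definition pelts :: "('i, 'a) poly \<Rightarrow> ('i \<times> ('a \<Rightarrow> 'x)) set" where
  "pelts P = {(I, f). I \<in> pos P \<and> f \<in> extensional (dirs P I)}"

definition pgen :: "('i, 'a) poly \<Rightarrow> 'i \<Rightarrow> 'i \<times> ('a \<Rightarrow> 'a)" where
  "pgen P I = (I, \<lambda>i\<in>dirs P I. i)"

definition nest :: "('i, 'a) poly \<Rightarrow> ('j, 'b) poly \<Rightarrow>
    ('i \<times> ('a \<Rightarrow> 'j)) \<times> ('a \<times> 'b \<Rightarrow> 'x) \<Rightarrow> 'i \<times> ('a \<Rightarrow> 'j \<times> ('b \<Rightarrow> 'x))" where
  "nest P Q = (\<lambda>((I, J), f). (I, \<lambda>i\<in>dirs P I. (J i, \<lambda>j\<in>dirs Q (J i). f (i, j))))"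

text \<open>Directions are contravariant: a monomorphism is injective on positions, surjective on directions.\<close>

definition pmono :: "('i, 'a, 'j, 'b) pmap \<Rightarrow> bool" where
  "pmono e \<longleftrightarrow> inj_on (onpos e) (pos (pdom e)) \<and>
     (\<forall>I\<in>pos (pdom e). ondir e I ` dirs (pcod e) (onpos e I) = dirs (pdom e) I)"

lemma phomD:
  assumes "f \<in> phom P Q"
  shows "pdom f = P" "pcod f = Q" "onpos f \<in> extensional (pos P)"
    "ondir f \<in> extensional (pos P)"
  using assms by (auto simp: phom_def PiE_def)

lemma phom_pos: "f \<in> phom P Q \<Longrightarrow> I \<in> pos P \<Longrightarrow> onpos f I \<in> pos Q"
  by (auto simp: phom_def)

lemma phom_dir:
  "f \<in> phom P Q \<Longrightarrow> I \<in> pos P \<Longrightarrow> j \<in> dirs Q (onpos f I) \<Longrightarrow> ondir f I j \<in> dirs P I"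
  by (auto simp: phom_def PiE_def Pi_def)

lemma phom_dir_ext:
  "f \<in> phom P Q \<Longrightarrow> I \<in> pos P \<Longrightarrow> ondir f I \<in> extensional (dirs Q (onpos f I))"
  by (auto simp: phom_def PiE_def Pi_def)

lemma phom_eqI:
  assumes f: "f \<in> phom P Q" and g: "g \<in> phom P Q"
    and pos: "\<And>I. I \<in> pos P \<Longrightarrow> onpos f I = onpos g I"
    and dir: "\<And>I j. I \<in> pos P \<Longrightarrow> j \<in> dirs Q (onpos f I) \<Longrightarrow> ondir f I j = ondir g I j"
  shows "f = g"
proof -
  have "onpos f = onpos g"
    using phomD[OF f] phomD[OF g] pos by (intro extensionalityI) auto
  moreover have "ondir f = ondir g"
  proof (rule extensionalityI[OF phomD(4)[OF f] phomD(4)[OF g]])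
    fix I assume I: "I \<in> pos P"
    show "ondir f I = ondir g I"
      using phom_dir_ext[OF f I] phom_dir_ext[OF g I] pos[OF I] dir[OF I]
      by (intro extensionalityI) auto
  qed
  ultimately show ?thesis
    using phomD[OF f] phomD[OF g] by (intro pmap.equality) auto
qed

section \<open>Polynomial maps in coordinates: identities, composites, composition product\<close>

lemma mk_pmap_simps [simp]:
  "pdom (mk_pmap P Q f g) = P" "pcod (mk_pmap P Q f g) = Q"
  "I \<in> pos P \<Longrightarrow> onpos (mk_pmap P Q f g) I = f I"
  "I \<in> pos P \<Longrightarrow> j \<in> dirs Q (f I) \<Longrightarrow> ondir (mk_pmap P Q f g) I j = g I j"
  by (auto simp: mk_pmap_def)

lemma mk_pmap_phom:
  assumes "\<And>I. I \<in> pos P \<Longrightarrow> f I \<in> pos Q"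
    and "\<And>I j. I \<in> pos P \<Longrightarrow> j \<in> dirs Q (f I) \<Longrightarrow> g I j \<in> dirs P I"
  shows "mk_pmap P Q f g \<in> phom P Q"
  using assms by (auto simp: mk_pmap_def phom_def)

lemma pid_phom [simp]: "pid P \<in> phom P P"
  unfolding pid_def by (rule mk_pmap_phom) auto

lemma pid_simps [simp]:
  "pdom (pid P) = P" "pcod (pid P) = P" "I \<in> pos P \<Longrightarrow> onpos (pid P) I = I"
  "I \<in> pos P \<Longrightarrow> i \<in> dirs P I \<Longrightarrow> ondir (pid P) I i = i"
  by (auto simp: pid_def)

lemma pcomp_phom: "f \<in> phom P Q \<Longrightarrow> g \<in> phom Q R \<Longrightarrow> g \<circ>\<^sub>p f \<in> phom P R"
  unfolding pcomp_def
  by (simp add: phomD, rule mk_pmap_phom) (auto intro: phom_pos phom_dir)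

lemma pcomp_simps:
  assumes "f \<in> phom P Q" "g \<in> phom Q R" "I \<in> pos P"
  shows "onpos (g \<circ>\<^sub>p f) I = onpos g (onpos f I)"
    "k \<in> dirs R (onpos g (onpos f I)) \<Longrightarrow> ondir (g \<circ>\<^sub>p f) I k = ondir f I (ondir g (onpos f I) k)"
  using assms by (auto simp: pcomp_def phomD)

lemma pdom_pcomp [simp]: "pdom (g \<circ>\<^sub>p f) = pdom f" and pcod_pcomp [simp]: "pcod (g \<circ>\<^sub>p f) = pcod g"
  by (auto simp: pcomp_def)

lemma ptri_pos: "pos (P \<lhd> Q) = (SIGMA I:pos P. dirs P I \<rightarrow>\<^sub>E pos Q)"
  and ptri_dirs [simp]: "dirs (P \<lhd> Q) (I, J) = (SIGMA i:dirs P I. dirs Q (J i))"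
  by (auto simp: ptri_def)

lemma ptri_dirs_restrict [simp]:
  "dirs (P \<lhd> Q) (I, restrict J (dirs P I)) = (SIGMA i:dirs P I. dirs Q (J i))"
  by auto

lemma ptri_posI: "I \<in> pos P \<Longrightarrow> J \<in> dirs P I \<rightarrow>\<^sub>E pos Q \<Longrightarrow> (I, J) \<in> pos (P \<lhd> Q)"
  by (auto simp: ptri_pos)

lemma ptri_posE:
  assumes "z \<in> pos (P \<lhd> Q)"
  obtains I J where "z = (I, J)" "I \<in> pos P" "J \<in> dirs P I \<rightarrow>\<^sub>E pos Q"
  using assms by (auto simp: ptri_pos)

lemma ptrim_phom:
  assumes f: "f \<in> phom P P'" and g: "g \<in> phom Q Q'"
  shows "f \<lhd>\<^sub>m g \<in> phom (P \<lhd> Q) (P' \<lhd> Q')"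
  unfolding ptrim_def phomD(1,2)[OF f] phomD(1,2)[OF g]
proof (rule mk_pmap_phom, goal_cases)
  case (1 z)
  then obtain I J where z: "z = (I, J)" "I \<in> pos P" "J \<in> dirs P I \<rightarrow>\<^sub>E pos Q" by (rule ptri_posE)
  have "onpos g (J (ondir f I k)) \<in> pos Q'" if "k \<in> dirs P' (onpos f I)" for k
    using phom_pos[OF g PiE_mem[OF z(3) phom_dir[OF f z(2) that]]] .
  then show ?case using phom_pos[OF f z(2)] by (simp add: z(1) ptri_pos)
next
  case (2 z s)
  from 2(1) obtain I J where z: "z = (I, J)" "I \<in> pos P" "J \<in> dirs P I \<rightarrow>\<^sub>E pos Q" by (rule ptri_posE)
  obtain k l where s: "s = (k, l)" by (cases s)
  have k: "k \<in> dirs P' (onpos f I)" and l: "l \<in> dirs Q' (onpos g (J (ondir f I k)))"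
    using 2(2) by (auto simp: z s)
  show ?case
    using phom_dir[OF f z(2) k] phom_dir[OF g PiE_mem[OF z(3) phom_dir[OF f z(2) k]] l] by (simp add: z s)
qed

lemma ptrim_simps:
  assumes "f \<in> phom P P'" "g \<in> phom Q Q'" "(I, J) \<in> pos (P \<lhd> Q)"
  shows "onpos (f \<lhd>\<^sub>m g) (I, J) = (onpos f I, \<lambda>k\<in>dirs P' (onpos f I). onpos g (J (ondir f I k)))"
    "k \<in> dirs P' (onpos f I) \<Longrightarrow> l \<in> dirs Q' (onpos g (J (ondir f I k))) \<Longrightarrow>
      ondir (f \<lhd>\<^sub>m g) (I, J) (k, l) = (ondir f I k, ondir g (J (ondir f I k)) l)"
  using assms by (auto simp: ptrim_def phomD)

lemma passoc_phom: "passoc P Q R \<in> phom ((P \<lhd> Q) \<lhd> R) (P \<lhd> (Q \<lhd> R))"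
  unfolding passoc_def
  by (rule mk_pmap_phom) (fastforce simp: ptri_pos PiE_iff)+

lemma passoc_simps:
  assumes "((I, J), K) \<in> pos ((P \<lhd> Q) \<lhd> R)"
  shows "onpos (passoc P Q R) ((I, J), K) = (I, \<lambda>i\<in>dirs P I. (J i, \<lambda>j\<in>dirs Q (J i). K (i, j)))"
    "i \<in> dirs P I \<Longrightarrow> j \<in> dirs Q (J i) \<Longrightarrow> k \<in> dirs R (K (i, j)) \<Longrightarrow>
      ondir (passoc P Q R) ((I, J), K) (i, j, k) = ((i, j), k)"
  using assms by (auto simp: passoc_def)

lemma passoc_inv_phom: "passoc_inv P Q R \<in> phom (P \<lhd> (Q \<lhd> R)) ((P \<lhd> Q) \<lhd> R)"
  unfolding passoc_inv_def
proof (rule mk_pmap_phom, goal_cases)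
  case (1 z)
  then obtain I H where z: "z = (I, H)" "I \<in> pos P" "H \<in> dirs P I \<rightarrow>\<^sub>E pos (Q \<lhd> R)"
    by (rule ptri_posE)
  have "fst (H i) \<in> pos Q" "snd (H i) \<in> dirs Q (fst (H i)) \<rightarrow>\<^sub>E pos R" if "i \<in> dirs P I" for i
    using PiE_mem[OF z(3) that] by (auto simp: ptri_pos)
  then have "snd (H i) j \<in> pos R" if "i \<in> dirs P I" "j \<in> dirs Q (fst (H i))" for i j
    using that by (blast intro: PiE_mem)
  moreover have "fst (H i) \<in> pos Q" if "i \<in> dirs P I" for i
    using PiE_mem[OF z(3) that] by (auto simp: ptri_pos)
  ultimately have "(\<lambda>(i, j)\<in>(SIGMA i:dirs P I. dirs Q (fst (H i))). snd (H i) j)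
      \<in> dirs (P \<lhd> Q) (I, \<lambda>i\<in>dirs P I. fst (H i)) \<rightarrow>\<^sub>E pos R"
    and "(I, \<lambda>i\<in>dirs P I. fst (H i)) \<in> pos (P \<lhd> Q)"
    unfolding ptri_dirs_restrict using z(2) by (auto simp: ptri_pos)
  then show ?case
    unfolding z(1) prod.case by (rule ptri_posI[rotated])
next
  case (2 z s)
  from 2(1) obtain I H where z: "z = (I, H)" "I \<in> pos P" "H \<in> dirs P I \<rightarrow>\<^sub>E pos (Q \<lhd> R)"
    by (rule ptri_posE)
  have *: "dirs (Q \<lhd> R) w = (SIGMA j:dirs Q (fst w). dirs R (snd w j))" for w
    by (cases w; simp)
  show ?case
    using 2(2) by (auto simp: z(1) *)
qed

lemma passoc_inv_simps:
  assumes "(I, H) \<in> pos (P \<lhd> (Q \<lhd> R))"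
  shows "onpos (passoc_inv P Q R) (I, H) = ((I, \<lambda>i\<in>dirs P I. fst (H i)),
        \<lambda>(i, j)\<in>(SIGMA i:dirs P I. dirs Q (fst (H i))). snd (H i) j)"
    "i \<in> dirs P I \<Longrightarrow> j \<in> dirs Q (fst (H i)) \<Longrightarrow> k \<in> dirs R (snd (H i) j) \<Longrightarrow>
      ondir (passoc_inv P Q R) (I, H) ((i, j), k) = (i, j, k)"
  using assms by (auto simp: passoc_inv_def)

section \<open>Universal elements and the naturality of evaluation\<close>

lemma pgen_pelts [simp]: "I \<in> pos P \<Longrightarrow> pgen P I \<in> pelts P"
  by (simp add: pgen_def pelts_def)

text \<open>Yoneda: an element of \<open>P(X)\<close> is the image of the universal element under
  its own function part. Naturality of \<open>peval\<close> then carries identities from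
  \<open>pgen\<close> to all elements.\<close>

lemma papp_pgen:
  assumes "(I, f) \<in> pelts P" shows "papp P f (pgen P I) = (I, f)"
proof -
  have "(\<lambda>i\<in>dirs P I. f ((\<lambda>i\<in>dirs P I. i) i)) = f"
    by (rule extensionalityI[OF restrict_extensional]) (use assms in \<open>auto simp: pelts_def\<close>)
  then show ?thesis by (simp add: papp_def pgen_def)
qed

lemma papp_pelts: "z \<in> pelts P \<Longrightarrow> papp P h z \<in> pelts P"
  by (auto simp: papp_def pelts_def)

lemma papp_papp: "papp P h (papp P k z) = papp P (\<lambda>x. h (k x)) z"
  by (cases z) (auto simp: papp_def cong: restrict_cong)

lemma peval_pelts: "\<phi> \<in> phom P Q \<Longrightarrow> z \<in> pelts P \<Longrightarrow> peval \<phi> z \<in> pelts Q"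
  by (auto simp: peval_def pelts_def phomD phom_pos)

lemma peval_papp: "\<phi> \<in> phom P Q \<Longrightarrow> z \<in> pelts P \<Longrightarrow> peval \<phi> (papp P h z) = papp Q h (peval \<phi> z)"
  by (cases z) (auto simp: peval_def papp_def pelts_def phomD phom_dir cong: restrict_cong)

lemma peval_pcomp:
  "f \<in> phom P Q \<Longrightarrow> g \<in> phom Q R \<Longrightarrow> z \<in> pelts P \<Longrightarrow> peval (g \<circ>\<^sub>p f) z = peval g (peval f z)"
  by (cases z) (auto simp: peval_def pelts_def phomD pcomp_simps phom_dir phom_pos cong: restrict_cong)

lemma peval_pid:
  assumes "z \<in> pelts P" shows "peval (pid P) z = z"
proof -
  obtain I f where z: "z = (I, f)" by (cases z)
  have "(\<lambda>i\<in>dirs P I. f (ondir (pid P) I i)) = f"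
    by (rule extensionalityI[OF restrict_extensional]) (use assms in \<open>auto simp: pelts_def z\<close>)
  then show ?thesis using assms by (simp add: peval_def pelts_def z)
qed

lemma peval_pgen:
  assumes f: "\<phi> \<in> phom P Q" and I: "I \<in> pos P"
  shows "peval \<phi> (pgen P I) = (onpos \<phi> I, ondir \<phi> I)"
proof -
  have "(\<lambda>j\<in>dirs Q (onpos \<phi> I). (\<lambda>i\<in>dirs P I. i) (ondir \<phi> I j)) = ondir \<phi> I"
    by (rule extensionalityI[OF restrict_extensional phom_dir_ext[OF f I]])
      (simp add: phom_dir[OF f I])
  then show ?thesis by (simp add: peval_def pgen_def phomD[OF f])
qed

text \<open>At \<open>pgen P I\<close> the evaluation returns \<open>onpos\<close> and
  \<open>ondir\<close> at \<open>I\<close> themselves, so these values decide the map.\<close>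

lemma phom_eqI_pgen:
  assumes "f \<in> phom P Q" "g \<in> phom P Q" "\<And>I. I \<in> pos P \<Longrightarrow> peval f (pgen P I) = peval g (pgen P I)"
  shows "f = g"
  using assms by (intro phom_eqI[of f P Q]) (auto simp: peval_pgen)

lemma pid_left:
  assumes "f \<in> phom P Q" shows "pid Q \<circ>\<^sub>p f = f"
  by (rule phom_eqI_pgen[OF pcomp_phom[OF assms pid_phom] assms])
    (simp add: peval_pcomp[OF assms pid_phom] peval_pid peval_pelts[OF assms])

lemma pid_right:
  assumes "f \<in> phom P Q" shows "f \<circ>\<^sub>p pid P = f"
  by (rule phom_eqI_pgen[OF pcomp_phom[OF pid_phom assms] assms])
    (simp add: peval_pcomp[OF pid_phom assms] peval_pid)

lemma pcomp_assoc:
  assumes f: "f \<in> phom P Q" and g: "g \<in> phom Q R" and h: "h \<in> phom R S"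
  shows "(h \<circ>\<^sub>p g) \<circ>\<^sub>p f = h \<circ>\<^sub>p (g \<circ>\<^sub>p f)"
  by (rule phom_eqI_pgen[OF pcomp_phom[OF f pcomp_phom[OF g h]] pcomp_phom[OF pcomp_phom[OF f g] h]])
    (simp add: peval_pcomp[OF f pcomp_phom[OF g h]] peval_pcomp[OF g h] peval_pcomp[OF pcomp_phom[OF f g] h]
      peval_pcomp[OF f g] peval_pelts[OF f])

section \<open>Unnesting the composition product\<close>

lemma nest_eq: "nest P Q (w, f) =
    (fst w, \<lambda>i\<in>dirs P (fst w). (snd w i, \<lambda>j\<in>dirs Q (snd w i). f (i, j)))"
  by (cases w) (simp add: nest_def)

text \<open>\<open>nest\<close> forgets all values off the directions; membership in
  \<open>pelts\<close> makes \<open>J\<close> and the function part extensional, so nothing is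
  lost.\<close>

lemma nest_inj:
  assumes z: "z \<in> pelts (P \<lhd> Q)" "w \<in> pelts (P \<lhd> Q)" and eq: "nest P Q z = nest P Q w"
  shows "z = w"
proof -
  obtain I J f where z': "z = ((I, J), f)" by (cases z) auto
  obtain I' J' f' where w': "w = ((I', J'), f')" by (cases w) auto
  have I: "I' = I" using eq by (auto simp: z' w' nest_def)
  have *: "(J i, \<lambda>j\<in>dirs Q (J i). f (i, j)) = (J' i, \<lambda>j\<in>dirs Q (J' i). f' (i, j))" if "i \<in> dirs P I" for i
    using eq that by (auto simp: z' w' nest_def dest!: fun_cong[where x=i] split: if_splits)
  have J: "J' = J"
    using z * unfolding z' w' I pelts_def ptri_pos
    by (intro extensionalityI[where A="dirs P I"]) (auto simp: PiE_iff)
  have "f (i, j) = f' (i, j)" if "i \<in> dirs P I" "j \<in> dirs Q (J i)" for i j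
    using *[OF that(1)] that(2) unfolding J by (auto dest!: fun_cong[where x=j])
  then have "f = f'"
    using z unfolding z' w' I J pelts_def
    by (intro extensionalityI[where A="dirs (P \<lhd> Q) (I, J)"]) auto
  then show ?thesis by (simp add: z' w' I J)
qed

lemma nest_pelts: "z \<in> pelts (P \<lhd> Q) \<Longrightarrow> nest P Q z \<in> pelts P"
  by (auto simp: nest_def pelts_def ptri_pos)

lemma nest_mem:
  "z \<in> pelts (P \<lhd> Q) \<Longrightarrow> i \<in> dirs P (fst (nest P Q z)) \<Longrightarrow> snd (nest P Q z) i \<in> pelts Q"
  by (auto simp: nest_def pelts_def ptri_pos PiE_iff)

lemma nest_papp: "z \<in> pelts (P \<lhd> Q) \<Longrightarrow> nest P Q (papp (P \<lhd> Q) h z) = papp P (papp Q h) (nest P Q z)"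
  by (auto simp: nest_def papp_def pelts_def cong: restrict_cong)

lemma nest_ptrim:
  assumes f: "f \<in> phom P P'" and g: "g \<in> phom Q Q'" and z: "z \<in> pelts (P \<lhd> Q)"
  shows "nest P' Q' (peval (f \<lhd>\<^sub>m g) z) = peval f (papp P (peval g) (nest P Q z))"
proof -
  obtain I J k where z': "z = ((I, J), k)" by (cases z) auto
  have IJ: "(I, J) \<in> pos (P \<lhd> Q)" and "I \<in> pos P" using z by (auto simp: z' pelts_def ptri_pos)
  then show ?thesis
    using phom_dir[OF f \<open>I \<in> pos P\<close>]
    by (auto simp: z' peval_def nest_def papp_def ptrim_simps[OF f g IJ] phomD[OF f] phomD[OF g]
        phomD[OF ptrim_phom[OF f g]] phom_dir[OF g] ptri_pos PiE_iff intro!: restrict_ext)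
qed

lemma nest_passoc:
  assumes z: "z \<in> pelts ((P \<lhd> Q) \<lhd> R)"
  shows "papp P (nest Q R) (nest P (Q \<lhd> R) (peval (passoc P Q R) z)) = nest P Q (nest (P \<lhd> Q) R z)"
proof -
  obtain I J K k where z': "z = (((I, J), K), k)" by (metis surj_pair)
  have *: "((I, J), K) \<in> pos ((P \<lhd> Q) \<lhd> R)" using z by (auto simp: z' pelts_def)
  show ?thesis
    by (auto simp: z' peval_def nest_def papp_def passoc_simps[OF *] phomD[OF passoc_phom] intro!: restrict_ext)
qed

lemma nest_passoc_inv:
  assumes z: "z \<in> pelts (P \<lhd> (Q \<lhd> R))"
  shows "nest P Q (nest (P \<lhd> Q) R (peval (passoc_inv P Q R) z)) = papp P (nest Q R) (nest P (Q \<lhd> R) z)"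
proof -
  obtain I H k where z': "z = ((I, H), k)" by (metis surj_pair)
  have *: "(I, H) \<in> pos (P \<lhd> (Q \<lhd> R))" using z by (auto simp: z' pelts_def)
  have ***: "dirs (Q \<lhd> R) w = (SIGMA j:dirs Q (fst w). dirs R (snd w j))" for w
    by (cases w; simp)
  have 1: "nest P (Q \<lhd> R) z = (I, \<lambda>i\<in>dirs P I. (H i, \<lambda>j\<in>dirs (Q \<lhd> R) (H i). k (i, j)))"
    by (simp add: z' nest_def)
  have 2: "nest (P \<lhd> Q) R (peval (passoc_inv P Q R) z) =
     ((I, \<lambda>i\<in>dirs P I. fst (H i)), \<lambda>(i, j)\<in>(SIGMA i:dirs P I. dirs Q (fst (H i))).
        (snd (H i) j, \<lambda>l\<in>dirs R (snd (H i) j). k (i, j, l)))"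
    by (simp add: z' nest_def peval_def passoc_inv_simps[OF *] phomD[OF passoc_inv_phom])
      (rule ext, auto simp: restrict_def passoc_inv_simps[OF *])
  show ?thesis
    unfolding 1 2 by (auto simp: papp_def nest_eq *** intro!: restrict_ext)
qed

section \<open>Monomorphisms and factorization through them\<close>

lemma pmono_surj:
  assumes "e \<in> phom E P" "pmono e" "I \<in> pos E" "i \<in> dirs E I"
  obtains j where "j \<in> dirs P (onpos e I)" "ondir e I j = i"
proof -
  have "i \<in> ondir e I ` dirs P (onpos e I)"
    using assms by (simp add: pmono_def phomD)
  then show ?thesis using that by blast
qed

lemma pmono_inj:
  "e \<in> phom E P \<Longrightarrow> pmono e \<Longrightarrow> I \<in> pos E \<Longrightarrow> J \<in> pos E \<Longrightarrow> onpos e I = onpos e J \<Longrightarrow> I = J"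
  by (auto simp: pmono_def phomD dest: inj_onD)

text \<open>Injectivity on positions recovers the position, and surjectivity on directions exposes
  every value of the function part. Equalities in an equalizer can thus be checked in the ambient
  polynomial.\<close>

lemma pmono_peval_inj:
  assumes e: "e \<in> phom E P" "pmono e" and z: "z \<in> pelts E" "w \<in> pelts E" and eq: "peval e z = peval e w"
  shows "z = w"
proof -
  obtain I f where z': "z = (I, f)" by (cases z)
  obtain I' f' where w': "w = (I', f')" by (cases w)
  have I: "I' = I"
    using pmono_inj[OF e, of I' I] eq z by (simp add: z' w' peval_def pelts_def)
  have "f i = f' i" if "i \<in> dirs E I" for i
  proof -
    have "I \<in> pos E" using z by (simp add: z' pelts_def)
    from pmono_surj[OF e this \<open>i \<in> dirs E I\<close>]
    obtain j where "j \<in> dirs P (onpos e I)" "ondir e I j = i" .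
    moreover have "snd (peval e z) j = snd (peval e w) j" by (simp add: eq)
    ultimately show ?thesis by (simp add: z' w' I peval_def phomD[OF e(1)])
  qed
  then have "f = f'"
    by (intro extensionalityI[where A="dirs E I"]) (use z in \<open>auto simp: z' w' I pelts_def\<close>)
  then show ?thesis by (simp add: z' w' I)
qed

lemma pmono_cancel:
  assumes e: "e \<in> phom E P" "pmono e" and f: "f \<in> phom A E" and g: "g \<in> phom A E" and eq: "e \<circ>\<^sub>p f = e \<circ>\<^sub>p g"
  shows "f = g"
proof (rule phom_eqI_pgen[OF f g])
  fix I assume I: "I \<in> pos A"
  have "peval e (peval f (pgen A I)) = peval e (peval g (pgen A I))"
    unfolding peval_pcomp[OF f e(1) pgen_pelts[OF I], symmetric] peval_pcomp[OF g e(1) pgen_pelts[OF I], symmetric] eq ..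
  then show "peval f (pgen A I) = peval g (pgen A I)"
    by (rule pmono_peval_inj[OF e peval_pelts[OF f pgen_pelts[OF I]] peval_pelts[OF g pgen_pelts[OF I]]])
qed

text \<open>Uniqueness, by \<open>pmono_cancel\<close>, turns the definite description into any
  factorization that has been exhibited.\<close>

lemma pfactor_eq:
  assumes "e \<in> phom E P" "pmono e" "g \<in> phom A E" "e \<circ>\<^sub>p g = h"
  shows "pfactor e h = g"
  unfolding pfactor_def
proof (rule the_equality)
  have "pdom h = A" "pdom e = E" using assms by (auto simp: phomD)
  then show "g \<in> phom (pdom h) (pdom e) \<and> e \<circ>\<^sub>p g = h" using assms by auto
  show "g' = g" if "g' \<in> phom (pdom h) (pdom e) \<and> e \<circ>\<^sub>p g' = h" for g'
    using that assms pmono_cancel[OF assms(1,2), of g' A g] \<open>pdom h = A\<close> \<open>pdom e = E\<close> by auto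
qed

text \<open>Existence criterion: the positions of \<open>h\<close> lie in the image of
  \<open>e\<close>, and each direction map of \<open>h\<close> is constant on the fibres of the
  corresponding direction map of \<open>e\<close>, which is onto.\<close>

lemma pfactor_pmono:
  assumes e: "e \<in> phom E P" "pmono e" and h: "h \<in> phom A P"
    and fac: "\<And>I. I \<in> pos A \<Longrightarrow> \<exists>K\<in>pos E. onpos e K = onpos h I \<and>
      (\<forall>i\<in>dirs P (onpos h I). \<forall>j\<in>dirs P (onpos h I). ondir e K i = ondir e K j \<longrightarrow> ondir h I i = ondir h I j)"
  shows "pfactor e h \<in> phom A E" "e \<circ>\<^sub>p pfactor e h = h"
proof -
  obtain K where K: "\<And>I. I \<in> pos A \<Longrightarrow> K I \<in> pos E" "\<And>I. I \<in> pos A \<Longrightarrow> onpos e (K I) = onpos h I"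
    "\<And>I i j. I \<in> pos A \<Longrightarrow> i \<in> dirs P (onpos h I) \<Longrightarrow> j \<in> dirs P (onpos h I) \<Longrightarrow>
       ondir e (K I) i = ondir e (K I) j \<Longrightarrow> ondir h I i = ondir h I j"
    using fac by metis
  \<comment> \<open>A section of the surjective direction map of \<open>e\<close>; constancy on
    fibres makes the choice of preimage immaterial.\<close>
  define r where "r I k = (SOME i. i \<in> dirs P (onpos h I) \<and> ondir e (K I) i = k)" for I k
  have r: "r I k \<in> dirs P (onpos h I)" "ondir e (K I) (r I k) = k" if "I \<in> pos A" "k \<in> dirs E (K I)" for I k
  proof -
    have "\<exists>i. i \<in> dirs P (onpos h I) \<and> ondir e (K I) i = k"
      using pmono_surj[OF e K(1)[OF that(1)] that(2)] K(2)[OF that(1)] by metis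
    then have "r I k \<in> dirs P (onpos h I) \<and> ondir e (K I) (r I k) = k"
      unfolding r_def by (rule someI_ex)
    then show "r I k \<in> dirs P (onpos h I)" "ondir e (K I) (r I k) = k" by auto
  qed
  define g where "g = mk_pmap A E K (\<lambda>I k. ondir h I (r I k))"
  have g: "g \<in> phom A E"
    unfolding g_def using K r by (intro mk_pmap_phom) (auto intro: phom_dir[OF h])
  have eg: "e \<circ>\<^sub>p g = h"
  proof (rule phom_eqI[OF pcomp_phom[OF g e(1)] h])
    fix I assume I: "I \<in> pos A"
    show 1: "onpos (e \<circ>\<^sub>p g) I = onpos h I"
      using I K by (simp add: pcomp_simps[OF g e(1)]) (simp add: g_def)
    fix j assume "j \<in> dirs P (onpos (e \<circ>\<^sub>p g) I)"
    then have j: "j \<in> dirs P (onpos h I)" by (simp add: 1)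
    have gI: "onpos g I = K I" using I by (simp add: g_def)
    have kE: "ondir e (K I) j \<in> dirs E (K I)"
      using phom_dir[OF e(1) K(1)[OF I]] j K(2)[OF I] by simp
    have "ondir (e \<circ>\<^sub>p g) I j = ondir h I (r I (ondir e (K I) j))"
      using I j K kE by (simp add: pcomp_simps[OF g e(1)] gI) (simp add: g_def)
    also have "\<dots> = ondir h I j"
      using K(3)[OF I r(1)[OF I kE] j r(2)[OF I kE]] .
    finally show "ondir (e \<circ>\<^sub>p g) I j = ondir h I j" .
  qed
  have "pfactor e h = g" by (rule pfactor_eq[OF e g eg])
  then show "pfactor e h \<in> phom A E" "e \<circ>\<^sub>p pfactor e h = h" using g eg by auto
qed

text \<open>Lifting the images of the universal elements is enough: the function part of
  \<open>t I\<close> serves as the direction map of the factorization, so \<open>ondir h I\<close>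
  is constant on the fibres of \<open>ondir e K\<close>.\<close>

lemma pfactor_peval:
  assumes e: "e \<in> phom E P" "pmono e" and h: "h \<in> phom A P"
    and t: "\<And>I. I \<in> pos A \<Longrightarrow> t I \<in> pelts E" "\<And>I. I \<in> pos A \<Longrightarrow> peval e (t I) = peval h (pgen A I)"
  shows "pfactor e h \<in> phom A E" "e \<circ>\<^sub>p pfactor e h = h"
proof -
  have *: "\<exists>K\<in>pos E. onpos e K = onpos h I \<and>
      (\<forall>i\<in>dirs P (onpos h I). \<forall>j\<in>dirs P (onpos h I). ondir e K i = ondir e K j \<longrightarrow> ondir h I i = ondir h I j)"
    if I: "I \<in> pos A" for I
  proof -
    obtain K f where Kf: "t I = (K, f)" by (cases "t I")
    have "onpos e K = onpos h I" and K: "K \<in> pos E"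
      and d: "(\<lambda>j\<in>dirs P (onpos e K). f (ondir e K j)) = ondir h I"
      using t[OF I] unfolding peval_pgen[OF h I] by (auto simp: Kf peval_def pelts_def phomD[OF e(1)])
    moreover have "ondir h I i = f (ondir e K i)" if "i \<in> dirs P (onpos h I)" for i
      using that \<open>onpos e K = onpos h I\<close> by (simp flip: d)
    ultimately show ?thesis by (intro bexI[of _ K]) auto
  qed
  show "pfactor e h \<in> phom A E" "e \<circ>\<^sub>p pfactor e h = h"
    using pfactor_pmono[OF e h *] by blast+
qed

lemma pmono_pcomp:
  assumes "f \<in> phom P Q" "g \<in> phom Q R" "pmono f" "pmono g"
  shows "pmono (g \<circ>\<^sub>p f)"
proof -
  have "inj_on (onpos (g \<circ>\<^sub>p f)) (pos P)"
    using assms by (auto simp: inj_on_def pcomp_simps[OF assms(1,2)] pmono_def phomD phom_pos)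
  moreover have "ondir (g \<circ>\<^sub>p f) I ` dirs R (onpos (g \<circ>\<^sub>p f) I) = dirs P I" if I: "I \<in> pos P" for I
  proof -
    have "ondir (g \<circ>\<^sub>p f) I ` dirs R (onpos (g \<circ>\<^sub>p f) I) =
        ondir f I ` ondir g (onpos f I) ` dirs R (onpos g (onpos f I))"
      using I unfolding image_image
      by (intro image_cong) (auto simp: pcomp_simps[OF assms(1,2) I])
    also have "\<dots> = dirs P I"
      using assms I by (auto simp: pmono_def phomD phom_pos)
    finally show ?thesis .
  qed
  ultimately show ?thesis using assms by (auto simp: pmono_def phomD)
qed

text \<open>Injectivity on positions already uses surjectivity of \<open>f\<close> on directions:
  the value \<open>J i\<close> is visible in the image only at some \<open>k\<close> with
  \<open>ondir f I k = i\<close>.\<close>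

lemma pmono_ptrim:
  assumes f: "f \<in> phom P P'" "pmono f" and g: "g \<in> phom Q Q'" "pmono g"
  shows "pmono (f \<lhd>\<^sub>m g)"
proof -
  note fg = ptrim_phom[OF f(1) g(1)]
  have fim: "\<exists>k\<in>dirs P' (onpos f I). ondir f I k = i" if "I \<in> pos P" "i \<in> dirs P I" for I i
    using pmono_surj[OF f that] by metis
  have gim: "\<exists>k\<in>dirs Q' (onpos g I). ondir g I k = i" if "I \<in> pos Q" "i \<in> dirs Q I" for I i
    using pmono_surj[OF g that] by metis
  have "inj_on (onpos (f \<lhd>\<^sub>m g)) (pos (P \<lhd> Q))"
  proof (rule inj_onI)
    fix z w assume z: "z \<in> pos (P \<lhd> Q)" and w: "w \<in> pos (P \<lhd> Q)"
      and eq: "onpos (f \<lhd>\<^sub>m g) z = onpos (f \<lhd>\<^sub>m g) w"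
    from z obtain I J where z': "z = (I, J)" "I \<in> pos P" "J \<in> dirs P I \<rightarrow>\<^sub>E pos Q" by (rule ptri_posE)
    from w obtain I' J' where w': "w = (I', J')" "I' \<in> pos P" "J' \<in> dirs P I' \<rightarrow>\<^sub>E pos Q" by (rule ptri_posE)
    have "onpos f I = onpos f I'"
      using eq z w by (simp add: z'(1) w'(1) ptrim_simps[OF f(1) g(1)])
    then have I: "I' = I" using pmono_inj[OF f z'(2) w'(2)] by simp
    have "J i = J' i" if i: "i \<in> dirs P I" for i
    proof -
      obtain k where k: "k \<in> dirs P' (onpos f I)" "ondir f I k = i" using fim z' i by blast
      have "onpos g (J i) = onpos g (J' i)"
        using arg_cong[OF eq, of "\<lambda>w. snd w k"] z w k
        by (simp add: z'(1) w'(1) I ptrim_simps[OF f(1) g(1)])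
      then show ?thesis
        using pmono_inj[OF g PiE_mem[OF z'(3) i] PiE_mem[OF w'(3)[unfolded I] i]] by simp
    qed
    then have "J = J'" using PiE_ext[OF z'(3) w'(3)[unfolded I]] by blast
    then show "z = w" by (simp add: z' w' I)
  qed
  moreover have "ondir (f \<lhd>\<^sub>m g) z ` dirs (P' \<lhd> Q') (onpos (f \<lhd>\<^sub>m g) z) = dirs (P \<lhd> Q) z"
    if z: "z \<in> pos (P \<lhd> Q)" for z
  proof
    show "ondir (f \<lhd>\<^sub>m g) z ` dirs (P' \<lhd> Q') (onpos (f \<lhd>\<^sub>m g) z) \<subseteq> dirs (P \<lhd> Q) z"
      using phom_dir[OF fg z] by auto
    obtain I J where z': "z = (I, J)" "I \<in> pos P" "J \<in> dirs P I \<rightarrow>\<^sub>E pos Q" using z by (rule ptri_posE)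
    show "dirs (P \<lhd> Q) z \<subseteq> ondir (f \<lhd>\<^sub>m g) z ` dirs (P' \<lhd> Q') (onpos (f \<lhd>\<^sub>m g) z)"
    proof
      fix s assume "s \<in> dirs (P \<lhd> Q) z"
      then obtain i j where s: "s = (i, j)" "i \<in> dirs P I" "j \<in> dirs Q (J i)" by (auto simp: z')
      obtain k where k: "k \<in> dirs P' (onpos f I)" "ondir f I k = i" using fim z' s by blast
      obtain l where l: "l \<in> dirs Q' (onpos g (J i))" "ondir g (J i) l = j"
        using gim[of "J i" j] z' s by auto
      show "s \<in> ondir (f \<lhd>\<^sub>m g) z ` dirs (P' \<lhd> Q') (onpos (f \<lhd>\<^sub>m g) z)"
        using z k l by (intro image_eqI[of _ _ "(k, l)"])
          (auto simp: z'(1) s(1) ptrim_simps[OF f(1) g(1)])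
    qed
  qed
  ultimately show ?thesis using fg by (auto simp: pmono_def phomD)
qed

lemma pmono_pid [simp]: "pmono (pid P)"
proof -
  have "ondir (pid P) I ` dirs P I = dirs P I" if "I \<in> pos P" for I
    using that by (auto simp: image_iff)
  then show ?thesis by (auto simp: pmono_def inj_on_def)
qed

section \<open>Bicomodules in terms of elements\<close>

text \<open>
  The morphism \<open>f\<close> out of the object \<open>lob p I\<close> sends the position \<open>I\<close> to \<open>lact p I f\<close> and comes with
  the map \<open>lback p I f\<close> from \<open>p[lact p I f]\<close> back to \<open>p[I]\<close>; \<open>rob p I\<close> and \<open>ract p I\<close> form the
  copresheaf structure on \<open>p[I]\<close>.  \<open>ccod\<close>, \<open>cidm\<close> and \<open>ccmp\<close> (in diagrammatic order) are the
  codomains, identities and composites of the category given by a comonoid.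
\<close>

definition ccod where "ccod c C f = snd (onpos (comult c) C) f"
definition cidm where "cidm c C = ondir (counit c) C ()"
definition ccmp where "ccmp c C f g = ondir (comult c) C (f, g)"
definition lob where "lob p I = fst (onpos (lcoact p) I)"
definition lact where "lact p I f = snd (onpos (lcoact p) I) f"
definition lback where "lback p I f i = ondir (lcoact p) I (f, i)"
definition rob where "rob p I i = snd (onpos (rcoact p) I) i"
definition ract where "ract p I i g = ondir (rcoact p) I (i, g)"

lemma restrict_eq_iff: "restrict f A = restrict g A \<longleftrightarrow> (\<forall>i\<in>A. f i = g i)"
  by (metis restrict_apply' restrict_ext)

text \<open>Unnested elements have normal forms of this shape, nested several levels deep. Splitting
  an equation between them layer by layer produces the equations for objects, positions and
  directions that make up the laws below.\<close>

lemma pair_restrict_eq_iff: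
  "(a, restrict f (dirs P a)) = (b, restrict g (dirs P b)) \<longleftrightarrow> a = b \<and> (\<forall>i\<in>dirs P a. f i = g i)"
  by (auto simp: restrict_eq_iff)

lemma nest_pgen:
  assumes l: "l \<in> phom P (A \<lhd> B)" and I: "I \<in> pos P"
  shows "nest A B (peval l (pgen P I)) = (fst (onpos l I), \<lambda>f\<in>dirs A (fst (onpos l I)).
    (snd (onpos l I) f, \<lambda>i\<in>dirs B (snd (onpos l I) f). ondir l I (f, i)))"
  by (simp add: peval_pgen[OF l I] nest_eq)

lemma nest_peval:
  assumes l: "l \<in> phom P (A \<lhd> B)" and z: "(I, k) \<in> pelts P"
  shows "nest A B (peval l (I, k)) = papp A (papp B k) (nest A B (peval l (pgen P I)))"
proof -
  have I: "pgen P I \<in> pelts P" using z by (simp add: pgen_def pelts_def)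
  have "peval l (I, k) = papp (A \<lhd> B) k (peval l (pgen P I))"
    using peval_papp[OF l I, of k] papp_pgen[OF z] by simp
  then show ?thesis by (simp add: nest_papp[OF peval_pelts[OF l I]])
qed

lemma phom_eq_iff_pgen:
  assumes "f \<in> phom P Q" "g \<in> phom P Q"
  shows "f = g \<longleftrightarrow> (\<forall>I\<in>pos P. peval f (pgen P I) = peval g (pgen P I))"
  using phom_eqI_pgen[OF assms] by auto

section \<open>Counit, coassociativity and compatibility laws as equations between elements\<close>

lemma plunit_phom: "plunit P \<in> phom (yon \<lhd> P) P"
  unfolding plunit_def by (rule mk_pmap_phom) (auto simp: ptri_pos yon_def)

lemma prunit_phom: "prunit P \<in> phom (P \<lhd> yon) P"
  unfolding prunit_def by (rule mk_pmap_phom) (auto simp: ptri_pos yon_def)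

lemma dirs_yon [simp]: "dirs yon u = {()}"
  by (simp add: yon_def)

lemma peval_plunit:
  assumes "z \<in> pelts (yon \<lhd> P)" shows "peval (plunit P) z = snd (nest yon P z) ()"
proof -
  obtain I J f where z: "z = ((I, J), f)" by (metis surj_pair)
  with assms have "(I, J) \<in> pos (yon \<lhd> P)" by (auto simp: pelts_def)
  then show ?thesis
    by (auto simp: z peval_def nest_def plunit_def intro!: restrict_ext)
qed

lemma peval_prunit:
  assumes "z \<in> pelts (P \<lhd> yon)" shows "peval (prunit P) z = papp P (\<lambda>w. snd w ()) (nest P yon z)"
proof -
  obtain I J f where z: "z = ((I, J), f)" by (metis surj_pair)
  with assms have "(I, J) \<in> pos (P \<lhd> yon)" by (auto simp: pelts_def)
  then show ?thesis
    by (auto simp: z peval_def nest_def prunit_def papp_def intro!: restrict_ext)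
qed

lemma papp_peval_pid:
  assumes "z \<in> pelts (A \<lhd> B)" shows "papp A (peval (pid B)) (nest A B z) = nest A B z"
proof -
  obtain I J f where z: "z = ((I, J), f)" by (metis surj_pair)
  show ?thesis using assms nest_mem[OF assms]
    by (auto simp: z nest_def papp_def peval_pid intro!: restrict_ext)
qed

lemma nest_ptrim_pid_right:
  assumes f: "f \<in> phom P P'" and z: "z \<in> pelts (P \<lhd> Q)"
  shows "nest P' Q (peval (f \<lhd>\<^sub>m pid Q) z) = peval f (nest P Q z)"
  by (simp add: nest_ptrim[OF f pid_phom z] papp_peval_pid[OF z])

lemma nest_ptrim_pid_left:
  assumes g: "g \<in> phom Q Q'" and z: "z \<in> pelts (P \<lhd> Q)"
  shows "nest P Q' (peval (pid P \<lhd>\<^sub>m g) z) = papp P (peval g) (nest P Q z)"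
  by (simp add: nest_ptrim[OF pid_phom g z] peval_pid papp_pelts[OF nest_pelts[OF z]])

lemma nest_nest_inj:
  assumes z: "z \<in> pelts (P \<lhd> (Q \<lhd> R))" and w: "w \<in> pelts (P \<lhd> (Q \<lhd> R))"
    and eq: "papp P (nest Q R) (nest P (Q \<lhd> R) z) = papp P (nest Q R) (nest P (Q \<lhd> R) w)"
  shows "z = w"
proof -
  obtain I F where zz: "nest P (Q \<lhd> R) z = (I, F)" by (cases "nest P (Q \<lhd> R) z")
  obtain I' G where ww: "nest P (Q \<lhd> R) w = (I', G)" by (cases "nest P (Q \<lhd> R) w")
  have I: "I' = I" using eq by (simp add: zz ww papp_def)
  have "F i = G i" if i: "i \<in> dirs P I" for i
  proof (rule nest_inj)
    show "F i \<in> pelts (Q \<lhd> R)" "G i \<in> pelts (Q \<lhd> R)"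
      using nest_mem[OF z, of i] nest_mem[OF w, of i] i by (auto simp: zz ww I)
    show "nest Q R (F i) = nest Q R (G i)"
      using arg_cong[OF eq, of "\<lambda>v. snd v i"] i by (simp add: zz ww I papp_def)
  qed
  moreover have "F \<in> extensional (dirs P I)" "G \<in> extensional (dirs P I)"
    using nest_pelts[OF z] nest_pelts[OF w] by (auto simp: zz ww I pelts_def)
  ultimately have "F = G" by (metis extensionalityI)
  then show ?thesis using nest_inj[OF z w] by (simp add: zz ww I)
qed

text \<open>At the universal element the counit picks out the value of the coaction at the identity
  morphism; comparison with \<open>pgen P I\<close> gives one equation for positions and one for
  directions.\<close>

lemma lcounit_iff:
  assumes \<epsilon>: "counit c \<in> phom (cpoly c) yon" and l: "l \<in> phom P (cpoly c \<lhd> P)"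
  shows "plunit P \<circ>\<^sub>p (counit c \<lhd>\<^sub>m pid P) \<circ>\<^sub>p l = pid P \<longleftrightarrow>
    (\<forall>I\<in>pos P. snd (onpos l I) (cidm c (fst (onpos l I))) = I \<and>
      (\<forall>i\<in>dirs P I. ondir l I (cidm c (fst (onpos l I)), i) = i))" (is "?f = _ \<longleftrightarrow> ?R")
proof -
  note 1 = ptrim_phom[OF \<epsilon> pid_phom[of P]]
  note 2 = pcomp_phom[OF 1 plunit_phom]
  have "?f \<in> phom P P" by (rule pcomp_phom[OF l 2])
  from phom_eq_iff_pgen[OF this pid_phom]
  have "?f = pid P \<longleftrightarrow> (\<forall>I\<in>pos P. peval ?f (pgen P I) = pgen P I)" by (simp add: peval_pid)
  also have "\<dots> \<longleftrightarrow> ?R"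
  proof (rule ball_cong[OF refl])
    fix I assume I: "I \<in> pos P"
    note r = peval_pelts[OF l pgen_pelts[OF I]]
    have "fst (onpos l I) \<in> pos (cpoly c)" using phom_pos[OF l I] by (auto simp: ptri_pos)
    then have id: "cidm c (fst (onpos l I)) \<in> dirs (cpoly c) (fst (onpos l I))"
      using phom_dir[OF \<epsilon>] by (auto simp: cidm_def)
    have "peval ?f (pgen P I) = snd (peval (counit c) (nest (cpoly c) P (peval l (pgen P I)))) ()"
      unfolding peval_pcomp[OF l 2 pgen_pelts[OF I]] peval_pcomp[OF 1 plunit_phom r] peval_plunit[OF peval_pelts[OF 1 r]]
        nest_ptrim_pid_right[OF \<epsilon> r] ..
    also have "\<dots> = (snd (onpos l I) (cidm c (fst (onpos l I))),
      \<lambda>i\<in>dirs P (snd (onpos l I) (cidm c (fst (onpos l I)))). ondir l I (cidm c (fst (onpos l I)), i))"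
      unfolding nest_pgen[OF l I] using id by (simp add: peval_def phomD[OF \<epsilon>] cidm_def)
    finally show "peval ?f (pgen P I) = pgen P I \<longleftrightarrow>
      snd (onpos l I) (cidm c (fst (onpos l I))) = I \<and>
      (\<forall>i\<in>dirs P I. ondir l I (cidm c (fst (onpos l I)), i) = i)"
      by (simp only: pgen_def pair_restrict_eq_iff) auto
  qed
  finally show ?thesis .
qed

lemma rcounit_iff:
  assumes \<epsilon>: "counit d \<in> phom (cpoly d) yon" and r: "r \<in> phom P (P \<lhd> cpoly d)"
  shows "prunit P \<circ>\<^sub>p (pid P \<lhd>\<^sub>m counit d) \<circ>\<^sub>p r = pid P \<longleftrightarrow>
    (\<forall>I\<in>pos P. fst (onpos r I) = I \<and>
      (\<forall>i\<in>dirs P I. ondir r I (i, cidm d (snd (onpos r I) i)) = i))" (is "?f = _ \<longleftrightarrow> ?R")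
proof -
  note 1 = ptrim_phom[OF pid_phom[of P] \<epsilon>]
  note 2 = pcomp_phom[OF 1 prunit_phom]
  have "?f \<in> phom P P" by (rule pcomp_phom[OF r 2])
  from phom_eq_iff_pgen[OF this pid_phom]
  have "?f = pid P \<longleftrightarrow> (\<forall>I\<in>pos P. peval ?f (pgen P I) = pgen P I)" by (simp add: peval_pid)
  also have "\<dots> \<longleftrightarrow> ?R"
  proof (rule ball_cong[OF refl])
    fix I assume I: "I \<in> pos P"
    note m = peval_pelts[OF r pgen_pelts[OF I]]
    have "snd (onpos r I) i \<in> pos (cpoly d)" if "i \<in> dirs P (fst (onpos r I))" for i
      using phom_pos[OF r I] that by (auto simp: ptri_pos split: prod.splits)
    then have id: "cidm d (snd (onpos r I) i) \<in> dirs (cpoly d) (snd (onpos r I) i)"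
      if "i \<in> dirs P (fst (onpos r I))" for i
      using phom_dir[OF \<epsilon>] that by (auto simp: cidm_def)
    have "peval ?f (pgen P I) = papp P (\<lambda>w. snd w ()) (papp P (peval (counit d)) (nest P (cpoly d) (peval r (pgen P I))))"
      unfolding peval_pcomp[OF r 2 pgen_pelts[OF I]] peval_pcomp[OF 1 prunit_phom m] peval_prunit[OF peval_pelts[OF 1 m]]
        nest_ptrim_pid_left[OF \<epsilon> m] ..
    also have "\<dots> = (fst (onpos r I), \<lambda>i\<in>dirs P (fst (onpos r I)). ondir r I (i, cidm d (snd (onpos r I) i)))"
      unfolding nest_pgen[OF r I] using id
      by (auto simp: peval_def papp_def phomD[OF \<epsilon>] cidm_def intro!: restrict_ext)
    finally show "peval ?f (pgen P I) = pgen P I \<longleftrightarrow>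
      fst (onpos r I) = I \<and> (\<forall>i\<in>dirs P I. ondir r I (i, cidm d (snd (onpos r I) i)) = i)"
      by (simp only: pgen_def pair_restrict_eq_iff) auto
  qed
  finally show ?thesis .
qed

lemma nest_coassoc:
  assumes l: "l \<in> phom P (C \<lhd> Q)" and d: "d \<in> phom C (A \<lhd> B)" and I: "I \<in> pos P"
  shows "papp A (nest B Q) (nest A (B \<lhd> Q) (peval (passoc A B Q \<circ>\<^sub>p (d \<lhd>\<^sub>m pid Q) \<circ>\<^sub>p l) (pgen P I)))
    = nest A B (peval d (nest C Q (peval l (pgen P I))))"
proof -
  note 1 = ptrim_phom[OF d pid_phom[of Q]]
  note 2 = pcomp_phom[OF 1 passoc_phom]
  note r = peval_pelts[OF l pgen_pelts[OF I]]
  show ?thesis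
    unfolding peval_pcomp[OF l 2 pgen_pelts[OF I]] peval_pcomp[OF 1 passoc_phom r]
      nest_passoc[OF peval_pelts[OF 1 r]] nest_ptrim_pid_right[OF d r] ..
qed

lemma nest_coassoc':
  assumes l: "l \<in> phom P (A \<lhd> D)" and d: "d \<in> phom D (B \<lhd> Q)" and I: "I \<in> pos P"
  shows "papp A (nest B Q) (nest A (B \<lhd> Q) (peval ((pid A \<lhd>\<^sub>m d) \<circ>\<^sub>p l) (pgen P I)))
    = papp A (\<lambda>w. nest B Q (peval d w)) (nest A D (peval l (pgen P I)))"
proof -
  note 1 = ptrim_phom[OF pid_phom[of A] d]
  note r = peval_pelts[OF l pgen_pelts[OF I]]
  show ?thesis
    unfolding peval_pcomp[OF l 1 pgen_pelts[OF I]] nest_ptrim_pid_left[OF d r] papp_papp ..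
qed

text \<open>Stated for four unrelated maps so that left coassociativity, right coassociativity and
  the compatibility of the two coactions are all instances.\<close>

lemma coassoc_eq_iff:
  assumes l: "l \<in> phom P (C \<lhd> Q)" and d: "d \<in> phom C (A \<lhd> B)"
    and l': "l' \<in> phom P (A \<lhd> D)" and d': "d' \<in> phom D (B \<lhd> Q)"
  shows "passoc A B Q \<circ>\<^sub>p (d \<lhd>\<^sub>m pid Q) \<circ>\<^sub>p l = (pid A \<lhd>\<^sub>m d') \<circ>\<^sub>p l' \<longleftrightarrow>
    (\<forall>I\<in>pos P. nest A B (peval d (nest C Q (peval l (pgen P I))))
      = papp A (\<lambda>w. nest B Q (peval d' w)) (nest A D (peval l' (pgen P I))))" (is "?f = ?g \<longleftrightarrow> _")
proof -
  have f: "?f \<in> phom P (A \<lhd> (B \<lhd> Q))"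
    by (rule pcomp_phom[OF l pcomp_phom[OF ptrim_phom[OF d pid_phom] passoc_phom]])
  have g: "?g \<in> phom P (A \<lhd> (B \<lhd> Q))"
    by (rule pcomp_phom[OF l' ptrim_phom[OF pid_phom d']])
  have "peval ?f (pgen P I) = peval ?g (pgen P I) \<longleftrightarrow> nest A B (peval d (nest C Q (peval l (pgen P I))))
      = papp A (\<lambda>w. nest B Q (peval d' w)) (nest A D (peval l' (pgen P I)))" if I: "I \<in> pos P" for I
    using nest_nest_inj[OF peval_pelts[OF f pgen_pelts[OF I]] peval_pelts[OF g pgen_pelts[OF I]]]
    unfolding nest_coassoc[OF l d I, symmetric] nest_coassoc'[OF l' d' I, symmetric] by auto
  then show ?thesis unfolding phom_eq_iff_pgen[OF f g] by auto
qed

lemma coact_mem: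
  assumes l: "l \<in> phom P (A \<lhd> B)" and I: "I \<in> pos P"
  shows "fst (onpos l I) \<in> pos A"
    "f \<in> dirs A (fst (onpos l I)) \<Longrightarrow> snd (onpos l I) f \<in> pos B"
    "f \<in> dirs A (fst (onpos l I)) \<Longrightarrow> i \<in> dirs B (snd (onpos l I) f) \<Longrightarrow> ondir l I (f, i) \<in> dirs P I"
    "onpos l I = (fst (onpos l I), \<lambda>f\<in>dirs A (fst (onpos l I)). snd (onpos l I) f)"
proof -
  obtain a J where *: "onpos l I = (a, J)" "a \<in> pos A" "J \<in> dirs A a \<rightarrow>\<^sub>E pos B"
    using phom_pos[OF l I] by (rule ptri_posE)
  show "fst (onpos l I) \<in> pos A"
    "f \<in> dirs A (fst (onpos l I)) \<Longrightarrow> snd (onpos l I) f \<in> pos B"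
    "f \<in> dirs A (fst (onpos l I)) \<Longrightarrow> i \<in> dirs B (snd (onpos l I) f) \<Longrightarrow> ondir l I (f, i) \<in> dirs P I"
    "onpos l I = (fst (onpos l I), \<lambda>f\<in>dirs A (fst (onpos l I)). snd (onpos l I) f)"
    using * phom_dir[OF l I] by (auto simp: PiE_restrict)
qed

text \<open>The normal forms \<open>1\<close> and \<open>2\<close> of the two sides are compared.
  The clauses are nested because the ranges of \<open>g\<close> and of \<open>i\<close> on the two
  sides coincide only once the preceding equation holds.\<close>

lemma lcoassoc_iff:
  assumes l: "l \<in> phom P (cpoly c \<lhd> P)" and d: "comult c \<in> phom (cpoly c) (cpoly c \<lhd> cpoly c)"
    and cb: "\<forall>C\<in>pos (cpoly c). fst (onpos (comult c) C) = C"
  shows "passoc (cpoly c) (cpoly c) P \<circ>\<^sub>p (comult c \<lhd>\<^sub>m pid P) \<circ>\<^sub>p l = (pid (cpoly c) \<lhd>\<^sub>m l) \<circ>\<^sub>p l \<longleftrightarrow>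
    (\<forall>I\<in>pos P. \<forall>f\<in>dirs (cpoly c) (fst (onpos l I)).
      fst (onpos l (snd (onpos l I) f)) = ccod c (fst (onpos l I)) f \<and>
      (\<forall>g\<in>dirs (cpoly c) (ccod c (fst (onpos l I)) f).
        snd (onpos l I) (ccmp c (fst (onpos l I)) f g) = snd (onpos l (snd (onpos l I) f)) g \<and>
        (\<forall>i\<in>dirs P (snd (onpos l I) (ccmp c (fst (onpos l I)) f g)).
          ondir l I (ccmp c (fst (onpos l I)) f g, i) = ondir l I (f, ondir l (snd (onpos l I) f) (g, i)))))"
proof -
  note c = cb[rule_format]
  { fix I assume I: "I \<in> pos P"
    let ?a = "fst (onpos l I)" and ?J = "snd (onpos l I)"
    note a = coact_mem(1)[OF l I] and J = coact_mem(2)[OF l I] and b = coact_mem(3)[OF l I]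
    have gg: "ccmp c ?a f g \<in> dirs (cpoly c) ?a" if "f \<in> dirs (cpoly c) ?a" "g \<in> dirs (cpoly c) (ccod c ?a f)" for f g
      using coact_mem(3)[OF d a, of f g] that by (simp add: ccmp_def ccod_def c[OF a])
    have nr: "nest (cpoly c) P (peval l (pgen P I)) \<in> pelts (cpoly c)"
      by (rule nest_pelts[OF peval_pelts[OF l pgen_pelts[OF I]]])
    have 1: "nest (cpoly c) (cpoly c) (peval (comult c) (nest (cpoly c) P (peval l (pgen P I)))) =
      (?a, \<lambda>f\<in>dirs (cpoly c) ?a. (ccod c ?a f, \<lambda>g\<in>dirs (cpoly c) (ccod c ?a f).
        (?J (ccmp c ?a f g), \<lambda>i\<in>dirs P (?J (ccmp c ?a f g)). ondir l I (ccmp c ?a f g, i))))"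
      unfolding nest_pgen[OF l I] using nest_peval[OF d nr[unfolded nest_pgen[OF l I]]] gg
      by (auto simp: nest_pgen[OF d a] c[OF a] papp_def ccod_def ccmp_def intro!: restrict_ext)
    have lr: "(?J f, \<lambda>i\<in>dirs P (?J f). ondir l I (f, i)) \<in> pelts P" if "f \<in> dirs (cpoly c) ?a" for f
      using J[OF that] by (simp add: pelts_def)
    have 2: "papp (cpoly c) (\<lambda>w. nest (cpoly c) P (peval l w)) (nest (cpoly c) P (peval l (pgen P I))) =
      (?a, \<lambda>f\<in>dirs (cpoly c) ?a. (fst (onpos l (?J f)), \<lambda>g\<in>dirs (cpoly c) (fst (onpos l (?J f))).
        (snd (onpos l (?J f)) g, \<lambda>i\<in>dirs P (snd (onpos l (?J f)) g). ondir l I (f, ondir l (?J f) (g, i)))))"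
      using coact_mem(3)[OF l J]
      by (auto simp: nest_pgen[OF l I] papp_def nest_peval[OF l lr] nest_pgen[OF l J] intro!: restrict_ext)
    have "nest (cpoly c) (cpoly c) (peval (comult c) (nest (cpoly c) P (peval l (pgen P I)))) =
      papp (cpoly c) (\<lambda>w. nest (cpoly c) P (peval l w)) (nest (cpoly c) P (peval l (pgen P I))) \<longleftrightarrow>
      (\<forall>f\<in>dirs (cpoly c) ?a. fst (onpos l (?J f)) = ccod c ?a f \<and> (\<forall>g\<in>dirs (cpoly c) (ccod c ?a f).
        ?J (ccmp c ?a f g) = snd (onpos l (?J f)) g \<and>
        (\<forall>i\<in>dirs P (?J (ccmp c ?a f g)). ondir l I (ccmp c ?a f g, i) = ondir l I (f, ondir l (?J f) (g, i)))))"
      unfolding 1 2 by (simp only: pair_restrict_eq_iff simp_thms) metis }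
  then show ?thesis unfolding coassoc_eq_iff[OF l d l l] by auto
qed

lemma rcoassoc_iff:
  assumes r: "r \<in> phom P (P \<lhd> cpoly d)" and d: "comult d \<in> phom (cpoly d) (cpoly d \<lhd> cpoly d)"
    and cb: "\<forall>C\<in>pos (cpoly d). fst (onpos (comult d) C) = C"
    and cb': "\<forall>I\<in>pos P. fst (onpos r I) = I"
  shows "passoc P (cpoly d) (cpoly d) \<circ>\<^sub>p (r \<lhd>\<^sub>m pid (cpoly d)) \<circ>\<^sub>p r = (pid P \<lhd>\<^sub>m comult d) \<circ>\<^sub>p r \<longleftrightarrow>
    (\<forall>I\<in>pos P. \<forall>i\<in>dirs P I. \<forall>g\<in>dirs (cpoly d) (snd (onpos r I) i).
        snd (onpos r I) (ondir r I (i, g)) = ccod d (snd (onpos r I) i) g \<and>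
        (\<forall>h\<in>dirs (cpoly d) (ccod d (snd (onpos r I) i) g).
          ondir r I (ondir r I (i, g), h) = ondir r I (i, ccmp d (snd (onpos r I) i) g h)))"
proof -
  note c = cb[rule_format] and c' = cb'[rule_format]
  let ?D = "cpoly d"
  { fix I assume I: "I \<in> pos P"
    let ?J = "snd (onpos r I)"
    note J = coact_mem(2)[OF r I, unfolded c'[OF I]] and b = coact_mem(3)[OF r I, unfolded c'[OF I]]
    have nr: "nest P ?D (peval r (pgen P I)) \<in> pelts P"
      by (rule nest_pelts[OF peval_pelts[OF r pgen_pelts[OF I]]])
    have 1: "nest P ?D (peval r (nest P ?D (peval r (pgen P I)))) =
      (I, \<lambda>i\<in>dirs P I. (?J i, \<lambda>g\<in>dirs ?D (?J i).
        (?J (ondir r I (i, g)), \<lambda>h\<in>dirs ?D (?J (ondir r I (i, g))). ondir r I (ondir r I (i, g), h))))"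
      unfolding nest_pgen[OF r I] c'[OF I] using nest_peval[OF r nr[unfolded nest_pgen[OF r I] c'[OF I]]] b
      by (auto simp: nest_pgen[OF r I] c'[OF I] papp_def intro!: restrict_ext)
    have lr: "(?J i, \<lambda>g\<in>dirs ?D (?J i). ondir r I (i, g)) \<in> pelts ?D" if "i \<in> dirs P I" for i
      using J[OF that] by (simp add: pelts_def)
    have 2: "papp P (\<lambda>w. nest ?D ?D (peval (comult d) w)) (nest P ?D (peval r (pgen P I))) =
      (I, \<lambda>i\<in>dirs P I. (?J i, \<lambda>g\<in>dirs ?D (?J i). (ccod d (?J i) g, \<lambda>h\<in>dirs ?D (ccod d (?J i) g).
        ondir r I (i, ccmp d (?J i) g h))))"
      using coact_mem(3)[OF d J, unfolded c[OF J]]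
      by (auto simp: nest_pgen[OF r I] c'[OF I] c[OF J] papp_def nest_peval[OF d lr] nest_pgen[OF d J] ccod_def ccmp_def
          intro!: restrict_ext)
    have "nest P ?D (peval r (nest P ?D (peval r (pgen P I)))) =
      papp P (\<lambda>w. nest ?D ?D (peval (comult d) w)) (nest P ?D (peval r (pgen P I))) \<longleftrightarrow>
      (\<forall>i\<in>dirs P I. \<forall>g\<in>dirs ?D (?J i). ?J (ondir r I (i, g)) = ccod d (?J i) g \<and>
        (\<forall>h\<in>dirs ?D (ccod d (?J i) g). ondir r I (ondir r I (i, g), h) = ondir r I (i, ccmp d (?J i) g h)))"
      unfolding 1 2 by (simp only: pair_restrict_eq_iff simp_thms) metis }
  then show ?thesis unfolding coassoc_eq_iff[OF r r r d] by auto
qed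

lemma bicompat_iff:
  assumes l: "l \<in> phom P (C \<lhd> P)" and r: "r \<in> phom P (P \<lhd> D)"
    and cb': "\<forall>I\<in>pos P. fst (onpos r I) = I"
  shows "passoc C P D \<circ>\<^sub>p (l \<lhd>\<^sub>m pid D) \<circ>\<^sub>p r = (pid C \<lhd>\<^sub>m r) \<circ>\<^sub>p l \<longleftrightarrow>
    (\<forall>I\<in>pos P. \<forall>f\<in>dirs C (fst (onpos l I)). \<forall>i\<in>dirs P (snd (onpos l I) f).
        snd (onpos r I) (ondir l I (f, i)) = snd (onpos r (snd (onpos l I) f)) i \<and>
        (\<forall>g\<in>dirs D (snd (onpos r (snd (onpos l I) f)) i).
          ondir r I (ondir l I (f, i), g) = ondir l I (f, ondir r (snd (onpos l I) f) (i, g))))"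
proof -
  note c' = cb'[rule_format]
  { fix I assume I: "I \<in> pos P"
    let ?a = "fst (onpos l I)" and ?J = "snd (onpos l I)" and ?R = "\<lambda>I. snd (onpos r I)"
    note a = coact_mem(1)[OF l I] and J = coact_mem(2)[OF l I] and b = coact_mem(3)[OF l I]
    have nr: "nest P D (peval r (pgen P I)) \<in> pelts P"
      by (rule nest_pelts[OF peval_pelts[OF r pgen_pelts[OF I]]])
    have 1: "nest C P (peval l (nest P D (peval r (pgen P I)))) =
      (?a, \<lambda>f\<in>dirs C ?a. (?J f, \<lambda>i\<in>dirs P (?J f).
        (?R I (ondir l I (f, i)), \<lambda>g\<in>dirs D (?R I (ondir l I (f, i))). ondir r I (ondir l I (f, i), g))))"
      unfolding nest_pgen[OF r I] c'[OF I] using nest_peval[OF l nr[unfolded nest_pgen[OF r I] c'[OF I]]] b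
      by (auto simp: nest_pgen[OF l I] papp_def intro!: restrict_ext)
    have lr: "(?J f, \<lambda>i\<in>dirs P (?J f). ondir l I (f, i)) \<in> pelts P" if "f \<in> dirs C ?a" for f
      using J[OF that] by (simp add: pelts_def)
    have 2: "papp C (\<lambda>w. nest P D (peval r w)) (nest C P (peval l (pgen P I))) =
      (?a, \<lambda>f\<in>dirs C ?a. (?J f, \<lambda>i\<in>dirs P (?J f). (?R (?J f) i, \<lambda>g\<in>dirs D (?R (?J f) i).
        ondir l I (f, ondir r (?J f) (i, g)))))"
      using coact_mem(3)[OF r J, unfolded c'[OF J]]
      by (auto simp: nest_pgen[OF l I] papp_def nest_peval[OF r lr] nest_pgen[OF r J] c'[OF J] intro!: restrict_ext)
    have "nest C P (peval l (nest P D (peval r (pgen P I)))) =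
      papp C (\<lambda>w. nest P D (peval r w)) (nest C P (peval l (pgen P I))) \<longleftrightarrow>
      (\<forall>f\<in>dirs C ?a. \<forall>i\<in>dirs P (?J f). ?R I (ondir l I (f, i)) = ?R (?J f) i \<and>
        (\<forall>g\<in>dirs D (?R (?J f) i). ondir r I (ondir l I (f, i), g) = ondir l I (f, ondir r (?J f) (i, g))))"
      unfolding 1 2 by (simp only: pair_restrict_eq_iff simp_thms) metis }
  then show ?thesis unfolding coassoc_eq_iff[OF r l l r] by auto
qed

section \<open>The locale of bicomodules\<close>

locale bicomod =
  fixes c :: "('c, 'f) comonoid" and d :: "('d, 'g) comonoid" and p :: "('i, 'a, 'c, 'f, 'd, 'g) bicom"
  assumes bicomodule: "bicomodule c d p"

lemma comonoid_bid: "comonoid c \<Longrightarrow> bicomodule c c (bid c)"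
  by (simp add: comonoid_def bicomodule_def bid_def)

text \<open>A comonoid is a right comodule over itself, and the position part of the right counit
  law says that a right coaction keeps the position.\<close>

lemma comonoid_onpos:
  assumes "comonoid c" "C \<in> pos (cpoly c)"
  shows "fst (onpos (comult c) C) = C"
  using assms rcounit_iff[of c "comult c" "cpoly c"] by (auto simp: comonoid_def)

text \<open>Read forwards, this gives the calculus of actions on positions and directions; read
  backwards, it is how composites, fibres and the coclosure are recognized as bicomodules.\<close>

lemma bicomodule_iff:
  "bicomodule c d p \<longleftrightarrow> comonoid c \<and> comonoid d \<and> lbase p = c \<and> rbase p = d \<and>
     lcoact p \<in> phom (carrier p) (cpoly c \<lhd> carrier p) \<and>
     rcoact p \<in> phom (carrier p) (carrier p \<lhd> cpoly d) \<and>
     (\<forall>I\<in>pos (carrier p).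
       lact p I (cidm c (lob p I)) = I \<and>
       (\<forall>i\<in>dirs (carrier p) I. lback p I (cidm c (lob p I)) i = i) \<and>
       (\<forall>f\<in>dirs (cpoly c) (lob p I).
         lob p (lact p I f) = ccod c (lob p I) f \<and>
         (\<forall>g\<in>dirs (cpoly c) (ccod c (lob p I) f).
           lact p I (ccmp c (lob p I) f g) = lact p (lact p I f) g \<and>
           (\<forall>i\<in>dirs (carrier p) (lact p I (ccmp c (lob p I) f g)).
             lback p I (ccmp c (lob p I) f g) i = lback p I f (lback p (lact p I f) g i)))) \<and>
       fst (onpos (rcoact p) I) = I \<and>
       (\<forall>i\<in>dirs (carrier p) I. ract p I i (cidm d (rob p I i)) = i \<and>
         (\<forall>g\<in>dirs (cpoly d) (rob p I i). rob p I (ract p I i g) = ccod d (rob p I i) g \<and>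
           (\<forall>h\<in>dirs (cpoly d) (ccod d (rob p I i) g).
             ract p I (ract p I i g) h = ract p I i (ccmp d (rob p I i) g h)))) \<and>
       (\<forall>f\<in>dirs (cpoly c) (lob p I). \<forall>i\<in>dirs (carrier p) (lact p I f).
         rob p I (lback p I f i) = rob p (lact p I f) i \<and>
         (\<forall>g\<in>dirs (cpoly d) (rob p (lact p I f) i).
           ract p I (lback p I f i) g = lback p I f (ract p (lact p I f) i g))))"
    (is "_ \<longleftrightarrow> ?R")
proof -
  \<comment> \<open>The clause that \<open>rcoact\<close> keeps positions is split off because
    \<open>rcoassoc_iff\<close> and \<open>bicompat_iff\<close> presuppose it. Where it fails, the
    right counit law fails as well, so both sides of the equivalence are false.\<close>
  let ?T = "comonoid c \<and> comonoid d \<and> lbase p = c \<and> rbase p = d \<and>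
     lcoact p \<in> phom (carrier p) (cpoly c \<lhd> carrier p) \<and>
     rcoact p \<in> phom (carrier p) (carrier p \<lhd> cpoly d) \<and> (\<forall>I\<in>pos (carrier p). fst (onpos (rcoact p) I) = I)"
  show ?thesis
  proof (cases ?T)
    case True
    then have l: "lcoact p \<in> phom (carrier p) (cpoly c \<lhd> carrier p)"
      and r: "rcoact p \<in> phom (carrier p) (carrier p \<lhd> cpoly d)"
      and r1: "\<forall>I\<in>pos (carrier p). fst (onpos (rcoact p) I) = I"
      and c: "comonoid c" and d: "comonoid d" by auto
    have \<epsilon>: "counit c \<in> phom (cpoly c) yon" "counit d \<in> phom (cpoly d) yon"
      and \<delta>: "comult c \<in> phom (cpoly c) (cpoly c \<lhd> cpoly c)" "comult d \<in> phom (cpoly d) (cpoly d \<lhd> cpoly d)"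
      using c d by (auto simp: comonoid_def)
    have \<delta>1: "\<forall>C\<in>pos (cpoly c). fst (onpos (comult c) C) = C" "\<forall>C\<in>pos (cpoly d). fst (onpos (comult d) C) = C"
      using comonoid_onpos[OF c] comonoid_onpos[OF d] by simp_all
    note * = lcounit_iff[OF \<epsilon>(1) l] rcounit_iff[OF \<epsilon>(2) r] lcoassoc_iff[OF l \<delta>(1) \<delta>1(1)]
      rcoassoc_iff[OF r \<delta>(2) \<delta>1(2) r1] bicompat_iff[OF l r r1]
    show ?thesis
      unfolding bicomodule_def
      unfolding * lob_def[symmetric] rob_def[symmetric] lact_def[symmetric] ract_def[symmetric] lback_def[symmetric]
      unfolding ball_conj_distrib using True
      apply (intro iffI)
       apply (elim conjE)
       apply (intro conjI)
                          apply assumption+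
      apply (elim conjE)
      apply (intro conjI)
                          apply assumption+
      done
  next
    case False
    have "\<not> bicomodule c d p"
      using False rcounit_iff[of d "rcoact p" "carrier p"] unfolding bicomodule_def comonoid_def by blast
    moreover have "\<not> ?R" using False by blast
    ultimately show ?thesis by blast
  qed
qed

section \<open>The operations of a bicomodule and their laws\<close>

context bicomod
begin

abbreviation "pp \<equiv> pos (carrier p)"
abbreviation "pd \<equiv> dirs (carrier p)"

lemma comon: "comonoid c" "comonoid d"
  and base [simp]: "lbase p = c" "rbase p = d"
  and lcoact: "lcoact p \<in> phom (carrier p) (cpoly c \<lhd> carrier p)"
  and rcoact: "rcoact p \<in> phom (carrier p) (carrier p \<lhd> cpoly d)"
  using bicomodule unfolding bicomodule_def by auto

lemmas laws = bicomodule[unfolded bicomodule_iff, THEN conjunct2, THEN conjunct2, THEN conjunct2,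
    THEN conjunct2, THEN conjunct2, THEN conjunct2, rule_format]

lemma
  assumes I: "I \<in> pp"
  shows lob [simp]: "lob p I \<in> pos (cpoly c)"
    and lact [simp]: "f \<in> dirs (cpoly c) (lob p I) \<Longrightarrow> lact p I f \<in> pp"
    and lback [simp]: "f \<in> dirs (cpoly c) (lob p I) \<Longrightarrow> i \<in> pd (lact p I f) \<Longrightarrow> lback p I f i \<in> pd I"
    and onpos_lcoact: "onpos (lcoact p) I = (lob p I, \<lambda>f\<in>dirs (cpoly c) (lob p I). lact p I f)"
  using coact_mem[OF lcoact I] by (auto simp: lob_def lact_def lback_def)

lemma
  assumes I: "I \<in> pp"
  shows rob [simp]: "i \<in> pd I \<Longrightarrow> rob p I i \<in> pos (cpoly d)"
    and ract [simp]: "i \<in> pd I \<Longrightarrow> g \<in> dirs (cpoly d) (rob p I i) \<Longrightarrow> ract p I i g \<in> pd I"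
    and onpos_rcoact: "onpos (rcoact p) I = (I, \<lambda>i\<in>pd I. rob p I i)"
  using coact_mem[OF rcoact I] laws[OF I] by (auto simp: rob_def ract_def)

lemma
  assumes I: "I \<in> pp"
  shows lact_id [simp]: "lact p I (cidm c (lob p I)) = I"
    and lback_id [simp]: "i \<in> pd I \<Longrightarrow> lback p I (cidm c (lob p I)) i = i"
    and lob_lact [simp]: "f \<in> dirs (cpoly c) (lob p I) \<Longrightarrow> lob p (lact p I f) = ccod c (lob p I) f"
    and lact_lact: "f \<in> dirs (cpoly c) (lob p I) \<Longrightarrow> g \<in> dirs (cpoly c) (ccod c (lob p I) f) \<Longrightarrow>
      lact p (lact p I f) g = lact p I (ccmp c (lob p I) f g)"
    and lback_lback: "f \<in> dirs (cpoly c) (lob p I) \<Longrightarrow> g \<in> dirs (cpoly c) (ccod c (lob p I) f) \<Longrightarrow>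
      i \<in> pd (lact p I (ccmp c (lob p I) f g)) \<Longrightarrow>
      lback p I f (lback p (lact p I f) g i) = lback p I (ccmp c (lob p I) f g) i"
    and ract_id [simp]: "i \<in> pd I \<Longrightarrow> ract p I i (cidm d (rob p I i)) = i"
    and rob_ract [simp]: "i \<in> pd I \<Longrightarrow> k \<in> dirs (cpoly d) (rob p I i) \<Longrightarrow>
      rob p I (ract p I i k) = ccod d (rob p I i) k"
    and ract_ract: "i \<in> pd I \<Longrightarrow> k \<in> dirs (cpoly d) (rob p I i) \<Longrightarrow> l \<in> dirs (cpoly d) (ccod d (rob p I i) k) \<Longrightarrow>
      ract p I (ract p I i k) l = ract p I i (ccmp d (rob p I i) k l)"
    and rob_lback [simp]: "f \<in> dirs (cpoly c) (lob p I) \<Longrightarrow> i \<in> pd (lact p I f) \<Longrightarrow>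
      rob p I (lback p I f i) = rob p (lact p I f) i"
    and ract_lback [simp]: "f \<in> dirs (cpoly c) (lob p I) \<Longrightarrow> i \<in> pd (lact p I f) \<Longrightarrow>
      k \<in> dirs (cpoly d) (rob p (lact p I f) i) \<Longrightarrow>
      ract p I (lback p I f i) k = lback p I f (ract p (lact p I f) i k)"
  using laws[OF I] by simp_all

end

locale catcom =
  fixes c :: "('c, 'f) comonoid"
  assumes comonoid: "comonoid c"
begin

sublocale B: bicomod c c "bid c"
  by unfold_locales (rule comonoid_bid[OF comonoid])

lemma counit: "counit c \<in> phom (cpoly c) yon"
  using comonoid by (simp add: comonoid_def)

lemma lob_bid [simp]: "C \<in> pos (cpoly c) \<Longrightarrow> lob (bid c) C = C"
  by (simp add: lob_def bid_def comonoid_onpos[OF comonoid])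

lemma bid_ops: "lact (bid c) = ccod c" "lback (bid c) = ccmp c" "rob (bid c) = ccod c" "ract (bid c) = ccmp c"
  "carrier (bid c) = cpoly c"
  by (auto simp: bid_def lact_def lback_def rob_def ract_def ccod_def ccmp_def fun_eq_iff)

lemma cidm [simp]: "C \<in> pos (cpoly c) \<Longrightarrow> cidm c C \<in> dirs (cpoly c) C"
  using phom_dir[OF counit] by (auto simp: cidm_def)

text \<open>These category laws are the bicomodule laws of \<open>bid c\<close>, whose left and
  right actions are both composition.\<close>

lemma
  assumes C: "C \<in> pos (cpoly c)"
  shows ccod [simp]: "f \<in> dirs (cpoly c) C \<Longrightarrow> ccod c C f \<in> pos (cpoly c)"
    and ccmp [simp]: "f \<in> dirs (cpoly c) C \<Longrightarrow> g \<in> dirs (cpoly c) (ccod c C f) \<Longrightarrow> ccmp c C f g \<in> dirs (cpoly c) C"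
    and ccod_id [simp]: "ccod c C (cidm c C) = C"
    and ccmp_id_left [simp]: "f \<in> dirs (cpoly c) C \<Longrightarrow> ccmp c C (cidm c C) f = f"
    and ccmp_id_right [simp]: "f \<in> dirs (cpoly c) C \<Longrightarrow> ccmp c C f (cidm c (ccod c C f)) = f"
    and ccod_ccmp [simp]: "f \<in> dirs (cpoly c) C \<Longrightarrow> g \<in> dirs (cpoly c) (ccod c C f) \<Longrightarrow>
      ccod c C (ccmp c C f g) = ccod c (ccod c C f) g"
  using C B.lact[of C f] B.lback[of C f g] B.lact_id[of C] B.lback_id[of C f] B.ract_id[of C f]
    B.lact_lact[of C f g] by (simp_all add: bid_ops)

end

section \<open>Equalizers\<close>

text \<open>The kernel of \<open>F\<close> is an equivalence relation containing the generating
  pairs, hence a member of the family whose intersection is \<open>eq_rel\<close>.\<close>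

lemma eq_rel_least:
  assumes ij: "(i, j) \<in> eq_rel f g I" and f: "f \<in> phom P Q" and g: "g \<in> phom P Q"
    and I: "I \<in> pos P" and eq: "onpos f I = onpos g I"
    and F: "\<And>k. k \<in> dirs Q (onpos f I) \<Longrightarrow> F (ondir f I k) = F (ondir g I k)"
  shows "F i = F j"
proof -
  let ?E = "{(a, b). a \<in> dirs P I \<and> b \<in> dirs P I \<and> F a = F b}"
  have "equiv (dirs P I) ?E"
    by (rule equivI) (auto simp: refl_on_def sym_def trans_def)
  moreover have "(ondir f I k, ondir g I k) \<in> ?E" if "k \<in> dirs Q (onpos f I)" for k
    using F[OF that] phom_dir[OF f I that] phom_dir[OF g I] that eq by auto
  ultimately have "(i, j) \<in> ?E"
    using ij unfolding eq_rel_def phomD[OF f] by blast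
  then show ?thesis by simp
qed

lemma eq_rel_equiv:
  assumes f: "f \<in> phom P Q" and g: "g \<in> phom P Q"
    and I: "I \<in> pos P" and eq: "onpos f I = onpos g I"
  shows "equiv (dirs P I) (eq_rel f g I)"
proof -
  let ?F = "{E. equiv (dirs P I) E \<and> (\<forall>k \<in> dirs Q (onpos f I). (ondir f I k, ondir g I k) \<in> E)}"
  have e: "eq_rel f g I = \<Inter> ?F" by (simp add: eq_rel_def phomD[OF f])
  \<comment> \<open>The total relation keeps the intersected family nonempty and so bounds the
    intersection by the set of directions.\<close>
  have "dirs P I \<times> dirs P I \<in> ?F"
    using phom_dir[OF f I] phom_dir[OF g I] eq by (auto simp: equiv_def refl_on_def sym_def trans_def)
  then have "eq_rel f g I \<subseteq> dirs P I \<times> dirs P I" unfolding e by blast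
  moreover have "refl_on (dirs P I) (eq_rel f g I)"
    unfolding e by (auto simp: refl_on_def equiv_def)
  moreover have "sym (eq_rel f g I)"
    unfolding e by (auto simp: sym_def equiv_def)
  moreover have "trans (eq_rel f g I)"
    unfolding e trans_def equiv_def by blast
  ultimately show ?thesis by (simp add: equiv_def)
qed

lemma eq_rel_gen:
  "f \<in> phom P Q \<Longrightarrow> k \<in> dirs Q (onpos f I) \<Longrightarrow> (ondir f I k, ondir g I k) \<in> eq_rel f g I"
  by (auto simp: eq_rel_def phomD)

lemma peq_incl_phom: "f \<in> phom P Q \<Longrightarrow> peq_incl f g \<in> phom (peq f g) P"
  unfolding peq_incl_def
  by (simp add: phomD, rule mk_pmap_phom) (auto simp: peq_def phomD intro: quotientI)

lemma peq_incl_pmono: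
  assumes "f \<in> phom P Q" shows "pmono (peq_incl f g)"
proof -
  have "ondir (peq_incl f g) I ` dirs P I = dirs (peq f g) I" if "I \<in> pos (peq f g)" for I
  proof -
    have "ondir (peq_incl f g) I i = eq_rel f g I `` {i}" if "i \<in> dirs P I" for i
      using that \<open>I \<in> pos (peq f g)\<close> by (simp add: peq_incl_def phomD[OF assms])
    then show ?thesis by (auto simp: peq_def quotient_def phomD[OF assms])
  qed
  moreover have "inj_on (onpos (peq_incl f g)) (pos (peq f g))"
    by (auto simp: inj_on_def peq_incl_def)
  ultimately show ?thesis
    using phomD[OF peq_incl_phom[OF assms]] by (auto simp: pmono_def peq_incl_def)
qed

section \<open>Composition of bicomodules\<close>

text \<open>The class in \<open>(p \<odot> q)[z]\<close> of a direction \<open>s\<close> of \<open>p \<lhd> q\<close> at \<open>z\<close>.\<close>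

definition cls where "cls p q z s = ondir (bincl p q) z s"

locale bicomod2 = P: bicomod c d p + Q: bicomod d e q
  for c :: "('c, 'f) comonoid" and d :: "('d, 'g) comonoid" and e :: "('e, 'h) comonoid"
    and p :: "('i, 'a, 'c, 'f, 'd, 'g) bicom" and q :: "('j, 'b, 'd, 'g, 'e, 'h) bicom"
begin

lemma bpar1: "bpar1 p q \<in> phom (carrier p \<lhd> carrier q) (carrier p \<lhd> (cpoly d \<lhd> carrier q))"
  unfolding bpar1_def P.base
  by (rule pcomp_phom[OF ptrim_phom[OF P.rcoact pid_phom] passoc_phom])

lemma bpar2: "bpar2 p q \<in> phom (carrier p \<lhd> carrier q) (carrier p \<lhd> (cpoly d \<lhd> carrier q))"
  unfolding bpar2_def by (rule ptrim_phom[OF pid_phom Q.lcoact])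

lemma bincl: "bincl p q \<in> phom (carrier (p \<odot> q)) (carrier p \<lhd> carrier q)"
  and bincl_mono: "pmono (bincl p q)"
  unfolding bincl_def bcomp_def using peq_incl_phom[OF bpar1] peq_incl_pmono[OF bpar1] by auto

lemma bincl_pos: "z \<in> pos (carrier (p \<odot> q)) \<Longrightarrow> onpos (bincl p q) z = z"
  by (simp add: bincl_def peq_incl_def bcomp_def)

lemma
  assumes I: "I \<in> P.pp" and J: "J \<in> P.pd I \<rightarrow>\<^sub>E Q.pp"
  shows onpos_bpar1: "onpos (bpar1 p q) (I, J) = (I, \<lambda>i\<in>P.pd I. (rob p I i,
      \<lambda>g\<in>dirs (cpoly d) (rob p I i). J (ract p I i g)))"
    and ondir_bpar1: "i \<in> P.pd I \<Longrightarrow> g \<in> dirs (cpoly d) (rob p I i) \<Longrightarrow> j \<in> Q.pd (J (ract p I i g)) \<Longrightarrow>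
      ondir (bpar1 p q) (I, J) (i, g, j) = (ract p I i g, j)"
    and onpos_bpar2: "onpos (bpar2 p q) (I, J) = (I, \<lambda>i\<in>P.pd I. (lob q (J i),
      \<lambda>g\<in>dirs (cpoly d) (lob q (J i)). lact q (J i) g))"
    and ondir_bpar2: "i \<in> P.pd I \<Longrightarrow> g \<in> dirs (cpoly d) (lob q (J i)) \<Longrightarrow> j \<in> Q.pd (lact q (J i) g) \<Longrightarrow>
      ondir (bpar2 p q) (I, J) (i, g, j) = (i, lback q (J i) g j)"
proof -
  have IJ: "(I, J) \<in> pos (carrier p \<lhd> carrier q)" using I J by (rule ptri_posI)
  note t = ptrim_phom[OF P.rcoact pid_phom[of "carrier q"]]
  note 1 = ptrim_simps[OF P.rcoact pid_phom[of "carrier q"] IJ, unfolded P.onpos_rcoact[OF I]]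
  have J': "J i \<in> Q.pp" if "i \<in> P.pd I" for i using J that by (rule PiE_mem)
  have r: "ondir (rcoact p) I (i, g) = ract p I i g" for i g by (simp add: ract_def)
  have 2: "onpos (rcoact p \<lhd>\<^sub>m pid (carrier q)) (I, J) = ((I, \<lambda>i\<in>P.pd I. rob p I i),
     \<lambda>(i, g)\<in>(SIGMA i:P.pd I. dirs (cpoly d) (rob p I i)). J (ract p I i g))"
    using I J' unfolding 1(1) ptri_dirs_restrict by (auto simp: r intro!: restrict_ext)
  note 3 = phom_pos[OF t IJ, unfolded 2]
  show "onpos (bpar1 p q) (I, J) = (I, \<lambda>i\<in>P.pd I. (rob p I i,
      \<lambda>g\<in>dirs (cpoly d) (rob p I i). J (ract p I i g)))"
    unfolding bpar1_def P.base pcomp_simps(1)[OF t passoc_phom IJ] 2 passoc_simps(1)[OF 3]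
    by (auto intro!: restrict_ext)
  show "ondir (bpar1 p q) (I, J) (i, g, j) = (ract p I i g, j)"
    if i: "i \<in> P.pd I" and g: "g \<in> dirs (cpoly d) (rob p I i)" and j: "j \<in> Q.pd (J (ract p I i g))"
  proof -
    have "ondir (bpar1 p q) (I, J) (i, g, j) = ondir (rcoact p \<lhd>\<^sub>m pid (carrier q)) (I, J) ((i, g), j)"
      unfolding bpar1_def P.base using i g j
      by (subst pcomp_simps(2)[OF t passoc_phom IJ])
        (auto simp: 2 passoc_simps[OF 3] simp del: P.ract)
    also have "\<dots> = (ract p I i g, j)"
      using i g j I J' by (subst 1(2)) (auto simp: r)
    finally show ?thesis .
  qed
  note 4 = ptrim_simps[OF pid_phom[of "carrier p"] Q.lcoact IJ]
  show "onpos (bpar2 p q) (I, J) = (I, \<lambda>i\<in>P.pd I. (lob q (J i),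
      \<lambda>g\<in>dirs (cpoly d) (lob q (J i)). lact q (J i) g))"
    unfolding bpar2_def 4(1) using I J' by (auto simp: Q.onpos_lcoact intro!: restrict_ext)
  show "ondir (bpar2 p q) (I, J) (i, g, j) = (i, lback q (J i) g j)"
    if i: "i \<in> P.pd I" and g: "g \<in> dirs (cpoly d) (lob q (J i))" and j: "j \<in> Q.pd (lact q (J i) g)"
    unfolding bpar2_def using I J' i g j by (subst 4(2)) (auto simp: Q.onpos_lcoact lback_def)
qed

lemma bpar_eq_iff:
  assumes I: "I \<in> P.pp" and J: "J \<in> P.pd I \<rightarrow>\<^sub>E Q.pp"
  shows "onpos (bpar1 p q) (I, J) = onpos (bpar2 p q) (I, J) \<longleftrightarrow>
    (\<forall>i\<in>P.pd I. lob q (J i) = rob p I i \<and> (\<forall>g\<in>dirs (cpoly d) (rob p I i). J (ract p I i g) = lact q (J i) g))"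
  unfolding onpos_bpar1[OF I J] onpos_bpar2[OF I J]
  by (simp only: pair_restrict_eq_iff simp_thms) auto

text \<open>The equalizer condition says that \<open>J\<close> is a map of copresheaves from
  \<open>p[I]\<close> to the positions of \<open>q\<close>, on which \<open>d\<close> acts by
  \<open>lob\<close> and \<open>lact\<close>.\<close>

lemma pos_bcomp_iff: "(I, J) \<in> pos (carrier (p \<odot> q)) \<longleftrightarrow> I \<in> P.pp \<and> J \<in> P.pd I \<rightarrow>\<^sub>E Q.pp \<and>
    (\<forall>i\<in>P.pd I. lob q (J i) = rob p I i \<and> (\<forall>g\<in>dirs (cpoly d) (rob p I i). J (ract p I i g) = lact q (J i) g))"
  unfolding bcomp_def using bpar_eq_iff[of I J]
  by (auto simp: peq_def phomD[OF bpar1] ptri_pos)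

lemma pos_bcompE:
  assumes "z \<in> pos (carrier (p \<odot> q))"
  obtains I J where "z = (I, J)" "I \<in> P.pp" "J \<in> P.pd I \<rightarrow>\<^sub>E Q.pp"
    "\<And>i. i \<in> P.pd I \<Longrightarrow> J i \<in> Q.pp"
    "\<And>i. i \<in> P.pd I \<Longrightarrow> lob q (J i) = rob p I i"
    "\<And>i g. i \<in> P.pd I \<Longrightarrow> g \<in> dirs (cpoly d) (rob p I i) \<Longrightarrow> J (ract p I i g) = lact q (J i) g"
  using assms by (cases z) (auto simp: pos_bcomp_iff)

lemma cls_mem:
  assumes z: "(I, J) \<in> pos (carrier (p \<odot> q))" and "i \<in> P.pd I" "j \<in> Q.pd (J i)"
  shows "cls p q (I, J) (i, j) \<in> dirs (carrier (p \<odot> q)) (I, J)"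
  using phom_dir[OF bincl z, of "(i, j)"] assms by (simp add: cls_def bincl_pos[OF z])

lemma dirs_bcompE:
  assumes z: "(I, J) \<in> pos (carrier (p \<odot> q))" and "s \<in> dirs (carrier (p \<odot> q)) (I, J)"
  obtains i j where "i \<in> P.pd I" "j \<in> Q.pd (J i)" "s = cls p q (I, J) (i, j)"
proof -
  from pmono_surj[OF bincl bincl_mono assms]
  obtain t where "t \<in> dirs (carrier p \<lhd> carrier q) (I, J)" "s = cls p q (I, J) t"
    unfolding bincl_pos[OF z] cls_def by metis
  then show ?thesis using that by (cases t) auto
qed

text \<open>The relation on directions is that of a tensor product over the category
  \<open>d\<close>: a morphism \<open>g\<close> may be moved from the right action on
  \<open>p[I]\<close> to the back map of \<open>q\<close>. The second fact is the universal
  property: a balanced function takes equal values on equal classes.\<close>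

lemma
  assumes z: "(I, J) \<in> pos (carrier (p \<odot> q))"
  shows cls_gen: "i \<in> P.pd I \<Longrightarrow> g \<in> dirs (cpoly d) (rob p I i) \<Longrightarrow> j \<in> Q.pd (lact q (J i) g) \<Longrightarrow>
      cls p q (I, J) (ract p I i g, j) = cls p q (I, J) (i, lback q (J i) g j)"
    and cls_eqD: "i \<in> P.pd I \<Longrightarrow> j \<in> Q.pd (J i) \<Longrightarrow> i' \<in> P.pd I \<Longrightarrow> j' \<in> Q.pd (J i') \<Longrightarrow>
      cls p q (I, J) (i, j) = cls p q (I, J) (i', j') \<Longrightarrow>
      (\<And>i g j. i \<in> P.pd I \<Longrightarrow> g \<in> dirs (cpoly d) (rob p I i) \<Longrightarrow> j \<in> Q.pd (lact q (J i) g) \<Longrightarrow>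
         F (ract p I i g) j = F i (lback q (J i) g j)) \<Longrightarrow> F i j = F i' j'"
proof -
  note IJ = z[unfolded pos_bcomp_iff]
  have I: "I \<in> P.pp" and J: "J \<in> P.pd I \<rightarrow>\<^sub>E Q.pp" and
    n: "\<And>i. i\<in>P.pd I \<Longrightarrow> lob q (J i) = rob p I i"
      "\<And>i g. i\<in>P.pd I \<Longrightarrow> g\<in>dirs (cpoly d) (rob p I i) \<Longrightarrow> J (ract p I i g) = lact q (J i) g"
    using IJ by auto
  have J': "J i \<in> Q.pp" if "i \<in> P.pd I" for i using J that by (rule PiE_mem)
  have z': "(I, J) \<in> pos (carrier p \<lhd> carrier q)" using I J by (rule ptri_posI)
  have eq: "onpos (bpar1 p q) (I, J) = onpos (bpar2 p q) (I, J)" using bpar_eq_iff[OF I J] IJ by simp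
  let ?E = "eq_rel (bpar1 p q) (bpar2 p q) (I, J)"
  note equiv = eq_rel_equiv[OF bpar1 bpar2 z' eq]
  have cls: "cls p q (I, J) (i, j) = ?E `` {(i, j)}" if "i \<in> P.pd I" "j \<in> Q.pd (J i)" for i j
    using z that by (simp add: cls_def bincl_def peq_incl_def bcomp_def phomD[OF bpar1])
  show "cls p q (I, J) (ract p I i g, j) = cls p q (I, J) (i, lback q (J i) g j)"
    if i: "i \<in> P.pd I" and g: "g \<in> dirs (cpoly d) (rob p I i)" and j: "j \<in> Q.pd (lact q (J i) g)"
  proof -
    have "(i, g, j) \<in> dirs (carrier p \<lhd> (cpoly d \<lhd> carrier q)) (onpos (bpar1 p q) (I, J))"
      unfolding onpos_bpar1[OF I J] using i g j n by simp
    from eq_rel_gen[OF bpar1 this, of "bpar2 p q"]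
    have "((ract p I i g, j), (i, lback q (J i) g j)) \<in> ?E"
      using ondir_bpar1[OF I J i g] ondir_bpar2[OF I J i, of g j] i g j n by simp
    then show ?thesis
      using i g j J' n I by (simp add: cls equiv_class_eq[OF equiv])
  qed
  show "F i j = F i' j'"
    if i: "i \<in> P.pd I" and j: "j \<in> Q.pd (J i)" and i': "i' \<in> P.pd I" and j': "j' \<in> Q.pd (J i')"
      and c: "cls p q (I, J) (i, j) = cls p q (I, J) (i', j')"
      and F: "\<And>i g j. i \<in> P.pd I \<Longrightarrow> g \<in> dirs (cpoly d) (rob p I i) \<Longrightarrow> j \<in> Q.pd (lact q (J i) g) \<Longrightarrow>
         F (ract p I i g) j = F i (lback q (J i) g j)"
  proof -
    have "((i, j), (i', j')) \<in> ?E"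
      using c i j i' j' eq_equiv_class[OF _ equiv] by (simp add: cls)
    moreover have "(case ondir (bpar1 p q) (I, J) k of (i, j) \<Rightarrow> F i j) =
        (case ondir (bpar2 p q) (I, J) k of (i, j) \<Rightarrow> F i j)"
      if "k \<in> dirs (carrier p \<lhd> (cpoly d \<lhd> carrier q)) (onpos (bpar1 p q) (I, J))" for k
    proof -
      obtain i g j where k: "k = (i, g, j)" by (metis surj_pair)
      have "i \<in> P.pd I" "g \<in> dirs (cpoly d) (rob p I i)" "j \<in> Q.pd (lact q (J i) g)"
        using that unfolding k onpos_bpar1[OF I J] by (auto simp: n)
      then show ?thesis
        using ondir_bpar1[OF I J, of i g j] ondir_bpar2[OF I J, of i g j] F by (simp add: n k)
    qed
    ultimately have "(case (i, j) of (i, j) \<Rightarrow> F i j) = (case (i', j') of (i, j) \<Rightarrow> F i j)"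
      by (rule eq_rel_least[OF _ bpar1 bpar2 z' eq])
    then show ?thesis by simp
  qed
qed

text \<open>\<open>G\<close> evaluates \<open>F\<close> at a chosen representative; by
  \<open>cls_eqD\<close> the value does not depend on the choice.\<close>

lemma cls_lift:
  assumes z: "(I, J) \<in> pos (carrier (p \<odot> q))"
    and F: "\<And>i g j. i \<in> P.pd I \<Longrightarrow> g \<in> dirs (cpoly d) (rob p I i) \<Longrightarrow> j \<in> Q.pd (lact q (J i) g) \<Longrightarrow>
         F (ract p I i g) j = F i (lback q (J i) g j)"
  obtains G where "\<And>i j. i \<in> P.pd I \<Longrightarrow> j \<in> Q.pd (J i) \<Longrightarrow> G (cls p q (I, J) (i, j)) = F i j"
proof
  fix i j assume i: "i \<in> P.pd I" and j: "j \<in> Q.pd (J i)"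
  let ?t = "SOME (i', j'). i' \<in> P.pd I \<and> j' \<in> Q.pd (J i') \<and> cls p q (I, J) (i, j) = cls p q (I, J) (i', j')"
  have "case ?t of (i', j') \<Rightarrow> i' \<in> P.pd I \<and> j' \<in> Q.pd (J i') \<and> cls p q (I, J) (i, j) = cls p q (I, J) (i', j')"
    by (rule someI[where x="(i, j)"]) (simp add: i j)
  then have "F i j = (case ?t of (i, j) \<Rightarrow> F i j)"
    using cls_eqD[OF z i j, of _ _ F] F by (auto split: prod.splits)
  then show "(\<lambda>s. case SOME (i, j). i \<in> P.pd I \<and> j \<in> Q.pd (J i) \<and> s = cls p q (I, J) (i, j) of (i, j) \<Rightarrow> F i j)
     (cls p q (I, J) (i, j)) = F i j" by simp
qed

section \<open>The two coactions of a composite\<close>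

abbreviation "lpos I J f \<equiv> (lact p I f, \<lambda>i\<in>P.pd (lact p I f). J (lback p I f i))"

lemma lpos_mem:
  assumes z: "(I, J) \<in> pos (carrier (p \<odot> q))" and f: "f \<in> dirs (cpoly c) (lob p I)"
  shows "lpos I J f \<in> pos (carrier (p \<odot> q))"
  using z f unfolding pos_bcomp_iff by (auto simp del: P.ract_lback simp: P.ract_lback[symmetric])

text \<open>\<open>h\<close> is the map whose factorization defines the left coaction of the
  composite. In coordinates it becomes visible where the factorization must land and what has to
  respect classes.\<close>

lemma lcoact_aux:
  defines "h \<equiv> passoc (cpoly c) (carrier p) (carrier q) \<circ>\<^sub>p (lcoact p \<lhd>\<^sub>m pid (carrier q)) \<circ>\<^sub>p bincl p q"
  shows "h \<in> phom (carrier (p \<odot> q)) (cpoly c \<lhd> (carrier p \<lhd> carrier q))"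
    and "(I, J) \<in> pos (carrier (p \<odot> q)) \<Longrightarrow> onpos h (I, J) = (lob p I, \<lambda>f\<in>dirs (cpoly c) (lob p I). lpos I J f)"
    and "(I, J) \<in> pos (carrier (p \<odot> q)) \<Longrightarrow> f \<in> dirs (cpoly c) (lob p I) \<Longrightarrow> i \<in> P.pd (lact p I f) \<Longrightarrow>
      j \<in> Q.pd (J (lback p I f i)) \<Longrightarrow> ondir h (I, J) (f, i, j) = cls p q (I, J) (lback p I f i, j)"
proof -
  note t = ptrim_phom[OF P.lcoact pid_phom[of "carrier q"]]
  note t2 = pcomp_phom[OF t passoc_phom]
  show "h \<in> phom (carrier (p \<odot> q)) (cpoly c \<lhd> (carrier p \<lhd> carrier q))"
    unfolding h_def by (rule pcomp_phom[OF bincl t2])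
  assume z: "(I, J) \<in> pos (carrier (p \<odot> q))"
  then have I: "I \<in> P.pp" and J: "J \<in> P.pd I \<rightarrow>\<^sub>E Q.pp" by (auto simp: pos_bcomp_iff)
  have J': "J i \<in> Q.pp" if "i \<in> P.pd I" for i using J that by (rule PiE_mem)
  have IJ: "(I, J) \<in> pos (carrier p \<lhd> carrier q)" using I J by (rule ptri_posI)
  note 1 = ptrim_simps[OF P.lcoact pid_phom[of "carrier q"] IJ, unfolded P.onpos_lcoact[OF I]]
  have r: "ondir (lcoact p) I (f, i) = lback p I f i" for i f by (simp add: lback_def)
  have 2: "onpos (lcoact p \<lhd>\<^sub>m pid (carrier q)) (I, J) = ((lob p I, \<lambda>f\<in>dirs (cpoly c) (lob p I). lact p I f),
     \<lambda>(f, i)\<in>(SIGMA f:dirs (cpoly c) (lob p I). P.pd (lact p I f)). J (lback p I f i))"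
    using I J' unfolding 1(1) ptri_dirs_restrict by (auto simp: r intro!: restrict_ext)
  note 3 = phom_pos[OF t IJ, unfolded 2]
  have hp: "onpos h (I, J) = onpos (passoc (cpoly c) (carrier p) (carrier q))
      (onpos (lcoact p \<lhd>\<^sub>m pid (carrier q)) (I, J))"
    unfolding h_def pcomp_simps(1)[OF bincl t2 z] bincl_pos[OF z] pcomp_simps(1)[OF t passoc_phom IJ] ..
  show hp2: "onpos h (I, J) = (lob p I, \<lambda>f\<in>dirs (cpoly c) (lob p I). lpos I J f)"
    unfolding hp 2 passoc_simps(1)[OF 3] by (auto intro!: restrict_ext)
  assume f: "f \<in> dirs (cpoly c) (lob p I)" and i: "i \<in> P.pd (lact p I f)" and j: "j \<in> Q.pd (J (lback p I f i))"
  have d: "(f, i, j) \<in> dirs (cpoly c \<lhd> (carrier p \<lhd> carrier q))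
     (onpos (passoc (cpoly c) (carrier p) (carrier q)) (onpos (lcoact p \<lhd>\<^sub>m pid (carrier q)) (I, J)))"
    unfolding hp[symmetric] hp2 using f i j by simp
  then have d': "(f, i, j) \<in> dirs (cpoly c \<lhd> (carrier p \<lhd> carrier q))
     (onpos (passoc (cpoly c) (carrier p) (carrier q) \<circ>\<^sub>p (lcoact p \<lhd>\<^sub>m pid (carrier q))) (onpos (bincl p q) (I, J)))"
    by (simp add: bincl_pos[OF z] pcomp_simps(1)[OF t passoc_phom IJ])
  have "ondir h (I, J) (f, i, j) =
      cls p q (I, J) (ondir (lcoact p \<lhd>\<^sub>m pid (carrier q)) (I, J) ((f, i), j))"
    unfolding h_def pcomp_simps(2)[OF bincl t2 z d'] bincl_pos[OF z] pcomp_simps(2)[OF t passoc_phom IJ d] cls_def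
    unfolding 2 using f i j by (subst passoc_simps(2)[OF 3]) auto
  also have "\<dots> = cls p q (I, J) (lback p I f i, j)"
    using f i j I J' by (subst 1(2)) (auto simp: r)
  finally show "ondir h (I, J) (f, i, j) = cls p q (I, J) (lback p I f i, j)" .
qed

text \<open>On positions \<open>h\<close> already lands in the equalizer, so the content is that
  pulling a direction back along \<open>f\<close> respects classes; \<open>pfactor_pmono\<close>
  then supplies the coaction, and its values follow by applying the monomorphism.\<close>

lemma
  shows lcoact_bcomp: "lcoact (p \<odot> q) \<in> phom (carrier (p \<odot> q)) (cpoly c \<lhd> carrier (p \<odot> q))"
    and lob_bcomp: "(I, J) \<in> pos (carrier (p \<odot> q)) \<Longrightarrow> lob (p \<odot> q) (I, J) = lob p I"
    and lact_bcomp: "(I, J) \<in> pos (carrier (p \<odot> q)) \<Longrightarrow> f \<in> dirs (cpoly c) (lob p I) \<Longrightarrow>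
      lact (p \<odot> q) (I, J) f = lpos I J f"
    and lback_bcomp: "(I, J) \<in> pos (carrier (p \<odot> q)) \<Longrightarrow> f \<in> dirs (cpoly c) (lob p I) \<Longrightarrow>
      i \<in> P.pd (lact p I f) \<Longrightarrow> j \<in> Q.pd (J (lback p I f i)) \<Longrightarrow>
      lback (p \<odot> q) (I, J) f (cls p q (lpos I J f) (i, j)) = cls p q (I, J) (lback p I f i, j)"
proof -
  let ?h = "passoc (cpoly c) (carrier p) (carrier q) \<circ>\<^sub>p (lcoact p \<lhd>\<^sub>m pid (carrier q)) \<circ>\<^sub>p bincl p q"
  let ?e = "pid (cpoly c) \<lhd>\<^sub>m bincl p q"
  note h = lcoact_aux
  note e = ptrim_phom[OF pid_phom[of "cpoly c"] bincl]
  note em = pmono_ptrim[OF pid_phom[of "cpoly c"] pmono_pid bincl bincl_mono]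
  have l: "lcoact (p \<odot> q) = pfactor ?e ?h" by (simp add: bcomp_def)
  have hm: "onpos ?h z \<in> pos (cpoly c \<lhd> carrier (p \<odot> q))" if z: "z \<in> pos (carrier (p \<odot> q))" for z
  proof -
    obtain I J where z': "z = (I, J)" by (cases z)
    have "I \<in> P.pp" using z by (auto simp: pos_bcomp_iff z')
    then show ?thesis
      using z lpos_mem[of I J] unfolding z' h(2)[OF z[unfolded z']] by (intro ptri_posI) auto
  qed
  \<comment> \<open>The monomorphism is the identity on positions, so the required lift of
    \<open>onpos ?h z\<close> is that position itself.\<close>
  have ep: "onpos ?e w = w" if w: "w \<in> pos (cpoly c \<lhd> carrier (p \<odot> q))" for w
  proof -
    obtain a K where w': "w = (a, K)" "a \<in> pos (cpoly c)" and K: "K \<in> dirs (cpoly c) a \<rightarrow>\<^sub>E pos (carrier (p \<odot> q))"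
      using w by (rule ptri_posE)
    have "(\<lambda>k\<in>dirs (cpoly c) a. onpos (bincl p q) (K (ondir (pid (cpoly c)) a k))) = K"
      using w' PiE_mem[OF K] K
      by (intro extensionalityI[where A="dirs (cpoly c) a"]) (auto simp: bincl_pos PiE_def)
    then show ?thesis using w'(2)
      by (simp add: w'(1) ptrim_simps(1)[OF pid_phom bincl w[unfolded w']])
  qed
  have ed: "ondir ?e (lob p I, \<lambda>f\<in>dirs (cpoly c) (lob p I). lpos I J f) (f, i, j) = (f, cls p q (lpos I J f) (i, j))"
    if z: "(I, J) \<in> pos (carrier (p \<odot> q))" and f: "f \<in> dirs (cpoly c) (lob p I)"
      and i: "i \<in> P.pd (lact p I f)" and j: "j \<in> Q.pd (J (lback p I f i))" for I J f i j
  proof -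
    note m = hm[OF z, unfolded h(2)[OF z]]
    have I: "I \<in> P.pp" using z by (auto simp: pos_bcomp_iff)
    show ?thesis using I f i j
      by (subst ptrim_simps(2)[OF pid_phom bincl m]) (auto simp: cls_def bincl_pos[OF lpos_mem[OF z f]])
  qed
  have fac: "\<exists>K\<in>pos (cpoly c \<lhd> carrier (p \<odot> q)). onpos ?e K = onpos ?h z \<and>
      (\<forall>s\<in>dirs (cpoly c \<lhd> (carrier p \<lhd> carrier q)) (onpos ?h z). \<forall>t\<in>dirs (cpoly c \<lhd> (carrier p \<lhd> carrier q)) (onpos ?h z).
        ondir ?e K s = ondir ?e K t \<longrightarrow> ondir ?h z s = ondir ?h z t)" if z: "z \<in> pos (carrier (p \<odot> q))" for z
  proof (rule bexI[OF _ hm[OF z]], intro conjI ep[OF hm[OF z]] ballI impI)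
    obtain I J where z': "z = (I, J)" and I: "I \<in> P.pp"
      and J: "J \<in> P.pd I \<rightarrow>\<^sub>E Q.pp" "\<And>i. i \<in> P.pd I \<Longrightarrow> J i \<in> Q.pp" "\<And>i. i \<in> P.pd I \<Longrightarrow> lob q (J i) = rob p I i"
      "\<And>i g. i \<in> P.pd I \<Longrightarrow> g \<in> dirs (cpoly d) (rob p I i) \<Longrightarrow> J (ract p I i g) = lact q (J i) g"
      using z by (elim pos_bcompE) (rule that)
    note z2 = z[unfolded z']
    fix s t assume "s \<in> dirs (cpoly c \<lhd> (carrier p \<lhd> carrier q)) (onpos ?h z)"
      and "t \<in> dirs (cpoly c \<lhd> (carrier p \<lhd> carrier q)) (onpos ?h z)"
      and eq: "ondir ?e (onpos ?h z) s = ondir ?e (onpos ?h z) t"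
    then obtain f i j f' i' j' where s: "s = (f, i, j)" "f \<in> dirs (cpoly c) (lob p I)" "i \<in> P.pd (lact p I f)" "j \<in> Q.pd (J (lback p I f i))"
      and t: "t = (f', i', j')" "f' \<in> dirs (cpoly c) (lob p I)" "i' \<in> P.pd (lact p I f')" "j' \<in> Q.pd (J (lback p I f' i'))"
      unfolding z' h(2)[OF z2] by auto
    have f: "f' = f" and c: "cls p q (lpos I J f) (i, j) = cls p q (lpos I J f) (i', j')"
      using eq unfolding z' h(2)[OF z2] s(1) t(1) ed[OF z2 s(2-)] ed[OF z2 t(2-)] by auto
    note [simp] = s(2)
    \<comment> \<open>The back map of \<open>p\<close> commutes with the right action, so it sends a
      generating pair at the translated position to a generating pair at
      \<open>(I, J)\<close>.\<close>
    have "cls p q (I, J) (lback p I f i, j) = cls p q (I, J) (lback p I f i', j')"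
    proof (rule cls_eqD[OF lpos_mem[OF z2 s(2)] s(3) _ _ _ c, where F="\<lambda>i j. cls p q (I, J) (lback p I f i, j)"])
      show "j \<in> Q.pd ((\<lambda>i\<in>P.pd (lact p I f). J (lback p I f i)) i)" "i' \<in> P.pd (lact p I f)"
        "j' \<in> Q.pd ((\<lambda>i\<in>P.pd (lact p I f). J (lback p I f i)) i')" using s t f by auto
    next
      fix i g j assume i: "i \<in> P.pd (lact p I f)" and g: "g \<in> dirs (cpoly d) (rob p (lact p I f) i)"
        and j: "j \<in> Q.pd (lact q ((\<lambda>i\<in>P.pd (lact p I f). J (lback p I f i)) i) g)"
      have "cls p q (I, J) (lback p I f (ract p (lact p I f) i g), j) = cls p q (I, J) (ract p I (lback p I f i) g, j)"
        using I i g by simp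
      also have "\<dots> = cls p q (I, J) (lback p I f i, lback q (J (lback p I f i)) g j)"
        using I i g j by (intro cls_gen[OF z2]) auto
      finally show "cls p q (I, J) (lback p I f (ract p (lact p I f) i g), j) =
        cls p q (I, J) (lback p I f i, lback q ((\<lambda>i\<in>P.pd (lact p I f). J (lback p I f i)) i) g j)"
        using i by simp
    qed
    then show "ondir ?h z s = ondir ?h z t"
      using t unfolding z' s(1) t(1) h(3)[OF z2 s(2-)] h(3)[OF z2 t(2-)] unfolding f by simp
  qed
  note fac' = pfactor_pmono[OF e em h(1) fac, folded l]
  show l': "lcoact (p \<odot> q) \<in> phom (carrier (p \<odot> q)) (cpoly c \<lhd> carrier (p \<odot> q))"
    by (rule fac'(1))
  assume z: "(I, J) \<in> pos (carrier (p \<odot> q))"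
  have pos: "onpos (lcoact (p \<odot> q)) (I, J) = (lob p I, \<lambda>f\<in>dirs (cpoly c) (lob p I). lpos I J f)"
    using arg_cong[OF fac'(2), of "\<lambda>x. onpos x (I, J)"]
    unfolding pcomp_simps(1)[OF l' e z] ep[OF phom_pos[OF l' z]] h(2)[OF z] .
  then show "lob (p \<odot> q) (I, J) = lob p I" by (simp add: lob_def)
  assume f: "f \<in> dirs (cpoly c) (lob p I)"
  then show "lact (p \<odot> q) (I, J) f = lpos I J f" using pos by (simp add: lact_def)
  assume i: "i \<in> P.pd (lact p I f)" and j: "j \<in> Q.pd (J (lback p I f i))"
  have "(f, i, j) \<in> dirs (cpoly c \<lhd> (carrier p \<lhd> carrier q)) (onpos ?e (onpos (lcoact (p \<odot> q)) (I, J)))"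
    unfolding ep[OF phom_pos[OF l' z]] unfolding pos using f i j by simp
  from pcomp_simps(2)[OF l' e z this]
  show "lback (p \<odot> q) (I, J) f (cls p q (lpos I J f) (i, j)) = cls p q (I, J) (lback p I f i, j)"
    using arg_cong[OF fac'(2), of "\<lambda>x. ondir x (I, J) (f, i, j)"] h(3)[OF z f i j] pos ed[OF z f i j]
    by (simp add: lback_def[of "p \<odot> q"])
qed

lemma rcoact_aux:
  defines "h \<equiv> passoc_inv (carrier p) (carrier q) (cpoly e) \<circ>\<^sub>p (pid (carrier p) \<lhd>\<^sub>m rcoact q) \<circ>\<^sub>p bincl p q"
  shows "h \<in> phom (carrier (p \<odot> q)) ((carrier p \<lhd> carrier q) \<lhd> cpoly e)"
    and "(I, J) \<in> pos (carrier (p \<odot> q)) \<Longrightarrow> onpos h (I, J) =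
      ((I, J), \<lambda>(i, j)\<in>(SIGMA i:P.pd I. Q.pd (J i)). rob q (J i) j)"
    and "(I, J) \<in> pos (carrier (p \<odot> q)) \<Longrightarrow> i \<in> P.pd I \<Longrightarrow> j \<in> Q.pd (J i) \<Longrightarrow>
      k \<in> dirs (cpoly e) (rob q (J i) j) \<Longrightarrow> ondir h (I, J) ((i, j), k) = cls p q (I, J) (i, ract q (J i) j k)"
proof -
  note t = ptrim_phom[OF pid_phom[of "carrier p"] Q.rcoact]
  note t2 = pcomp_phom[OF t passoc_inv_phom]
  show "h \<in> phom (carrier (p \<odot> q)) ((carrier p \<lhd> carrier q) \<lhd> cpoly e)"
    unfolding h_def by (rule pcomp_phom[OF bincl t2])
  assume z: "(I, J) \<in> pos (carrier (p \<odot> q))"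
  then have I: "I \<in> P.pp" and J: "J \<in> P.pd I \<rightarrow>\<^sub>E Q.pp" by (auto simp: pos_bcomp_iff)
  have J': "J i \<in> Q.pp" if "i \<in> P.pd I" for i using J that by (rule PiE_mem)
  have IJ: "(I, J) \<in> pos (carrier p \<lhd> carrier q)" using I J by (rule ptri_posI)
  note 1 = ptrim_simps[OF pid_phom[of "carrier p"] Q.rcoact IJ]
  have 2: "onpos (pid (carrier p) \<lhd>\<^sub>m rcoact q) (I, J) = (I, \<lambda>i\<in>P.pd I. (J i, \<lambda>j\<in>Q.pd (J i). rob q (J i) j))"
    unfolding 1(1) using I J' by (auto simp: Q.onpos_rcoact intro!: restrict_ext)
  note 3 = phom_pos[OF t IJ, unfolded 2]
  have hp: "onpos h (I, J) = onpos (passoc_inv (carrier p) (carrier q) (cpoly e))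
      (onpos (pid (carrier p) \<lhd>\<^sub>m rcoact q) (I, J))"
    unfolding h_def pcomp_simps(1)[OF bincl t2 z] bincl_pos[OF z] pcomp_simps(1)[OF t passoc_inv_phom IJ] ..
  have JJ: "(\<lambda>i\<in>P.pd I. J i) = J" using J by (rule PiE_restrict)
  show hp2: "onpos h (I, J) = ((I, J), \<lambda>(i, j)\<in>(SIGMA i:P.pd I. Q.pd (J i)). rob q (J i) j)"
    unfolding hp 2 passoc_inv_simps(1)[OF 3] by (auto simp: JJ cong: restrict_cong)
  assume i: "i \<in> P.pd I" and j: "j \<in> Q.pd (J i)" and k: "k \<in> dirs (cpoly e) (rob q (J i) j)"
  have d: "((i, j), k) \<in> dirs ((carrier p \<lhd> carrier q) \<lhd> cpoly e)
     (onpos (passoc_inv (carrier p) (carrier q) (cpoly e)) (onpos (pid (carrier p) \<lhd>\<^sub>m rcoact q) (I, J)))"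
    unfolding hp[symmetric] hp2 using i j k by simp
  then have d': "((i, j), k) \<in> dirs ((carrier p \<lhd> carrier q) \<lhd> cpoly e)
     (onpos (passoc_inv (carrier p) (carrier q) (cpoly e) \<circ>\<^sub>p (pid (carrier p) \<lhd>\<^sub>m rcoact q)) (onpos (bincl p q) (I, J)))"
    by (simp add: bincl_pos[OF z] pcomp_simps(1)[OF t passoc_inv_phom IJ])
  have "ondir h (I, J) ((i, j), k) =
      cls p q (I, J) (ondir (pid (carrier p) \<lhd>\<^sub>m rcoact q) (I, J) (i, j, k))"
    unfolding h_def pcomp_simps(2)[OF bincl t2 z d'] bincl_pos[OF z] pcomp_simps(2)[OF t passoc_inv_phom IJ d] cls_def
    unfolding 2 using i j k by (subst passoc_inv_simps(2)[OF 3]) auto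
  also have "\<dots> = cls p q (I, J) (i, ract q (J i) j k)"
    using i j k I J' by (subst 1(2)) (auto simp: ract_def Q.onpos_rcoact)
  finally show "ondir h (I, J) ((i, j), k) = cls p q (I, J) (i, ract q (J i) j k)" .
qed

text \<open>Here the position part needs lifting too: the coaction labels directions by objects of
  \<open>e\<close>, and directions are classes. The label \<open>rob q (J i) j\<close> is balanced
  and descends by \<open>cls_lift\<close>; afterwards the action is shown to respect
  classes.\<close>

lemma
  shows rcoact_bcomp: "rcoact (p \<odot> q) \<in> phom (carrier (p \<odot> q)) (carrier (p \<odot> q) \<lhd> cpoly e)"
    and fst_rcoact_bcomp: "z \<in> pos (carrier (p \<odot> q)) \<Longrightarrow> fst (onpos (rcoact (p \<odot> q)) z) = z"
    and rob_bcomp: "(I, J) \<in> pos (carrier (p \<odot> q)) \<Longrightarrow> i \<in> P.pd I \<Longrightarrow> j \<in> Q.pd (J i) \<Longrightarrow>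
      rob (p \<odot> q) (I, J) (cls p q (I, J) (i, j)) = rob q (J i) j"
    and ract_bcomp: "(I, J) \<in> pos (carrier (p \<odot> q)) \<Longrightarrow> i \<in> P.pd I \<Longrightarrow> j \<in> Q.pd (J i) \<Longrightarrow>
      k \<in> dirs (cpoly e) (rob q (J i) j) \<Longrightarrow>
      ract (p \<odot> q) (I, J) (cls p q (I, J) (i, j)) k = cls p q (I, J) (i, ract q (J i) j k)"
proof -
  let ?h = "passoc_inv (carrier p) (carrier q) (cpoly e) \<circ>\<^sub>p (pid (carrier p) \<lhd>\<^sub>m rcoact q) \<circ>\<^sub>p bincl p q"
  let ?e = "bincl p q \<lhd>\<^sub>m pid (cpoly e)"
  note h = rcoact_aux
  note e = ptrim_phom[OF bincl pid_phom[of "cpoly e"]]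
  note em = pmono_ptrim[OF bincl bincl_mono pid_phom[of "cpoly e"] pmono_pid]
  have r: "rcoact (p \<odot> q) = pfactor ?e ?h" by (simp add: bcomp_def)
  have ep: "onpos ?e (w, K) = (w, \<lambda>t\<in>dirs (carrier p \<lhd> carrier q) w. K (cls p q w t))"
    if w: "(w, K) \<in> pos (carrier (p \<odot> q) \<lhd> cpoly e)" for w K
  proof -
    have w': "w \<in> pos (carrier (p \<odot> q))" and K: "K \<in> dirs (carrier (p \<odot> q)) w \<rightarrow>\<^sub>E pos (cpoly e)"
      using w by (auto simp: ptri_pos)
    show ?thesis
      using PiE_mem[OF K phom_dir[OF bincl w']]
      by (auto simp: ptrim_simps(1)[OF bincl pid_phom w] bincl_pos[OF w'] cls_def intro!: restrict_ext)
  qed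
  have ed: "ondir ?e (w, K) (t, k) = (cls p q w t, k)"
    if w: "(w, K) \<in> pos (carrier (p \<odot> q) \<lhd> cpoly e)" and "t \<in> dirs (carrier p \<lhd> carrier q) w"
      and "k \<in> dirs (cpoly e) (K (cls p q w t))" for w K t k
  proof -
    have w': "w \<in> pos (carrier (p \<odot> q))" and K: "K \<in> dirs (carrier (p \<odot> q)) w \<rightarrow>\<^sub>E pos (cpoly e)"
      using w by (auto simp: ptri_pos)
    have "K (cls p q w t) \<in> pos (cpoly e)"
      using PiE_mem[OF K] phom_dir[OF bincl w', of t] that by (auto simp: cls_def bincl_pos[OF w'])
    then show ?thesis using that
      by (subst ptrim_simps(2)[OF bincl pid_phom w]) (auto simp: bincl_pos[OF w'] cls_def)
  qed
  have fac1: "\<exists>K. (z, K) \<in> pos (carrier (p \<odot> q) \<lhd> cpoly e) \<and> onpos ?e (z, K) = onpos ?h z \<and>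
      (\<forall>i\<in>P.pd (fst z). \<forall>j\<in>Q.pd (snd z i). K (cls p q z (i, j)) = rob q (snd z i) j)"
    if z: "z \<in> pos (carrier (p \<odot> q))" for z
  proof -
    obtain I J where z': "z = (I, J)" and I: "I \<in> P.pp"
      and J: "J \<in> P.pd I \<rightarrow>\<^sub>E Q.pp" "\<And>i. i \<in> P.pd I \<Longrightarrow> J i \<in> Q.pp" "\<And>i. i \<in> P.pd I \<Longrightarrow> lob q (J i) = rob p I i"
      "\<And>i g. i \<in> P.pd I \<Longrightarrow> g \<in> dirs (cpoly d) (rob p I i) \<Longrightarrow> J (ract p I i g) = lact q (J i) g"
      using z by (elim pos_bcompE) (rule that)
    note z2 = z[unfolded z']
    obtain G where G: "\<And>i j. i \<in> P.pd I \<Longrightarrow> j \<in> Q.pd (J i) \<Longrightarrow> G (cls p q (I, J) (i, j)) = rob q (J i) j"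
      by (rule cls_lift[OF z2, of "\<lambda>i j. rob q (J i) j"]) (use J in auto)
    let ?K = "restrict G (dirs (carrier (p \<odot> q)) z)"
    have K: "?K (cls p q (I, J) (i, j)) = rob q (J i) j" if "i \<in> P.pd I" "j \<in> Q.pd (J i)" for i j
      using cls_mem[OF z2 that] G[OF that] by (simp add: z')
    have "G s \<in> pos (cpoly e)" if "s \<in> dirs (carrier (p \<odot> q)) z" for s
      using that unfolding z' by (rule dirs_bcompE[OF z2]) (auto simp: G J)
    then have m: "(z, ?K) \<in> pos (carrier (p \<odot> q) \<lhd> cpoly e)" using z by (intro ptri_posI) auto
    have "onpos ?e (z, ?K) = onpos ?h z"
      unfolding ep[OF m] unfolding z' h(2)[OF z2]
      using K unfolding z' by (auto intro!: restrict_ext)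
    then show ?thesis using m K by (intro exI[of _ ?K]) (auto simp: z')
  qed
  have kern: "cls p q (I, J) (i, ract q (J i) j k) = cls p q (I, J) (i', ract q (J i') j' k)"
    if z: "(I, J) \<in> pos (carrier (p \<odot> q))" and i: "i \<in> P.pd I" and j: "j \<in> Q.pd (J i)"
    and i': "i' \<in> P.pd I" and j': "j' \<in> Q.pd (J i')" and c: "cls p q (I, J) (i, j) = cls p q (I, J) (i', j')"
    and k: "k \<in> dirs (cpoly e) (rob q (J i) j)" "k \<in> dirs (cpoly e) (rob q (J i') j')" for I J i j i' j' k
  proof -
    obtain I: "I \<in> P.pp" and J: "\<And>i. i \<in> P.pd I \<Longrightarrow> J i \<in> Q.pp" "\<And>i. i \<in> P.pd I \<Longrightarrow> lob q (J i) = rob p I i"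
      "\<And>i g. i \<in> P.pd I \<Longrightarrow> g \<in> dirs (cpoly d) (rob p I i) \<Longrightarrow> J (ract p I i g) = lact q (J i) g"
      using z unfolding pos_bcomp_iff by (auto simp: PiE_iff)
    \<comment> \<open>\<open>cls_eqD\<close> ranges over all pairs, while \<open>k\<close> acts only
      where the label permits. Labels agree along a generating pair, so the default value is only
      ever compared with itself.\<close>
    let ?F = "\<lambda>i j. if k \<in> dirs (cpoly e) (rob q (J i) j) then cls p q (I, J) (i, ract q (J i) j k) else undefined"
    have "?F i j = ?F i' j'"
    proof (rule cls_eqD[OF z i j i' j' c, where F="?F"])
      fix i g j assume *: "i \<in> P.pd I" "g \<in> dirs (cpoly d) (rob p I i)" "j \<in> Q.pd (lact q (J i) g)"
      have "cls p q (I, J) (ract p I i g, ract q (lact q (J i) g) j k) =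
          cls p q (I, J) (i, lback q (J i) g (ract q (lact q (J i) g) j k))"
        if "k \<in> dirs (cpoly e) (rob q (lact q (J i) g) j)"
        using * J that by (intro cls_gen[OF z]) auto
      then show "?F (ract p I i g) j = ?F i (lback q (J i) g j)" using * J by simp
    qed
    then show ?thesis using k by simp
  qed
  have fac: "\<exists>K\<in>pos (carrier (p \<odot> q) \<lhd> cpoly e). onpos ?e K = onpos ?h z \<and>
      (\<forall>s\<in>dirs ((carrier p \<lhd> carrier q) \<lhd> cpoly e) (onpos ?h z). \<forall>t\<in>dirs ((carrier p \<lhd> carrier q) \<lhd> cpoly e) (onpos ?h z).
        ondir ?e K s = ondir ?e K t \<longrightarrow> ondir ?h z s = ondir ?h z t)" if z: "z \<in> pos (carrier (p \<odot> q))" for z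
  proof -
    obtain K where K: "(z, K) \<in> pos (carrier (p \<odot> q) \<lhd> cpoly e)" "onpos ?e (z, K) = onpos ?h z"
      "\<And>i j. i \<in> P.pd (fst z) \<Longrightarrow> j \<in> Q.pd (snd z i) \<Longrightarrow> K (cls p q z (i, j)) = rob q (snd z i) j"
      using fac1[OF z] by blast
    obtain I J where z': "z = (I, J)" by (cases z)
    note z2 = z[unfolded z']
    show ?thesis
    proof (rule bexI[OF _ K(1)], intro conjI K(2) ballI impI)
      fix s t assume "s \<in> dirs ((carrier p \<lhd> carrier q) \<lhd> cpoly e) (onpos ?h z)"
        and "t \<in> dirs ((carrier p \<lhd> carrier q) \<lhd> cpoly e) (onpos ?h z)"
        and eq: "ondir ?e (z, K) s = ondir ?e (z, K) t"
      then obtain i j k i' j' k' where s: "s = ((i, j), k)" "i \<in> P.pd I" "j \<in> Q.pd (J i)" "k \<in> dirs (cpoly e) (rob q (J i) j)"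
        and t: "t = ((i', j'), k')" "i' \<in> P.pd I" "j' \<in> Q.pd (J i')" "k' \<in> dirs (cpoly e) (rob q (J i') j')"
        unfolding z' h(2)[OF z2] by auto
      have "ondir ?e (z, K) s = (cls p q (I, J) (i, j), k)" "ondir ?e (z, K) t = (cls p q (I, J) (i', j'), k')"
        using ed[OF K(1), of "(i, j)" k] ed[OF K(1), of "(i', j')" k'] K(3) s t by (auto simp: z')
      then have kk: "k' = k" and c: "cls p q (I, J) (i, j) = cls p q (I, J) (i', j')" using eq by auto
      show "ondir ?h z s = ondir ?h z t"
        unfolding z' s(1) t(1) h(3)[OF z2 s(2-)] h(3)[OF z2 t(2-)] unfolding kk
        using kern[OF z2 s(2,3) t(2,3) c] s t kk by simp
    qed
  qed
  note fac' = pfactor_pmono[OF e em h(1) fac, folded r]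
  show r': "rcoact (p \<odot> q) \<in> phom (carrier (p \<odot> q)) (carrier (p \<odot> q) \<lhd> cpoly e)"
    by (rule fac'(1))
  have pos: "\<exists>K. onpos (rcoact (p \<odot> q)) z = (z, K) \<and>
      (z, K) \<in> pos (carrier (p \<odot> q) \<lhd> cpoly e) \<and>
      (\<forall>i\<in>P.pd (fst z). \<forall>j\<in>Q.pd (snd z i). K (cls p q z (i, j)) = rob q (snd z i) j)"
    if z: "z \<in> pos (carrier (p \<odot> q))" for z
  proof -
    obtain K where K: "(z, K) \<in> pos (carrier (p \<odot> q) \<lhd> cpoly e)" "onpos ?e (z, K) = onpos ?h z"
      "\<And>i j. i \<in> P.pd (fst z) \<Longrightarrow> j \<in> Q.pd (snd z i) \<Longrightarrow> K (cls p q z (i, j)) = rob q (snd z i) j"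
      using fac1[OF z] by blast
    have "onpos ?e (onpos (rcoact (p \<odot> q)) z) = onpos ?h z"
      using arg_cong[OF fac'(2), of "\<lambda>x. onpos x z"] unfolding pcomp_simps(1)[OF r' e z] .
    then have "onpos (rcoact (p \<odot> q)) z = (z, K)"
      using pmono_inj[OF e em phom_pos[OF r' z] K(1)] K(2) by simp
    then show ?thesis using K by auto
  qed
  show "fst (onpos (rcoact (p \<odot> q)) z) = z" if "z \<in> pos (carrier (p \<odot> q))" for z
    using pos[OF that] by auto
  assume z: "(I, J) \<in> pos (carrier (p \<odot> q))" and i: "i \<in> P.pd I" and j: "j \<in> Q.pd (J i)"
  from pos[OF z] obtain K where K: "onpos (rcoact (p \<odot> q)) (I, J) = ((I, J), K)"
    "((I, J), K) \<in> pos (carrier (p \<odot> q) \<lhd> cpoly e)"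
      "\<And>i j. i \<in> P.pd I \<Longrightarrow> j \<in> Q.pd (J i) \<Longrightarrow> K (cls p q (I, J) (i, j)) = rob q (J i) j"
    by auto
  show "rob (p \<odot> q) (I, J) (cls p q (I, J) (i, j)) = rob q (J i) j"
    using K(3)[OF i j] by (simp add: rob_def[of "p \<odot> q"] K(1))
  assume k: "k \<in> dirs (cpoly e) (rob q (J i) j)"
  have "((i, j), k) \<in> dirs ((carrier p \<lhd> carrier q) \<lhd> cpoly e) (onpos ?e (onpos (rcoact (p \<odot> q)) (I, J)))"
    unfolding K(1) ep[OF K(2)] using K(3) i j k by simp
  from pcomp_simps(2)[OF r' e z this]
  have "cls p q (I, J) (i, ract q (J i) j k) = ondir (rcoact (p \<odot> q)) (I, J) (ondir ?e ((I, J), K) ((i, j), k))"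
    using arg_cong[OF fac'(2), of "\<lambda>x. ondir x (I, J) ((i, j), k)"] h(3)[OF z i j k] K(1) by simp
  then show "ract (p \<odot> q) (I, J) (cls p q (I, J) (i, j)) k = cls p q (I, J) (i, ract q (J i) j k)"
    using ed[OF K(2), of "(i, j)" k] i j k K(3) by (simp add: ract_def[of "p \<odot> q"])
qed

text \<open>Every direction is a class, so each law is checked on a representative: the left laws
  reduce to those of \<open>p\<close>, the right laws to those of \<open>q\<close>.\<close>

theorem bicomodule_bcomp: "bicomodule c e (p \<odot> q)"
proof -
  interpret C: catcom c by unfold_locales (rule P.comon)
  interpret E: catcom e by unfold_locales (rule Q.comon)
  let ?r = "p \<odot> q"
  have base: "lbase ?r = c" "rbase ?r = e" by (auto simp: bcomp_def)
  show ?thesis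
    unfolding bicomodule_iff
  proof (intro conjI ballI base lcoact_bcomp rcoact_bcomp P.comon Q.comon fst_rcoact_bcomp)
    fix z assume z: "z \<in> pos (carrier ?r)"
    obtain I J where z': "z = (I, J)" and I [simp]: "I \<in> P.pp"
      and J: "J \<in> P.pd I \<rightarrow>\<^sub>E Q.pp" and J' [simp]: "\<And>i. i \<in> P.pd I \<Longrightarrow> J i \<in> Q.pp" "\<And>i. i \<in> P.pd I \<Longrightarrow> lob q (J i) = rob p I i"
      "\<And>i g. i \<in> P.pd I \<Longrightarrow> g \<in> dirs (cpoly d) (rob p I i) \<Longrightarrow> J (ract p I i g) = lact q (J i) g"
      using z by (elim pos_bcompE) (rule that)
    note z2 = z[unfolded z']
    have lob [simp]: "lob ?r z = lob p I" by (simp add: z' lob_bcomp[OF z2])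
    have id: "cidm c (lob p I) \<in> dirs (cpoly c) (lob p I)" by simp
    have lid: "lpos I J (cidm c (lob p I)) = (I, J)"
      using J by (auto simp: PiE_iff extensional_def intro!: ext)
    show "lact ?r z (cidm c (lob ?r z)) = z"
      unfolding lob using lid by (simp add: z' lact_bcomp[OF z2])
    show "lback ?r z (cidm c (lob ?r z)) s = s" if "s \<in> dirs (carrier ?r) z" for s
      using that unfolding z'
    proof (rule dirs_bcompE[OF z2])
      fix i j assume ij: "i \<in> P.pd I" "j \<in> Q.pd (J i)" and s: "s = cls p q (I, J) (i, j)"
      then show "lback ?r (I, J) (cidm c (lob ?r (I, J))) s = s"
        using lback_bcomp[OF z2 id, of i j] lob unfolding lid by (simp add: z')
    qed
    show "ract ?r z s (cidm e (rob ?r z s)) = s" if "s \<in> dirs (carrier ?r) z" for s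
      using that unfolding z' by (rule dirs_bcompE[OF z2]) (simp add: rob_bcomp[OF z2] ract_bcomp[OF z2])
    show "rob ?r z (ract ?r z s g) = ccod e (rob ?r z s) g"
      if "s \<in> dirs (carrier ?r) z" "g \<in> dirs (cpoly e) (rob ?r z s)" for s g
      using that unfolding z' by (elim dirs_bcompE[OF z2]) (simp add: rob_bcomp[OF z2] ract_bcomp[OF z2])
    show "ract ?r z (ract ?r z s g) h = ract ?r z s (ccmp e (rob ?r z s) g h)"
      if "s \<in> dirs (carrier ?r) z" "g \<in> dirs (cpoly e) (rob ?r z s)" "h \<in> dirs (cpoly e) (ccod e (rob ?r z s) g)" for s g h
      using that unfolding z'
      by (elim dirs_bcompE[OF z2]) (simp add: rob_bcomp[OF z2] ract_bcomp[OF z2] Q.ract_ract)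
    fix f assume "f \<in> dirs (cpoly c) (lob ?r z)"
    then have f [simp]: "f \<in> dirs (cpoly c) (lob p I)" by simp
    have lact: "lact ?r z f = lpos I J f" by (simp add: z' lact_bcomp[OF z2])
    note fz = lpos_mem[OF z2 f]
    show "lob ?r (lact ?r z f) = ccod c (lob ?r z) f" by (simp add: lact lob_bcomp[OF fz])
    show "rob ?r z (lback ?r z f s) = rob ?r (lact ?r z f) s" if "s \<in> dirs (carrier ?r) (lact ?r z f)" for s
      using that unfolding lact
      by (elim dirs_bcompE[OF fz]) (simp add: z' lback_bcomp[OF z2 f] rob_bcomp[OF fz] rob_bcomp[OF z2])
    show "ract ?r z (lback ?r z f s) g = lback ?r z f (ract ?r (lact ?r z f) s g)"
      if "s \<in> dirs (carrier ?r) (lact ?r z f)" "g \<in> dirs (cpoly e) (rob ?r (lact ?r z f) s)" for s g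
      using that unfolding lact
      by (elim dirs_bcompE[OF fz])
        (simp add: z' lback_bcomp[OF z2 f] rob_bcomp[OF fz] ract_bcomp[OF fz] ract_bcomp[OF z2])
    fix g assume "g \<in> dirs (cpoly c) (ccod c (lob ?r z) f)"
    then have g [simp]: "g \<in> dirs (cpoly c) (ccod c (lob p I) f)" by simp
    then have g' [simp]: "g \<in> dirs (cpoly c) (lob p (lact p I f))" by simp
    have fg [simp]: "ccmp c (lob p I) f g \<in> dirs (cpoly c) (lob p I)" by simp
    \<comment> \<open>Functoriality on positions: reindexing \<open>J\<close> along the two back
      maps in turn is reindexing along the back map of the composite morphism.\<close>
    have eq: "lpos (lact p I f) (\<lambda>i\<in>P.pd (lact p I f). J (lback p I f i)) g = lpos I J (ccmp c (lob p I) f g)"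
      by (auto simp: P.lact_lact P.lback_lback P.lback[of "lact p I f", unfolded P.lact_lact[OF I f g]] intro!: restrict_ext)
    show "lact ?r z (ccmp c (lob ?r z) f g) = lact ?r (lact ?r z f) g"
      unfolding lact lact_bcomp[OF fz g'] eq lob by (simp add: z' lact_bcomp[OF z2 fg])
    show "lback ?r z (ccmp c (lob ?r z) f g) s = lback ?r z f (lback ?r (lact ?r z f) g s)"
      if "s \<in> dirs (carrier ?r) (lact ?r z (ccmp c (lob ?r z) f g))" for s
    proof -
      have s: "s \<in> dirs (carrier ?r) (lpos I J (ccmp c (lob p I) f g))"
        using that by (simp add: z' lob_bcomp[OF z2] lact_bcomp[OF z2 fg])
      show ?thesis
        using s
      proof (rule dirs_bcompE[OF lpos_mem[OF z2 fg]])
        fix i j assume i: "i \<in> P.pd (lact p I (ccmp c (lob p I) f g))"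
          and "j \<in> Q.pd ((\<lambda>i\<in>P.pd (lact p I (ccmp c (lob p I) f g)). J (lback p I (ccmp c (lob p I) f g) i)) i)"
          and s: "s = cls p q (lpos I J (ccmp c (lob p I) f g)) (i, j)"
        then have j: "j \<in> Q.pd (J (lback p I (ccmp c (lob p I) f g) i))" by simp
        have i': "i \<in> P.pd (lact p (lact p I f) g)" using i by (simp add: P.lact_lact)
        have b: "lback p (lact p I f) g i \<in> P.pd (lact p I f)" using i' by simp
        have bb: "lback p I f (lback p (lact p I f) g i) = lback p I (ccmp c (lob p I) f g) i"
          using i by (simp add: P.lback_lback)
        have 1: "lback ?r (lpos I J f) g s = cls p q (lpos I J f) (lback p (lact p I f) g i, j)"
          unfolding s eq[symmetric] using b j bb by (intro lback_bcomp[OF fz g' i']) simp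
        have 2: "lback ?r z f (lback ?r (lpos I J f) g s) = cls p q (I, J) (lback p I (ccmp c (lob p I) f g) i, j)"
          unfolding 1 z' using lback_bcomp[OF z2 f b, of j] j bb by simp
        show ?thesis
          unfolding lact 2 lob unfolding s z' by (rule lback_bcomp[OF z2 fg i j])
      qed
    qed
  qed
qed

end

section \<open>Copresheaves and the functor given by a bicomodule\<close>

text \<open>A direct encoding of the copresheaves that the coclosure treats as bicomodules into the
  empty category: elements, the object over each, and the action. Values off \<open>cel\<close> are
  unconstrained, which is why maps are compared on \<open>cel\<close> only.\<close>

record ('x, 'o, 'm) cps =
  cel :: "'x set"
  cob :: "'x \<Rightarrow> 'o"
  cact :: "'x \<Rightarrow> 'm \<Rightarrow> 'x"

definition copsh :: "('o, 'm) comonoid \<Rightarrow> ('x, 'o, 'm) cps \<Rightarrow> bool" where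
  "copsh d X \<longleftrightarrow> (\<forall>x\<in>cel X. cob X x \<in> pos (cpoly d) \<and> cact X x (cidm d (cob X x)) = x \<and>
     (\<forall>g\<in>dirs (cpoly d) (cob X x). cact X x g \<in> cel X \<and> cob X (cact X x g) = ccod d (cob X x) g \<and>
       (\<forall>h\<in>dirs (cpoly d) (ccod d (cob X x) g).
         cact X (cact X x g) h = cact X x (ccmp d (cob X x) g h))))"

definition copmap :: "('o, 'm) comonoid \<Rightarrow> ('x, 'o, 'm) cps \<Rightarrow> ('y, 'o, 'm) cps \<Rightarrow> ('x \<Rightarrow> 'y) \<Rightarrow> bool" where
  "copmap d X Y h \<longleftrightarrow> (\<forall>x\<in>cel X. h x \<in> cel Y \<and> cob Y (h x) = cob X x \<and>
     (\<forall>g\<in>dirs (cpoly d) (cob X x). h (cact X x g) = cact Y (h x) g))"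

definition copiso :: "('o, 'm) comonoid \<Rightarrow> ('x, 'o, 'm) cps \<Rightarrow> ('y, 'o, 'm) cps \<Rightarrow> ('x \<Rightarrow> 'y) \<Rightarrow> bool" where
  "copiso d X Y h \<longleftrightarrow> copmap d X Y h \<and> bij_betw h (cel X) (cel Y)"

text \<open>\<open>fib p I\<close> is the copresheaf \<open>p[I]\<close>, and \<open>beval p X\<close> is \<open>p\<langle>X\<rangle>\<close>.\<close>

definition fib :: "('i, 'a, 'c, 'f, 'd, 'g) bicom \<Rightarrow> 'i \<Rightarrow> ('a, 'd, 'g) cps" where
  "fib p I = \<lparr>cel = dirs (carrier p) I, cob = rob p I, cact = ract p I\<rparr>"

definition beval :: "('i, 'a, 'c, 'f, 'd, 'g) bicom \<Rightarrow> ('x, 'd, 'g) cps \<Rightarrow> ('i \<times> ('a \<Rightarrow> 'x), 'c, 'f) cps" where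
  "beval p X = \<lparr>cel = {(I, f). I \<in> pos (carrier p) \<and> f \<in> extensional (dirs (carrier p) I) \<and>
       copmap (rbase p) (fib p I) X f},
     cob = (\<lambda>(I, f). lob p I),
     cact = (\<lambda>(I, f) g. (lact p I g, \<lambda>i\<in>dirs (carrier p) (lact p I g). f (lback p I g i)))\<rparr>"

lemma copmapD:
  assumes "copmap d X Y h" "x \<in> cel X"
  shows "h x \<in> cel Y" "cob Y (h x) = cob X x"
    "g \<in> dirs (cpoly d) (cob X x) \<Longrightarrow> h (cact X x g) = cact Y (h x) g"
  using assms by (auto simp: copmap_def)

lemma copmapI:
  assumes "\<And>x. x \<in> cel X \<Longrightarrow> h x \<in> cel Y" "\<And>x. x \<in> cel X \<Longrightarrow> cob Y (h x) = cob X x"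
    "\<And>x g. x \<in> cel X \<Longrightarrow> g \<in> dirs (cpoly d) (cob X x) \<Longrightarrow> h (cact X x g) = cact Y (h x) g"
  shows "copmap d X Y h"
  using assms by (auto simp: copmap_def)

lemma copshD:
  assumes "copsh d X" "x \<in> cel X"
  shows "cob X x \<in> pos (cpoly d)" "cact X x (cidm d (cob X x)) = x"
    "g \<in> dirs (cpoly d) (cob X x) \<Longrightarrow> cact X x g \<in> cel X"
    "g \<in> dirs (cpoly d) (cob X x) \<Longrightarrow> cob X (cact X x g) = ccod d (cob X x) g"
    "g \<in> dirs (cpoly d) (cob X x) \<Longrightarrow> h \<in> dirs (cpoly d) (ccod d (cob X x) g) \<Longrightarrow>
      cact X (cact X x g) h = cact X x (ccmp d (cob X x) g h)"
  using assms by (auto simp: copsh_def)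

lemma copmap_comp:
  assumes "copmap d X Y h" "copmap d Y Z k"
  shows "copmap d X Z (\<lambda>x. k (h x))"
  using assms by (auto simp: copmap_def)

text \<open>Equivariance mentions the image of \<open>cact X x g\<close>, so \<open>cel X\<close>
  must be closed under the action before two maps agreeing on it can be exchanged.\<close>

lemma copmap_cong:
  assumes "copmap d X Y h" "copsh d X" "\<And>x. x \<in> cel X \<Longrightarrow> h x = k x"
  shows "copmap d X Y k"
  using assms by (auto simp: copmap_def copsh_def)

lemma copiso_comp:
  assumes "copiso d X Y h" "copiso d Y Z k"
  shows "copiso d X Z (\<lambda>x. k (h x))"
  using assms copmap_comp[of d X Y h Z k] bij_betw_trans[of h "cel X" "cel Y" k "cel Z"]
  by (auto simp: copiso_def comp_def)

lemma copisoD: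
  assumes "copiso d X Y h"
  shows "copmap d X Y h" "inj_on h (cel X)" "h ` cel X = cel Y"
  using assms by (auto simp: copiso_def bij_betw_def)

lemma fib_simps [simp]: "cel (fib p I) = dirs (carrier p) I" "cob (fib p I) = rob p I" "cact (fib p I) = ract p I"
  by (auto simp: fib_def)

lemma beval_simps [simp]:
  "(I, f) \<in> cel (beval p X) \<longleftrightarrow> I \<in> pos (carrier p) \<and> f \<in> extensional (dirs (carrier p) I) \<and> copmap (rbase p) (fib p I) X f"
  "cob (beval p X) (I, f) = lob p I"
  "cact (beval p X) (I, f) g = (lact p I g, \<lambda>i\<in>dirs (carrier p) (lact p I g). f (lback p I g i))"
  by (auto simp: beval_def)

lemma beval_pelts: "z \<in> cel (beval p X) \<Longrightarrow> z \<in> pelts (carrier p)"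
  by (cases z) (auto simp: pelts_def)

lemma papp_cong:
  "(\<And>x. x \<in> snd z ` dirs P (fst z) \<Longrightarrow> h x = k x) \<Longrightarrow> papp P h z = papp P k z"
  by (cases z) (auto simp: papp_def intro!: restrict_ext)

lemma beval_snd: "z \<in> cel (beval p X) \<Longrightarrow> x \<in> snd z ` dirs (carrier p) (fst z) \<Longrightarrow> x \<in> cel X"
  by (cases z) (auto simp: copmap_def)

lemma papp_cong_beval:
  assumes "z \<in> cel (beval p X)" "\<And>x. x \<in> cel X \<Longrightarrow> h x = k x"
  shows "papp (carrier p) h z = papp (carrier p) k z"
  using assms(2) beval_snd[OF assms(1)] by (intro papp_cong) auto

lemma papp_id: "z \<in> pelts P \<Longrightarrow> papp P (\<lambda>x. x) z = z"
  by (cases z) (auto simp: papp_def pelts_def extensional_restrict)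

context bicomod
begin

lemma copsh_fib: "I \<in> pp \<Longrightarrow> copsh d (fib p I)"
  by (auto simp: copsh_def ract_ract)

lemma copmap_lback: "I \<in> pp \<Longrightarrow> f \<in> dirs (cpoly c) (lob p I) \<Longrightarrow> copmap d (fib p (lact p I f)) (fib p I) (lback p I f)"
  by (auto simp: copmap_def)

lemma copsh_beval:
  assumes X: "copsh d X" shows "copsh c (beval p X)"
proof -
  interpret C: catcom c by unfold_locales (rule comon)
  show ?thesis
    unfolding copsh_def
  proof (intro ballI conjI)
    fix z assume z: "z \<in> cel (beval p X)"
    obtain I f where z': "z = (I, f)" by (cases z)
    have I [simp]: "I \<in> pp" and f: "f \<in> extensional (pd I)" "copmap d (fib p I) X f"
      using z by (auto simp: z')
    show "cob (beval p X) z \<in> pos (cpoly c)" by (simp add: z')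
    show "cact (beval p X) z (cidm c (cob (beval p X) z)) = z"
      using f by (auto simp: z' extensional_def)
    fix g assume "g \<in> dirs (cpoly c) (cob (beval p X) z)"
    then have g [simp]: "g \<in> dirs (cpoly c) (lob p I)" by (simp add: z')
    note fg = copmap_comp[OF copmap_lback[OF I g] f(2)]
    show "cact (beval p X) z g \<in> cel (beval p X)"
      using copmap_cong[OF fg copsh_fib] by (auto simp: z')
    show "cob (beval p X) (cact (beval p X) z g) = ccod c (cob (beval p X) z) g" by (simp add: z')
    fix h assume "h \<in> dirs (cpoly c) (ccod c (cob (beval p X) z) g)"
    then have h [simp]: "h \<in> dirs (cpoly c) (ccod c (lob p I) g)" by (simp add: z')
    have "lback p (lact p I g) h i \<in> pd (lact p I g)" if "i \<in> pd (lact p I (ccmp c (lob p I) g h))" for i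
      using that lback[of "lact p I g" h i] by (simp add: lact_lact)
    then show "cact (beval p X) (cact (beval p X) z g) h = cact (beval p X) z (ccmp c (cob (beval p X) z) g h)"
      by (auto simp: z' lact_lact lback_lback intro!: restrict_ext)
  qed
qed

lemma pgen_beval: "I \<in> pp \<Longrightarrow> pgen (carrier p) I \<in> cel (beval p (fib p I))"
  by (auto simp: pgen_def copmap_def)

lemma papp_beval:
  assumes X: "copsh d X" and h: "copmap d X Y h"
  shows "copmap c (beval p X) (beval p Y) (papp (carrier p) h)"
proof (rule copmapI)
  fix z assume z: "z \<in> cel (beval p X)"
  obtain I f where z': "z = (I, f)" by (cases z)
  have I [simp]: "I \<in> pp" and f: "f \<in> extensional (pd I)" "copmap d (fib p I) X f"
    using z by (auto simp: z')
  show "papp (carrier p) h z \<in> cel (beval p Y)"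
    using copmap_cong[OF copmap_comp[OF f(2) h] copsh_fib[OF I]] by (auto simp: z' papp_def)
  show "cob (beval p Y) (papp (carrier p) h z) = cob (beval p X) z" by (simp add: z' papp_def)
  fix g assume "g \<in> dirs (cpoly c) (cob (beval p X) z)"
  then have g [simp]: "g \<in> dirs (cpoly c) (lob p I)" by (simp add: z')
  show "papp (carrier p) h (cact (beval p X) z g) = cact (beval p Y) (papp (carrier p) h z) g"
    by (auto simp: z' papp_def intro!: restrict_ext)
qed

text \<open>Functors preserve isomorphisms; the point to check is that the inverse function is again
  a map of copresheaves. The bijectivity provided here is what later allows equations to be tested
  after unnesting inside a bicomodule.\<close>

lemma papp_copiso:
  assumes X: "copsh d X" and Y: "copsh d Y" and h: "copiso d X Y h"
  shows "copiso c (beval p X) (beval p Y) (papp (carrier p) h)"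
proof -
  define k where "k = inv_into (cel X) h"
  have kh: "k (h x) = x" if "x \<in> cel X" for x
    using copisoD(2)[OF h] that by (simp add: k_def)
  have hk: "h (k y) = y" "k y \<in> cel X" if "y \<in> cel Y" for y
    using copisoD(3)[OF h] that unfolding k_def by (auto intro: f_inv_into_f inv_into_into)
  note hD = copmapD[OF copisoD(1)[OF h]]
  have k: "copmap d Y X k"
  proof (rule copmapI)
    fix y assume y: "y \<in> cel Y"
    show "k y \<in> cel X" using hk y by simp
    show cb: "cob X (k y) = cob Y y" using hD(2)[OF hk(2)[OF y]] hk(1)[OF y] by simp
    fix g assume g: "g \<in> dirs (cpoly d) (cob Y y)"
    have "k (cact Y y g) = k (h (cact X (k y) g))"
      using hD(3)[OF hk(2)[OF y], of g] hk(1)[OF y] g cb by simp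
    also have "\<dots> = cact X (k y) g" using copshD(3)[OF X hk(2)[OF y]] g cb by (intro kh) simp
    finally show "k (cact Y y g) = cact X (k y) g" .
  qed
  have "bij_betw (papp (carrier p) h) (cel (beval p X)) (cel (beval p Y))"
  proof (rule bij_betw_byWitness[where f'="papp (carrier p) k"])
    show "\<forall>z\<in>cel (beval p X). papp (carrier p) k (papp (carrier p) h z) = z"
      unfolding papp_papp by (intro ballI, rule trans[OF papp_cong_beval papp_id[OF beval_pelts]]) (auto simp: kh)
    show "\<forall>z\<in>cel (beval p Y). papp (carrier p) h (papp (carrier p) k z) = z"
      unfolding papp_papp by (intro ballI, rule trans[OF papp_cong_beval papp_id[OF beval_pelts]]) (auto simp: hk)
  qed (use copmapD(1)[OF papp_beval[OF X copisoD(1)[OF h]]] copmapD(1)[OF papp_beval[OF Y k]] in auto)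
  then show ?thesis using papp_beval[OF X copisoD(1)[OF h]] by (simp add: copiso_def)
qed

end

section \<open>Bicomodule morphisms\<close>

lemma bicellsD:
  assumes "\<phi> \<in> bicells p q"
  shows "bdom \<phi> = p" "bcod \<phi> = q" "bmap \<phi> \<in> phom (carrier p) (carrier q)"
  using assms by (auto simp: bicells_def)

locale bicomod_pair = P: bicomod c d p + Q: bicomod c d q
  for c :: "('c, 'f) comonoid" and d :: "('d, 'g) comonoid"
    and p :: "('i, 'a, 'c, 'f, 'd, 'g) bicom" and q :: "('j, 'b, 'c, 'f, 'd, 'g) bicom"
begin

lemma lcell_iff:
  assumes \<phi>: "\<phi> \<in> phom (carrier p) (carrier q)"
  shows "lcoact q \<circ>\<^sub>p \<phi> = (pid (cpoly c) \<lhd>\<^sub>m \<phi>) \<circ>\<^sub>p lcoact p \<longleftrightarrow>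
    (\<forall>I\<in>P.pp. lob q (onpos \<phi> I) = lob p I \<and> (\<forall>f\<in>dirs (cpoly c) (lob p I).
      lact q (onpos \<phi> I) f = onpos \<phi> (lact p I f) \<and> (\<forall>j\<in>Q.pd (onpos \<phi> (lact p I f)).
        ondir \<phi> I (lback q (onpos \<phi> I) f j) = lback p I f (ondir \<phi> (lact p I f) j))))" (is "?f = ?g \<longleftrightarrow> _")
proof -
  note t = ptrim_phom[OF pid_phom[of "cpoly c"] \<phi>]
  have f: "?f \<in> phom (carrier p) (cpoly c \<lhd> carrier q)" by (rule pcomp_phom[OF \<phi> Q.lcoact])
  have g: "?g \<in> phom (carrier p) (cpoly c \<lhd> carrier q)" by (rule pcomp_phom[OF P.lcoact t])
  { fix I assume I: "I \<in> P.pp"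
    note r = pgen_pelts[OF I]
    note fI = phom_pos[OF \<phi> I]
    have rc: "(onpos \<phi> I, ondir \<phi> I) \<in> pelts (carrier q)"
      using fI phom_dir_ext[OF \<phi> I] by (auto simp: pelts_def)
    have 1: "nest (cpoly c) (carrier q) (peval ?f (pgen (carrier p) I)) = (lob q (onpos \<phi> I),
      \<lambda>f\<in>dirs (cpoly c) (lob q (onpos \<phi> I)). (lact q (onpos \<phi> I) f,
        \<lambda>j\<in>Q.pd (lact q (onpos \<phi> I) f). ondir \<phi> I (lback q (onpos \<phi> I) f j)))"
      unfolding peval_pcomp[OF \<phi> Q.lcoact r] peval_pgen[OF \<phi> I] nest_peval[OF Q.lcoact rc] nest_pgen[OF Q.lcoact fI]
      by (auto simp: papp_def lob_def lact_def lback_def intro!: restrict_ext)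
    have "nest (cpoly c) (carrier q) (peval ?g (pgen (carrier p) I)) =
        papp (cpoly c) (peval \<phi>) (nest (cpoly c) (carrier p) (peval (lcoact p) (pgen (carrier p) I)))"
      unfolding peval_pcomp[OF P.lcoact t r] nest_ptrim_pid_left[OF \<phi> peval_pelts[OF P.lcoact r]] ..
    also have "\<dots> = (lob p I, \<lambda>f\<in>dirs (cpoly c) (lob p I). (onpos \<phi> (lact p I f),
        \<lambda>j\<in>Q.pd (onpos \<phi> (lact p I f)). lback p I f (ondir \<phi> (lact p I f) j)))"
      unfolding nest_pgen[OF P.lcoact I] using I phom_dir[OF \<phi>]
      by (auto simp: papp_def peval_def lob_def[symmetric] lact_def[symmetric] lback_def[symmetric] phomD[OF \<phi>] intro!: restrict_ext)
    finally have 2: "nest (cpoly c) (carrier q) (peval ?g (pgen (carrier p) I)) = \<dots>" .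
    have "peval ?f (pgen (carrier p) I) = peval ?g (pgen (carrier p) I) \<longleftrightarrow>
      nest (cpoly c) (carrier q) (peval ?f (pgen (carrier p) I)) = nest (cpoly c) (carrier q) (peval ?g (pgen (carrier p) I))"
      using nest_inj[OF peval_pelts[OF f r] peval_pelts[OF g r]] by auto
    also have "\<dots> \<longleftrightarrow> lob q (onpos \<phi> I) = lob p I \<and> (\<forall>f\<in>dirs (cpoly c) (lob p I).
      lact q (onpos \<phi> I) f = onpos \<phi> (lact p I f) \<and> (\<forall>j\<in>Q.pd (onpos \<phi> (lact p I f)).
        ondir \<phi> I (lback q (onpos \<phi> I) f j) = lback p I f (ondir \<phi> (lact p I f) j)))"
      unfolding 1 2 by (simp only: pair_restrict_eq_iff) auto
    finally have "peval ?f (pgen (carrier p) I) = peval ?g (pgen (carrier p) I) \<longleftrightarrow> \<dots>" . }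
  then show ?thesis unfolding phom_eq_iff_pgen[OF f g] by auto
qed

lemma rcell_iff:
  assumes \<phi>: "\<phi> \<in> phom (carrier p) (carrier q)"
  shows "rcoact q \<circ>\<^sub>p \<phi> = (\<phi> \<lhd>\<^sub>m pid (cpoly d)) \<circ>\<^sub>p rcoact p \<longleftrightarrow>
    (\<forall>I\<in>P.pp. copmap d (fib q (onpos \<phi> I)) (fib p I) (ondir \<phi> I))" (is "?f = ?g \<longleftrightarrow> _")
proof -
  note t = ptrim_phom[OF \<phi> pid_phom[of "cpoly d"]]
  have f: "?f \<in> phom (carrier p) (carrier q \<lhd> cpoly d)" by (rule pcomp_phom[OF \<phi> Q.rcoact])
  have g: "?g \<in> phom (carrier p) (carrier q \<lhd> cpoly d)" by (rule pcomp_phom[OF P.rcoact t])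
  { fix I assume I: "I \<in> P.pp"
    note r = pgen_pelts[OF I]
    note fI = phom_pos[OF \<phi> I]
    have rc: "(onpos \<phi> I, ondir \<phi> I) \<in> pelts (carrier q)"
      using fI phom_dir_ext[OF \<phi> I] by (auto simp: pelts_def)
    have 1: "nest (carrier q) (cpoly d) (peval ?f (pgen (carrier p) I)) = (onpos \<phi> I,
      \<lambda>j\<in>Q.pd (onpos \<phi> I). (rob q (onpos \<phi> I) j,
        \<lambda>g\<in>dirs (cpoly d) (rob q (onpos \<phi> I) j). ondir \<phi> I (ract q (onpos \<phi> I) j g)))"
      unfolding peval_pcomp[OF \<phi> Q.rcoact r] peval_pgen[OF \<phi> I] nest_peval[OF Q.rcoact rc] nest_pgen[OF Q.rcoact fI]
      using fI by (auto simp: Q.onpos_rcoact papp_def ract_def intro!: restrict_ext)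
    have "nest (carrier q) (cpoly d) (peval ?g (pgen (carrier p) I)) =
        peval \<phi> (nest (carrier p) (cpoly d) (peval (rcoact p) (pgen (carrier p) I)))"
      unfolding peval_pcomp[OF P.rcoact t r] nest_ptrim_pid_right[OF \<phi> peval_pelts[OF P.rcoact r]] ..
    also have "\<dots> = (onpos \<phi> I, \<lambda>j\<in>Q.pd (onpos \<phi> I). (rob p I (ondir \<phi> I j),
        \<lambda>g\<in>dirs (cpoly d) (rob p I (ondir \<phi> I j)). ract p I (ondir \<phi> I j) g))"
      unfolding nest_pgen[OF P.rcoact I] using I phom_dir[OF \<phi> I]
      by (auto simp: P.onpos_rcoact peval_def phomD[OF \<phi>] ract_def[symmetric] intro!: restrict_ext)
    finally have 2: "nest (carrier q) (cpoly d) (peval ?g (pgen (carrier p) I)) = \<dots>" .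
    have "peval ?f (pgen (carrier p) I) = peval ?g (pgen (carrier p) I) \<longleftrightarrow>
      nest (carrier q) (cpoly d) (peval ?f (pgen (carrier p) I)) = nest (carrier q) (cpoly d) (peval ?g (pgen (carrier p) I))"
      using nest_inj[OF peval_pelts[OF f r] peval_pelts[OF g r]] by auto
    also have "\<dots> \<longleftrightarrow> copmap d (fib q (onpos \<phi> I)) (fib p I) (ondir \<phi> I)"
      unfolding 1 2 copmap_def using phom_dir[OF \<phi> I] by (simp only: pair_restrict_eq_iff) auto
    finally have "peval ?f (pgen (carrier p) I) = peval ?g (pgen (carrier p) I) \<longleftrightarrow> \<dots>" . }
  then show ?thesis unfolding phom_eq_iff_pgen[OF f g] by auto
qed

lemma bicell_iff:
  "\<phi> \<in> bicells p q \<longleftrightarrow> bdom \<phi> = p \<and> bcod \<phi> = q \<and> bmap \<phi> \<in> phom (carrier p) (carrier q) \<and>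
    (\<forall>I\<in>P.pp. lob q (onpos (bmap \<phi>) I) = lob p I \<and> (\<forall>f\<in>dirs (cpoly c) (lob p I).
      lact q (onpos (bmap \<phi>) I) f = onpos (bmap \<phi>) (lact p I f) \<and> (\<forall>j\<in>Q.pd (onpos (bmap \<phi>) (lact p I f)).
        ondir (bmap \<phi>) I (lback q (onpos (bmap \<phi>) I) f j) = lback p I f (ondir (bmap \<phi>) (lact p I f) j)))) \<and>
    (\<forall>I\<in>P.pp. copmap d (fib q (onpos (bmap \<phi>) I)) (fib p I) (ondir (bmap \<phi>) I))"
  unfolding bicells_def using lcell_iff[of "bmap \<phi>"] rcell_iff[of "bmap \<phi>"] by auto

lemma bicell_copmap:
  assumes \<phi>: "\<phi> \<in> bicells p q" and X: "copsh d X"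
  shows "copmap c (beval p X) (beval q X) (peval (bmap \<phi>))"
proof (rule copmapI)
  let ?m = "bmap \<phi>"
  have m: "?m \<in> phom (carrier p) (carrier q)" by (rule bicellsD[OF \<phi>])
  note b = \<phi>[unfolded bicell_iff]
  fix z assume z: "z \<in> cel (beval p X)"
  obtain I f where z': "z = (I, f)" by (cases z)
  have I [simp]: "I \<in> P.pp" and f: "f \<in> extensional (P.pd I)" "copmap d (fib p I) X f"
    using z by (auto simp: z')
  have mI [simp]: "onpos ?m I \<in> Q.pp" by (rule phom_pos[OF m I])
  have cm: "copmap d (fib q (onpos ?m I)) (fib p I) (ondir ?m I)" using b by auto
  have peval: "peval ?m z = (onpos ?m I, \<lambda>j\<in>Q.pd (onpos ?m I). f (ondir ?m I j))"
    by (simp add: z' peval_def phomD[OF m])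
  show "peval ?m z \<in> cel (beval q X)"
    using copmap_cong[OF copmap_comp[OF cm f(2)] Q.copsh_fib[OF mI]] by (auto simp: peval)
  show "cob (beval q X) (peval ?m z) = cob (beval p X) z" unfolding peval using b by (simp add: z')
  fix g assume "g \<in> dirs (cpoly c) (cob (beval p X) z)"
  then have g [simp]: "g \<in> dirs (cpoly c) (lob p I)" by (simp add: z')
  have lg: "lob q (onpos ?m I) = lob p I" and la: "lact q (onpos ?m I) g = onpos ?m (lact p I g)"
    and lb: "\<And>j. j \<in> Q.pd (onpos ?m (lact p I g)) \<Longrightarrow>
      ondir ?m I (lback q (onpos ?m I) g j) = lback p I g (ondir ?m (lact p I g) j)"
    using b by auto
  have "lback q (onpos ?m I) g j \<in> Q.pd (onpos ?m I)" if "j \<in> Q.pd (onpos ?m (lact p I g))" for j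
    using that Q.lback[OF mI, of g j] by (simp add: lg la)
  then show "peval ?m (cact (beval p X) z g) = cact (beval q X) (peval ?m z) g"
    using phom_dir[OF m, of "lact p I g"]
    by (simp add: z' peval_def phomD[OF m] la) (auto simp: lb intro!: restrict_ext)
qed

text \<open>Converse of \<open>bicell_copmap\<close>, by Yoneda. At the universal element,
  membership of the image says that \<open>ondir\<close> is a map of copresheaves, which is right
  compatibility; preservation of the object and the action gives left compatibility.\<close>

lemma bicellI:
  assumes m: "bmap \<phi> \<in> phom (carrier p) (carrier q)" and "bdom \<phi> = p" "bcod \<phi> = q"
    and cm: "\<And>I. I \<in> P.pp \<Longrightarrow> copmap c (beval p (fib p I)) (beval q (fib p I)) (peval (bmap \<phi>))"
  shows "\<phi> \<in> bicells p q"
proof -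
  let ?m = "bmap \<phi>"
  { fix I assume I [simp]: "I \<in> P.pp"
    have mI [simp]: "onpos ?m I \<in> Q.pp" by (rule phom_pos[OF m I])
    note g = P.pgen_beval[OF I]
    note c = copmapD[OF cm[OF I] g, unfolded peval_pgen[OF m I]]
    have 1: "lob q (onpos ?m I) = lob p I" using c(2) by (simp add: pgen_def)
    have 2: "copmap d (fib q (onpos ?m I)) (fib p I) (ondir ?m I)" using c(1) by simp
    have "lact q (onpos ?m I) f = onpos ?m (lact p I f) \<and> (\<forall>j\<in>Q.pd (onpos ?m (lact p I f)).
        ondir ?m I (lback q (onpos ?m I) f j) = lback p I f (ondir ?m (lact p I f) j))"
      if f [simp]: "f \<in> dirs (cpoly c) (lob p I)" for f
    proof -
      have "peval ?m (lact p I f, \<lambda>i\<in>P.pd (lact p I f). lback p I f i) =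
        (lact q (onpos ?m I) f, \<lambda>j\<in>Q.pd (lact q (onpos ?m I) f). ondir ?m I (lback q (onpos ?m I) f j))"
        using c(3)[of f] by (simp add: pgen_def cong: restrict_cong)
      then have *: "(onpos ?m (lact p I f), \<lambda>j\<in>Q.pd (onpos ?m (lact p I f)). (\<lambda>i\<in>P.pd (lact p I f). lback p I f i) (ondir ?m (lact p I f) j)) =
        (lact q (onpos ?m I) f, \<lambda>j\<in>Q.pd (lact q (onpos ?m I) f). ondir ?m I (lback q (onpos ?m I) f j))"
        by (simp only: peval_def prod.case phomD(2)[OF m])
      show ?thesis
        using iffD1[OF pair_restrict_eq_iff *] phom_dir[OF m, of "lact p I f"] by auto
    qed
    note 1 2 this }
  then show ?thesis using assms unfolding bicell_iff by auto
qed

text \<open>The universal elements decide, and they lie in \<open>beval p (fib p I)\<close>. With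
  \<open>z\<close> ranging over that evaluation, applications can argue by naturality for a generic
  element.\<close>

lemma bicell_eqI:
  assumes \<phi>: "\<phi> \<in> bicells p q" and \<psi>: "\<psi> \<in> bicells p q"
    and eq: "\<And>I z. I \<in> P.pp \<Longrightarrow> z \<in> cel (beval p (fib p I)) \<Longrightarrow> peval (bmap \<phi>) z = peval (bmap \<psi>) z"
  shows "\<phi> = \<psi>"
proof -
  have "bmap \<phi> = bmap \<psi>"
    by (rule phom_eqI_pgen[OF bicellsD(3)[OF \<phi>] bicellsD(3)[OF \<psi>]]) (auto intro: eq P.pgen_beval)
  then show ?thesis
    using bicellsD[OF \<phi>] bicellsD[OF \<psi>] by (intro bicell.equality) auto
qed

text \<open>
  All structural cells are factorizations through a monomorphism \<open>e\<close>.  They are recognized as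
  bicomodule morphisms by comparing with a natural map \<open>B\<close> into a copresheaf that \<open>A\<close>
  identifies with the evaluation of the target.
\<close>

lemma pfactor_cell:
  assumes e: "e \<in> phom (carrier q) R" "pmono e" and h: "h \<in> phom (carrier p) R"
    and B: "\<And>I. I \<in> P.pp \<Longrightarrow> copmap c (beval p (fib p I)) (Z I) B"
    and A: "\<And>I. I \<in> P.pp \<Longrightarrow> copiso c (beval q (fib p I)) (Z I) A"
    and AB: "\<And>I z w. I \<in> P.pp \<Longrightarrow> z \<in> cel (beval q (fib p I)) \<Longrightarrow> w \<in> cel (beval p (fib p I)) \<Longrightarrow> A z = B w \<Longrightarrow> peval e z = peval h w"
  shows "pfactor e h \<in> phom (carrier p) (carrier q)" "e \<circ>\<^sub>p pfactor e h = h"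
    "\<lparr>bdom = p, bcod = q, bmap = pfactor e h\<rparr> \<in> bicells p q"
proof -
  have ex: "\<exists>z\<in>cel (beval q (fib p I)). A z = B w \<and> peval e z = peval h w"
    if I: "I \<in> P.pp" and w: "w \<in> cel (beval p (fib p I))" for I w
  proof -
    have "B w \<in> A ` cel (beval q (fib p I))" using copmapD(1)[OF B[OF I] w] copisoD(3)[OF A[OF I]] by simp
    then obtain z where "z \<in> cel (beval q (fib p I))" "A z = B w" by auto
    then show ?thesis using AB[OF I _ w] by blast
  qed
  define t where "t I = (SOME z. z \<in> cel (beval q (fib p I)) \<and> peval e z = peval h (pgen (carrier p) I))" for I
  have t: "t I \<in> cel (beval q (fib p I)) \<and> peval e (t I) = peval h (pgen (carrier p) I)" if "I \<in> P.pp" for I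
    unfolding t_def by (rule someI_ex) (use ex[OF that P.pgen_beval[OF that]] in blast)
  note pf = pfactor_peval[OF e h, of t]
  have pf1: "pfactor e h \<in> phom (carrier p) (carrier q)" and pf2: "e \<circ>\<^sub>p pfactor e h = h"
    using pf t beval_pelts by blast+
  then show "pfactor e h \<in> phom (carrier p) (carrier q)" "e \<circ>\<^sub>p pfactor e h = h" by auto
  have peval: "peval (pfactor e h) w \<in> cel (beval q (fib p I)) \<and> A (peval (pfactor e h) w) = B w"
    if I: "I \<in> P.pp" and w: "w \<in> cel (beval p (fib p I))" for I w
  proof -
    obtain z where z: "z \<in> cel (beval q (fib p I))" "A z = B w" "peval e z = peval h w" using ex[OF I w] by blast
    have "peval e (peval (pfactor e h) w) = peval h w"
      using peval_pcomp[OF pf1 e(1) beval_pelts[OF w]] pf2 by simp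
    then have "peval (pfactor e h) w = z"
      using z(3) pmono_peval_inj[OF e peval_pelts[OF pf1 beval_pelts[OF w]] beval_pelts[OF z(1)]] by simp
    then show ?thesis using z by simp
  qed
  show "\<lparr>bdom = p, bcod = q, bmap = pfactor e h\<rparr> \<in> bicells p q"
  proof (rule bicellI)
    fix I assume I: "I \<in> P.pp"
    note A' = copmapD[OF copisoD(1)[OF A[OF I]]] and B' = copmapD[OF B[OF I]]
    have "copmap c (beval p (fib p I)) (beval q (fib p I)) (peval (pfactor e h))"
    proof (rule copmapI)
      fix w assume w: "w \<in> cel (beval p (fib p I))"
      show m: "peval (pfactor e h) w \<in> cel (beval q (fib p I))" using peval[OF I w] by auto
      show cob: "cob (beval q (fib p I)) (peval (pfactor e h) w) = cob (beval p (fib p I)) w"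
        using A'(2)[OF m] B'(2)[OF w] peval[OF I w] by simp
      fix g assume g: "g \<in> dirs (cpoly c) (cob (beval p (fib p I)) w)"
      note wg = copshD(3)[OF P.copsh_beval[OF P.copsh_fib[OF I]] w g]
      note mg = copshD(3)[OF Q.copsh_beval[OF P.copsh_fib[OF I]] m, of g, unfolded cob, OF g]
      \<comment> \<open>Equivariance is tested after \<open>A\<close>, where it is that of
        \<open>B\<close>, and pulled back along the injectivity of \<open>A\<close>.\<close>
      have "A (peval (pfactor e h) (cact (beval p (fib p I)) w g)) = A (cact (beval q (fib p I)) (peval (pfactor e h) w) g)"
        using peval[OF I wg] peval[OF I w] A'(3)[OF m, of g] B'(3)[OF w g] g cob by simp
      then show "peval (pfactor e h) (cact (beval p (fib p I)) w g) = cact (beval q (fib p I)) (peval (pfactor e h) w) g"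
        using peval[OF I wg] mg inj_onD[OF copisoD(2)[OF A[OF I]]] by blast
    qed
    then show "copmap c (beval p (fib p I)) (beval q (fib p I)) (peval (bmap \<lparr>bdom = p, bcod = q, bmap = pfactor e h\<rparr>))"
      by simp
  qed (use pf1 in auto)
qed

end

lemma cid_bicell:
  assumes "bicomodule c d p" shows "cid p \<in> bicells p p"
proof -
  interpret bicomod_pair c d p p by unfold_locales (rule assms)+
  have 1: "pid (cpoly c) \<lhd>\<^sub>m pid (carrier p) = pid (cpoly c \<lhd> carrier p)"
    and 2: "pid (carrier p) \<lhd>\<^sub>m pid (cpoly d) = pid (carrier p \<lhd> cpoly d)"
    by (rule phom_eqI_pgen[OF ptrim_phom[OF pid_phom pid_phom] pid_phom],
        rule nest_inj[OF peval_pelts[OF ptrim_phom[OF pid_phom pid_phom]] peval_pelts[OF pid_phom]],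
        simp_all add: nest_ptrim_pid_right[OF pid_phom] peval_pid nest_pelts)+
  show ?thesis
    by (auto simp: bicells_def cid_def 1 2 pid_left[OF P.lcoact] pid_right[OF P.lcoact]
      pid_left[OF P.rcoact] pid_right[OF P.rcoact])
qed

lemma vcomp_bicell:
  assumes "bicomodule c d p" "bicomodule c d q" "bicomodule c d r"
    and \<phi>: "\<phi> \<in> bicells p q" and \<psi>: "\<psi> \<in> bicells q r"
  shows "\<psi> \<circ>\<^sub>b \<phi> \<in> bicells p r"
    "z \<in> pelts (carrier p) \<Longrightarrow> peval (bmap (\<psi> \<circ>\<^sub>b \<phi>)) z = peval (bmap \<psi>) (peval (bmap \<phi>) z)"
proof -
  interpret PQ: bicomod_pair c d p q by unfold_locales (rule assms)+
  interpret QR: bicomod_pair c d q r by unfold_locales (rule assms)+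
  interpret PR: bicomod_pair c d p r by unfold_locales (rule assms)+
  have m: "bmap (\<psi> \<circ>\<^sub>b \<phi>) = bmap \<psi> \<circ>\<^sub>p bmap \<phi>" by (simp add: vcomp_def)
  note peval = peval_pcomp[OF bicellsD(3)[OF \<phi>] bicellsD(3)[OF \<psi>]]
  show "z \<in> pelts (carrier p) \<Longrightarrow> peval (bmap (\<psi> \<circ>\<^sub>b \<phi>)) z = peval (bmap \<psi>) (peval (bmap \<phi>) z)"
    unfolding m by (rule peval)
  show "\<psi> \<circ>\<^sub>b \<phi> \<in> bicells p r"
  proof (rule PR.bicellI)
    show "bmap (\<psi> \<circ>\<^sub>b \<phi>) \<in> phom (carrier p) (carrier r)"
      unfolding m by (rule pcomp_phom[OF bicellsD(3)[OF \<phi>] bicellsD(3)[OF \<psi>]])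
    show "bdom (\<psi> \<circ>\<^sub>b \<phi>) = p" "bcod (\<psi> \<circ>\<^sub>b \<phi>) = r" using bicellsD[OF \<phi>] bicellsD[OF \<psi>] by (auto simp: vcomp_def)
    fix I assume I: "I \<in> pos (carrier p)"
    note X = PQ.P.copsh_fib[OF I]
    show "copmap c (beval p (fib p I)) (beval r (fib p I)) (peval (bmap (\<psi> \<circ>\<^sub>b \<phi>)))"
      by (rule copmap_cong[OF copmap_comp[OF PQ.bicell_copmap[OF \<phi> X] QR.bicell_copmap[OF \<psi> X]] PQ.P.copsh_beval[OF X]])
        (simp add: m peval beval_pelts)
  qed
qed

section \<open>Evaluation of composites and structural cells\<close>

text \<open>
  \<open>bnest p q\<close> is the isomorphism \<open>(p \<odot> q)\<langle>X\<rangle> \<rightarrow> p\<langle>q\<langle>X\<rangle>\<rangle>\<close>, and \<open>orbit c Y\<close> the isomorphism \<open>Y \<rightarrow> c\<langle>Y\<rangle>\<close> for the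
  identity bicomodule.
\<close>

definition bnest :: "('i, 'a, 'c, 'f, 'd, 'g) bicom \<Rightarrow> ('j, 'b, 'd, 'g, 'e, 'h) bicom \<Rightarrow>
    ('i \<times> ('a \<Rightarrow> 'j)) \<times> (('a \<times> 'b) set \<Rightarrow> 'x) \<Rightarrow> 'i \<times> ('a \<Rightarrow> 'j \<times> ('b \<Rightarrow> 'x))" where
  "bnest p q z = nest (carrier p) (carrier q) (peval (bincl p q) z)"

definition orbit :: "('o, 'm) comonoid \<Rightarrow> ('x, 'o, 'm) cps \<Rightarrow> 'x \<Rightarrow> 'o \<times> ('m \<Rightarrow> 'x)" where
  "orbit c Y y = (cob Y y, \<lambda>g\<in>dirs (cpoly c) (cob Y y). cact Y y g)"

context bicomod2
begin

lemma bicomod_bcomp: "bicomod c e (p \<odot> q)"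
  by unfold_locales (rule bicomodule_bcomp)

lemma bnest_eq:
  assumes z: "(I, J) \<in> pos (carrier (p \<odot> q))"
  shows "bnest p q ((I, J), f) = (I, \<lambda>i\<in>P.pd I. (J i, \<lambda>j\<in>Q.pd (J i). f (cls p q (I, J) (i, j))))"
  by (auto simp: bnest_def peval_def nest_def bincl_pos[OF z] phomD[OF bincl] cls_def intro!: restrict_ext)

lemma bnest_inj:
  assumes "z \<in> pelts (carrier (p \<odot> q))" "w \<in> pelts (carrier (p \<odot> q))" "bnest p q z = bnest p q w"
  shows "z = w"
  using nest_inj[OF peval_pelts[OF bincl assms(1)] peval_pelts[OF bincl assms(2)] assms(3)[unfolded bnest_def]]
  by (rule pmono_peval_inj[OF bincl bincl_mono assms(1,2)])

lemma bnest_pelts: "z \<in> pelts (carrier (p \<odot> q)) \<Longrightarrow> bnest p q z \<in> pelts (carrier p)"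
  unfolding bnest_def by (rule nest_pelts[OF peval_pelts[OF bincl]])

lemma bnest_papp:
  "z \<in> pelts (carrier (p \<odot> q)) \<Longrightarrow> bnest p q (papp (carrier (p \<odot> q)) h z) = papp (carrier p) (papp (carrier q) h) (bnest p q z)"
  unfolding bnest_def by (simp add: peval_papp[OF bincl] nest_papp[OF peval_pelts[OF bincl]])

text \<open>A copresheaf map out of the quotient \<open>(p \<odot> q)[(I, J)]\<close> is a balanced
  family of maps \<open>q[J i] \<rightarrow> X\<close>, and being balanced is exactly equivariance
  of the resulting map \<open>p[I] \<rightarrow> q\<langle>X\<rangle>\<close>.\<close>

lemma bnest_copiso:
  assumes X: "copsh e X"
  shows "copiso c (beval (p \<odot> q) X) (beval p (beval q X)) (bnest p q)"
proof -
  interpret R: bicomod c e "p \<odot> q" by (rule bicomod_bcomp)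
  have 1: "copmap c (beval (p \<odot> q) X) (beval p (beval q X)) (bnest p q)"
  proof (rule copmapI)
    fix z assume z: "z \<in> cel (beval (p \<odot> q) X)"
    then obtain w f where zw: "z = (w, f)" "w \<in> pos (carrier (p \<odot> q))" by (cases z) auto
    obtain I J where w: "w = (I, J)" and I [simp]: "I \<in> P.pp" and J: "J \<in> P.pd I \<rightarrow>\<^sub>E Q.pp"
      "\<And>i. i \<in> P.pd I \<Longrightarrow> J i \<in> Q.pp" "\<And>i. i \<in> P.pd I \<Longrightarrow> lob q (J i) = rob p I i"
      "\<And>i g. i \<in> P.pd I \<Longrightarrow> g \<in> dirs (cpoly d) (rob p I i) \<Longrightarrow> J (ract p I i g) = lact q (J i) g"
      using zw(2) by (elim pos_bcompE) (rule that)
    have IJ: "(I, J) \<in> pos (carrier (p \<odot> q))" using zw w by simp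
    have f: "copmap e (fib (p \<odot> q) (I, J)) X f" using z by (simp add: zw w)
    note f' = copmapD[OF f, unfolded fib_simps, OF cls_mem[OF IJ]]
    have Ji: "(J i, \<lambda>j\<in>Q.pd (J i). f (cls p q (I, J) (i, j))) \<in> cel (beval q X)" if i: "i \<in> P.pd I" for i
      using i J by (auto simp: copmap_def f' rob_bcomp[OF IJ] ract_bcomp[OF IJ, symmetric])
    show "bnest p q z \<in> cel (beval p (beval q X))"
      unfolding zw w bnest_eq[OF IJ] beval_simps
    proof (intro conjI I restrict_extensional copmapI)
      fix i assume "i \<in> cel (fib p I)"
      then have i: "i \<in> P.pd I" by simp
      show "(\<lambda>i\<in>P.pd I. (J i, \<lambda>j\<in>Q.pd (J i). f (cls p q (I, J) (i, j)))) i \<in> cel (beval q X)"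
        using i Ji by simp
      show "cob (beval q X) ((\<lambda>i\<in>P.pd I. (J i, \<lambda>j\<in>Q.pd (J i). f (cls p q (I, J) (i, j)))) i) = cob (fib p I) i"
        using i J by simp
      fix g assume "g \<in> dirs (cpoly (rbase p)) (cob (fib p I) i)"
      then have g: "g \<in> dirs (cpoly d) (rob p I i)" by simp
      show "(\<lambda>i\<in>P.pd I. (J i, \<lambda>j\<in>Q.pd (J i). f (cls p q (I, J) (i, j)))) (cact (fib p I) i g) =
        cact (beval q X) ((\<lambda>i\<in>P.pd I. (J i, \<lambda>j\<in>Q.pd (J i). f (cls p q (I, J) (i, j)))) i) g"
        using i g J by (auto simp: cls_gen[OF IJ] intro!: restrict_ext)
    qed
    show "cob (beval p (beval q X)) (bnest p q z) = cob (beval (p \<odot> q) X) z"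
      by (simp add: zw w bnest_eq[OF IJ] lob_bcomp[OF IJ])
    fix g assume "g \<in> dirs (cpoly c) (cob (beval (p \<odot> q) X) z)"
    then have g [simp]: "g \<in> dirs (cpoly c) (lob p I)" by (simp add: zw w lob_bcomp[OF IJ])
    note gz = lpos_mem[OF IJ g]
    show "bnest p q (cact (beval (p \<odot> q) X) z g) = cact (beval p (beval q X)) (bnest p q z) g"
      unfolding zw w beval_simps lact_bcomp[OF IJ g] bnest_eq[OF gz] bnest_eq[OF IJ]
      using cls_mem[OF gz] by (auto simp: lback_bcomp[OF IJ g] intro!: restrict_ext)
  qed
  moreover have "inj_on (bnest p q) (cel (beval (p \<odot> q) X))"
    by (intro inj_onI bnest_inj) (auto intro: beval_pelts)
  moreover have "\<exists>z\<in>cel (beval (p \<odot> q) X). bnest p q z = y" if y: "y \<in> cel (beval p (beval q X))" for y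
  proof -
    obtain I F where y': "y = (I, F)" by (cases y)
    have I [simp]: "I \<in> P.pp" and Fe: "F \<in> extensional (P.pd I)" and F: "copmap d (fib p I) (beval q X) F"
      using y by (auto simp: y')
    note F' = copmapD[OF F, unfolded fib_simps]
    define J where "J = (\<lambda>i\<in>P.pd I. fst (F i))"
    define k where "k = (\<lambda>i. snd (F i))"
    have FJ: "F i = (J i, k i)" if "i \<in> P.pd I" for i using that by (simp add: J_def k_def)
    have k: "J i \<in> Q.pp \<and> k i \<in> extensional (Q.pd (J i)) \<and> copmap e (fib q (J i)) X (k i) \<and> lob q (J i) = rob p I i"
      if i: "i \<in> P.pd I" for i
      using F'(1,2)[OF i] i by (simp add: FJ)
    have mact: "J (ract p I i g) = lact q (J i) g \<and>
      k (ract p I i g) = (\<lambda>j\<in>Q.pd (lact q (J i) g). k i (lback q (J i) g j))"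
      if i: "i \<in> P.pd I" and g: "g \<in> dirs (cpoly d) (rob p I i)" for i g
      using F'(3)[OF i g] i g by (simp add: FJ)
    have Je: "J \<in> extensional (P.pd I)" by (simp add: J_def)
    have IJ: "(I, J) \<in> pos (carrier (p \<odot> q))"
      using k mact Je unfolding pos_bcomp_iff by (auto simp: PiE_iff)
    \<comment> \<open>Surjectivity: \<open>F\<close> splits into positions \<open>J\<close> and
      function parts \<open>k\<close>. The second half of \<open>mact\<close> says that
      \<open>k\<close> is balanced, so the parts glue to a map on classes.\<close>
    obtain G where G: "\<And>i j. i \<in> P.pd I \<Longrightarrow> j \<in> Q.pd (J i) \<Longrightarrow> G (cls p q (I, J) (i, j)) = k i j"
      by (rule cls_lift[OF IJ, of k]) (use mact in auto)
    let ?f = "restrict G (dirs (carrier (p \<odot> q)) (I, J))"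
    have f: "?f (cls p q (I, J) (i, j)) = k i j" if "i \<in> P.pd I" "j \<in> Q.pd (J i)" for i j
      using cls_mem[OF IJ that] G[OF that] by simp
    have "copmap e (fib (p \<odot> q) (I, J)) X ?f"
    proof (rule copmapI)
      fix s assume "s \<in> cel (fib (p \<odot> q) (I, J))"
      then obtain i j where ij: "i \<in> P.pd I" "j \<in> Q.pd (J i)" and s: "s = cls p q (I, J) (i, j)"
        using dirs_bcompE[OF IJ] by (metis fib_simps(1))
      have kk: "copmap e (fib q (J i)) X (k i)" using k ij by auto
      note kk' = copmapD[OF kk, unfolded fib_simps, OF ij(2)]
      show "?f s \<in> cel X" "cob X (?f s) = cob (fib (p \<odot> q) (I, J)) s"
        unfolding s f[OF ij] using kk' by (auto simp: rob_bcomp[OF IJ ij])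
      fix g assume "g \<in> dirs (cpoly e) (cob (fib (p \<odot> q) (I, J)) s)"
      then have g: "g \<in> dirs (cpoly e) (rob q (J i) j)" by (simp add: s rob_bcomp[OF IJ ij])
      have "ract q (J i) j g \<in> Q.pd (J i)" using g ij k by auto
      then show "?f (cact (fib (p \<odot> q) (I, J)) s g) = cact X (?f s) g"
        unfolding s f[OF ij] fib_simps ract_bcomp[OF IJ ij g] using kk'(3)[OF g] f[OF ij(1)] by simp
    qed
    then have 1: "((I, J), ?f) \<in> cel (beval (p \<odot> q) X)" using IJ by simp
    have 2: "bnest p q ((I, J), ?f) = y"
    proof -
      have "(\<lambda>i\<in>P.pd I. (J i, \<lambda>j\<in>Q.pd (J i). ?f (cls p q (I, J) (i, j)))) = F"
      proof (rule extensionalityI[OF restrict_extensional Fe])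
        fix i assume i: "i \<in> P.pd I"
        have "(\<lambda>j\<in>Q.pd (J i). ?f (cls p q (I, J) (i, j))) = k i"
          by (rule extensionalityI[OF restrict_extensional]) (use k i f in auto)
        then show "(\<lambda>i\<in>P.pd I. (J i, \<lambda>j\<in>Q.pd (J i). ?f (cls p q (I, J) (i, j)))) i = F i"
          using i by (simp add: FJ)
      qed
      then show ?thesis unfolding bnest_eq[OF IJ] y' by simp
    qed
    show ?thesis using 1 2 by (rule bexI[rotated])
  qed
  then have "bnest p q ` cel (beval (p \<odot> q) X) = cel (beval p (beval q X))"
    using copmapD(1)[OF 1] by blast
  ultimately show ?thesis by (simp add: copiso_def bij_betw_def)
qed

end

text \<open>\<open>pfactor_cell\<close> applies with \<open>bnest\<close> on the target side and, on
  the source side, horizontal composition of natural transformations: \<open>\<psi>\<close> inside,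
  then \<open>\<phi>\<close> outside.\<close>

lemma hcomp_bicell:
  fixes p :: "('i, 'a, 'c, 'f, 'd, 'g) bicom" and p' :: "('i2, 'a2, 'c, 'f, 'd, 'g) bicom"
    and q :: "('j, 'b, 'd, 'g, 'e, 'h) bicom" and q' :: "('j2, 'b2, 'd, 'g, 'e, 'h) bicom"
  assumes "bicomodule c d p" "bicomodule c d p'" "bicomodule d e q" "bicomodule d e q'"
    and \<phi>: "\<phi> \<in> bicells p p'" and \<psi>: "\<psi> \<in> bicells q q'"
  shows "\<phi> \<odot>\<^sub>b \<psi> \<in> bicells (p \<odot> q) (p' \<odot> q')"
    "z \<in> pelts (carrier (p \<odot> q)) \<Longrightarrow>
      bnest p' q' (peval (bmap (\<phi> \<odot>\<^sub>b \<psi>)) z) = peval (bmap \<phi>) (papp (carrier p) (peval (bmap \<psi>)) (bnest p q z))"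
proof -
  interpret A: bicomod2 c d e p q by unfold_locales (rule assms)+
  interpret B: bicomod2 c d e p' q' by unfold_locales (rule assms)+
  interpret PP: bicomod_pair c d p p' by unfold_locales (rule assms)+
  interpret QQ: bicomod_pair d e q q' by unfold_locales (rule assms)+
  interpret R: bicomod_pair c e "p \<odot> q" "p' \<odot> q'"
    using A.bicomod_bcomp B.bicomod_bcomp by (simp add: bicomod_pair_def)
  note f = bicellsD(3)[OF \<phi>] and g = bicellsD(3)[OF \<psi>]
  let ?h = "(bmap \<phi> \<lhd>\<^sub>m bmap \<psi>) \<circ>\<^sub>p bincl p q"
  note fg = ptrim_phom[OF f g]
  have h: "?h \<in> phom (carrier (p \<odot> q)) (carrier p' \<lhd> carrier q')" by (rule pcomp_phom[OF A.bincl fg])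
  have nh: "nest (carrier p') (carrier q') (peval ?h w) = peval (bmap \<phi>) (papp (carrier p) (peval (bmap \<psi>)) (bnest p q w))"
    if w: "w \<in> pelts (carrier (p \<odot> q))" for w :: "('i \<times> ('a \<Rightarrow> 'j)) \<times> (('a \<times> 'b) set \<Rightarrow> 'z)"
    unfolding peval_pcomp[OF A.bincl fg w] nest_ptrim[OF f g peval_pelts[OF A.bincl w]] bnest_def ..
  have cell: "\<phi> \<odot>\<^sub>b \<psi> = \<lparr>bdom = p \<odot> q, bcod = p' \<odot> q', bmap = pfactor (bincl p' q') ?h\<rparr>"
    using bicellsD[OF \<phi>] bicellsD[OF \<psi>] by (simp add: hcomp_def)
  let ?B = "\<lambda>w. peval (bmap \<phi>) (papp (carrier p) (peval (bmap \<psi>)) (bnest p q w))"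
  have B: "copmap c (beval (p \<odot> q) (fib (p \<odot> q) I)) (beval p' (beval q' (fib (p \<odot> q) I))) ?B"
    if I: "I \<in> pos (carrier (p \<odot> q))" for I
    by (intro copmap_comp[OF copmap_comp[OF copisoD(1)[OF A.bnest_copiso] A.P.papp_beval[OF _ QQ.bicell_copmap[OF \<psi>]]]
          PP.bicell_copmap[OF \<phi>]] A.Q.copsh_beval B.Q.copsh_beval R.P.copsh_fib I)
  have A: "copiso c (beval (p' \<odot> q') (fib (p \<odot> q) I)) (beval p' (beval q' (fib (p \<odot> q) I))) (bnest p' q')"
    if I: "I \<in> pos (carrier (p \<odot> q))" for I
    by (intro B.bnest_copiso R.P.copsh_fib I)
  have AB: "peval (bincl p' q') z = peval ?h w"
    if "z \<in> cel (beval (p' \<odot> q') (fib (p \<odot> q) I))" "w \<in> cel (beval (p \<odot> q) (fib (p \<odot> q) I))"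
      "bnest p' q' z = ?B w" for I z w
    using that(3) unfolding nh[OF beval_pelts[OF that(2)], symmetric] unfolding bnest_def
    by (rule nest_inj[OF peval_pelts[OF B.bincl beval_pelts[OF that(1)]] peval_pelts[OF h beval_pelts[OF that(2)]]])
  note pf = R.pfactor_cell[OF B.bincl B.bincl_mono h B A AB, folded cell]
  show "\<phi> \<odot>\<^sub>b \<psi> \<in> bicells (p \<odot> q) (p' \<odot> q')" by (rule pf(3)) auto
  have 1: "pfactor (bincl p' q') ?h \<in> phom (carrier (p \<odot> q)) (carrier (p' \<odot> q'))" by (rule pf(1)) auto
  have 2: "bincl p' q' \<circ>\<^sub>p pfactor (bincl p' q') ?h = ?h" by (rule pf(2)) auto
  show "bnest p' q' (peval (bmap (\<phi> \<odot>\<^sub>b \<psi>)) z) = ?B z" if z: "z \<in> pelts (carrier (p \<odot> q))"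
    unfolding nh[OF z, symmetric] cell unfolding bnest_def using peval_pcomp[OF 1 B.bincl z] unfolding 2 by simp
qed

section \<open>Orbit maps and unit isomorphisms\<close>

context catcom
begin

text \<open>Yoneda for the category \<open>c\<close>: a copresheaf map out of the morphisms with
  source \<open>C\<close> is determined by its value at the identity, of which it is the
  orbit.\<close>

lemma orbit_copiso:
  assumes Y: "copsh c Y" shows "copiso c Y (beval (bid c) Y) (orbit c Y)"
proof -
  note Y' = copshD[OF Y]
  have 1: "copmap c Y (beval (bid c) Y) (orbit c Y)"
    by (auto simp: copmap_def orbit_def bid_ops Y' B.base intro!: restrict_ext)
  moreover have "inj_on (orbit c Y) (cel Y)"
  proof (rule inj_onI)
    fix x y assume x: "x \<in> cel Y" and y: "y \<in> cel Y" and eq: "orbit c Y x = orbit c Y y"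
    then have *: "cob Y x = cob Y y" by (simp add: orbit_def)
    have "snd (orbit c Y x) (cidm c (cob Y x)) = snd (orbit c Y y) (cidm c (cob Y y))" using eq * by simp
    then show "x = y" using Y'[OF x] Y'[OF y] by (simp add: orbit_def)
  qed
  moreover have "\<exists>y\<in>cel Y. orbit c Y y = z" if z: "z \<in> cel (beval (bid c) Y)" for z
  proof -
    obtain C F where z': "z = (C, F)" by (cases z)
    have C [simp]: "C \<in> pos (cpoly c)" and Fe: "F \<in> extensional (dirs (cpoly c) C)"
      and F: "copmap c (fib (bid c) C) Y F"
      using z by (auto simp: z' bid_ops B.base)
    note F' = copmapD[OF F, unfolded fib_simps bid_ops]
    have id: "cidm c C \<in> dirs (cpoly c) C" by simp
    have "(\<lambda>g\<in>dirs (cpoly c) C. cact Y (F (cidm c C)) g) = F"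
      by (rule extensionalityI[OF restrict_extensional Fe]) (simp add: F'(3)[OF id, symmetric])
    then have "orbit c Y (F (cidm c C)) = z" using F'(2)[OF id] by (simp add: orbit_def z')
    then show ?thesis using F'(1)[OF id] by blast
  qed
  then have "orbit c Y ` cel Y = cel (beval (bid c) Y)"
    using copmapD(1)[OF 1] by blast
  ultimately show ?thesis by (simp add: copiso_def bij_betw_def)
qed

end

context bicomod
begin

sublocale C: catcom c by unfold_locales (rule comon)
sublocale D: catcom d by unfold_locales (rule comon)

lemma nest_lcoact:
  assumes z: "z \<in> cel (beval p X)"
  shows "nest (cpoly c) (carrier p) (peval (lcoact p) z) = orbit c (beval p X) z"
proof -
  obtain I f where z': "z = (I, f)" by (cases z)
  have I: "I \<in> pp" using z by (auto simp: z')
  show ?thesis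
    unfolding z' nest_peval[OF lcoact beval_pelts[OF z, unfolded z']] nest_pgen[OF lcoact I]
    using I by (auto simp: papp_def orbit_def lob_def[symmetric] lact_def[symmetric] lback_def[symmetric] intro!: restrict_ext)
qed

lemma nest_rcoact:
  assumes z: "z \<in> cel (beval p X)"
  shows "nest (carrier p) (cpoly d) (peval (rcoact p) z) = papp (carrier p) (orbit d X) z"
proof -
  obtain I f where z': "z = (I, f)" by (cases z)
  have I: "I \<in> pp" and f: "copmap d (fib p I) X f" using z by (auto simp: z')
  note f' = copmapD[OF f, unfolded fib_simps]
  show ?thesis
    unfolding z' nest_peval[OF rcoact beval_pelts[OF z, unfolded z']] nest_pgen[OF rcoact I]
    using I f' by (auto simp: papp_def orbit_def onpos_rcoact ract_def[symmetric] intro!: restrict_ext)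
qed

text \<open>The cell factors \<open>lcoact p\<close>. Unnested, the left coaction is the orbit map
  of \<open>p\<langle>X\<rangle>\<close>, hence a map of copresheaves, as
  \<open>pfactor_cell\<close> requires.\<close>

lemma lunitor_inv_bicell:
  shows "lunitor_inv p \<in> bicells p (bid c \<odot> p)"
    "z \<in> cel (beval p X) \<Longrightarrow> bnest (bid c) p (peval (bmap (lunitor_inv p)) z) = orbit c (beval p X) z"
proof -
  interpret A: bicomod2 c c d "bid c" p by unfold_locales
  interpret R: bicomod_pair c d p "bid c \<odot> p"
    using A.bicomod_bcomp bicomod_axioms by (simp add: bicomod_pair_def)
  have b: "carrier (bid c) = cpoly c" by (simp add: bid_def)
  let ?B = "\<lambda>w. nest (cpoly c) (carrier p) (peval (lcoact p) w)"
  have B: "copmap c (beval p (fib p I)) (beval (bid c) (beval p (fib p I))) ?B" if I: "I \<in> pp" for I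
    by (rule copmap_cong[OF copisoD(1)[OF C.orbit_copiso]])
      (auto intro!: copsh_beval copsh_fib I nest_lcoact[symmetric])
  have A: "copiso c (beval (bid c \<odot> p) (fib p I)) (beval (bid c) (beval p (fib p I))) (bnest (bid c) p)" if I: "I \<in> pp" for I
    by (intro A.bnest_copiso copsh_fib I)
  have AB: "peval (bincl (bid c) p) z = peval (lcoact p) w"
    if "z \<in> cel (beval (bid c \<odot> p) (fib p I))" "w \<in> cel (beval p (fib p I))"
      "bnest (bid c) p z = ?B w" for I z w
    using that(3) unfolding bnest_def b
    by (rule nest_inj[OF peval_pelts[OF A.bincl[unfolded b] beval_pelts[OF that(1)]] peval_pelts[OF lcoact beval_pelts[OF that(2)]]])
  note pf = R.pfactor_cell[OF A.bincl[unfolded b] A.bincl_mono lcoact B A AB]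
  show "lunitor_inv p \<in> bicells p (bid c \<odot> p)" unfolding lunitor_inv_def base by (rule pf(3)) auto
  have 1: "pfactor (bincl (bid c) p) (lcoact p) \<in> phom (carrier p) (carrier (bid c \<odot> p))" by (rule pf(1)) auto
  have 2: "bincl (bid c) p \<circ>\<^sub>p pfactor (bincl (bid c) p) (lcoact p) = lcoact p" by (rule pf(2)) auto
  show "bnest (bid c) p (peval (bmap (lunitor_inv p)) z) = orbit c (beval p X) z" if z: "z \<in> cel (beval p X)"
    unfolding nest_lcoact[OF z, symmetric] bnest_def
    using peval_pcomp[OF 1 A.bincl beval_pelts[OF z]] unfolding 2 by (simp add: lunitor_inv_def b)
qed

lemma runitor_inv_bicell:
  shows "runitor_inv p \<in> bicells p (p \<odot> bid d)"
    "z \<in> cel (beval p X) \<Longrightarrow> bnest p (bid d) (peval (bmap (runitor_inv p)) z) = papp (carrier p) (orbit d X) z"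
proof -
  interpret A: bicomod2 c d d p "bid d" by unfold_locales
  interpret R: bicomod_pair c d p "p \<odot> bid d"
    using A.bicomod_bcomp bicomod_axioms by (simp add: bicomod_pair_def)
  have b: "carrier (bid d) = cpoly d" by (simp add: bid_def)
  let ?B = "\<lambda>w. nest (carrier p) (cpoly d) (peval (rcoact p) w)"
  have B: "copmap c (beval p (fib p I)) (beval p (beval (bid d) (fib p I))) ?B" if I: "I \<in> pp" for I
    by (rule copmap_cong[OF papp_beval[OF _ copisoD(1)[OF D.orbit_copiso]]])
      (auto intro!: copsh_beval copsh_fib I nest_rcoact[symmetric])
  have A: "copiso c (beval (p \<odot> bid d) (fib p I)) (beval p (beval (bid d) (fib p I))) (bnest p (bid d))" if I: "I \<in> pp" for I
    by (intro A.bnest_copiso copsh_fib I)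
  have AB: "peval (bincl p (bid d)) z = peval (rcoact p) w"
    if "z \<in> cel (beval (p \<odot> bid d) (fib p I))" "w \<in> cel (beval p (fib p I))"
      "bnest p (bid d) z = ?B w" for I z w
    using that(3) unfolding bnest_def b
    by (rule nest_inj[OF peval_pelts[OF A.bincl[unfolded b] beval_pelts[OF that(1)]] peval_pelts[OF rcoact beval_pelts[OF that(2)]]])
  note pf = R.pfactor_cell[OF A.bincl[unfolded b] A.bincl_mono rcoact B A AB]
  show "runitor_inv p \<in> bicells p (p \<odot> bid d)" unfolding runitor_inv_def base by (rule pf(3)) auto
  have 1: "pfactor (bincl p (bid d)) (rcoact p) \<in> phom (carrier p) (carrier (p \<odot> bid d))" by (rule pf(1)) auto
  have 2: "bincl p (bid d) \<circ>\<^sub>p pfactor (bincl p (bid d)) (rcoact p) = rcoact p" by (rule pf(2)) auto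
  show "bnest p (bid d) (peval (bmap (runitor_inv p)) z) = papp (carrier p) (orbit d X) z" if z: "z \<in> cel (beval p X)"
    unfolding nest_rcoact[OF z, symmetric] bnest_def
    using peval_pcomp[OF 1 A.bincl beval_pelts[OF z]] unfolding 2 by (simp add: runitor_inv_def b)
qed

end

section \<open>Threefold composites and associators\<close>

locale bicomod3 = P: bicomod c d p + Q: bicomod d e q + R: bicomod e f r
  for c :: "('c, 'cm) comonoid" and d :: "('d, 'dm) comonoid" and e :: "('e, 'em) comonoid" and f :: "('f, 'fm) comonoid"
    and p :: "('i, 'a, 'c, 'cm, 'd, 'dm) bicom" and q :: "('j, 'b, 'd, 'dm, 'e, 'em) bicom"
    and r :: "('k, 'u, 'e, 'em, 'f, 'fm) bicom"
begin

sublocale PQ: bicomod2 c d e p q by unfold_locales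
sublocale QR: bicomod2 d e f q r by unfold_locales
sublocale PQ_: bicomod c e "p \<odot> q" by (rule PQ.bicomod_bcomp)
sublocale QR_: bicomod d f "q \<odot> r" by (rule QR.bicomod_bcomp)
sublocale PQ_R: bicomod2 c e f "p \<odot> q" r by unfold_locales
sublocale P_QR: bicomod2 c d f p "q \<odot> r" by unfold_locales
sublocale PQ_R_: bicomod c f "(p \<odot> q) \<odot> r" by (rule PQ_R.bicomod_bcomp)
sublocale P_QR_: bicomod c f "p \<odot> (q \<odot> r)" by (rule P_QR.bicomod_bcomp)

text \<open>The embeddings of the two bracketings into the plain threefold composition products; the
  associators are factorizations through them.\<close>

abbreviation "el \<equiv> (bincl p q \<lhd>\<^sub>m pid (carrier r)) \<circ>\<^sub>p bincl (p \<odot> q) r"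
abbreviation "er \<equiv> (pid (carrier p) \<lhd>\<^sub>m bincl q r) \<circ>\<^sub>p bincl p (q \<odot> r)"

lemma el: "el \<in> phom (carrier ((p \<odot> q) \<odot> r)) ((carrier p \<lhd> carrier q) \<lhd> carrier r)" "pmono el"
  by (rule pcomp_phom[OF PQ_R.bincl ptrim_phom[OF PQ.bincl pid_phom]],
      rule pmono_pcomp[OF PQ_R.bincl ptrim_phom[OF PQ.bincl pid_phom] PQ_R.bincl_mono
        pmono_ptrim[OF PQ.bincl PQ.bincl_mono pid_phom pmono_pid]])

lemma er: "er \<in> phom (carrier (p \<odot> (q \<odot> r))) (carrier p \<lhd> (carrier q \<lhd> carrier r))" "pmono er"
  by (rule pcomp_phom[OF P_QR.bincl ptrim_phom[OF pid_phom QR.bincl]],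
      rule pmono_pcomp[OF P_QR.bincl ptrim_phom[OF pid_phom QR.bincl] P_QR.bincl_mono
        pmono_ptrim[OF pid_phom pmono_pid QR.bincl QR.bincl_mono]])

lemma nest_el:
  assumes z: "z \<in> pelts (carrier ((p \<odot> q) \<odot> r))"
  shows "nest (carrier p) (carrier q) (nest (carrier p \<lhd> carrier q) (carrier r) (peval el z)) = bnest p q (bnest (p \<odot> q) r z)"
  unfolding peval_pcomp[OF PQ_R.bincl ptrim_phom[OF PQ.bincl pid_phom] z]
    nest_ptrim_pid_right[OF PQ.bincl peval_pelts[OF PQ_R.bincl z]] bnest_def ..

lemma nest_er:
  assumes z: "z \<in> pelts (carrier (p \<odot> (q \<odot> r)))"
  shows "papp (carrier p) (nest (carrier q) (carrier r)) (nest (carrier p) (carrier q \<lhd> carrier r) (peval er z))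
    = papp (carrier p) (bnest q r) (bnest p (q \<odot> r) z)"
  unfolding peval_pcomp[OF P_QR.bincl ptrim_phom[OF pid_phom QR.bincl] z]
    nest_ptrim_pid_left[OF QR.bincl peval_pelts[OF P_QR.bincl z]] papp_papp bnest_def ..

lemma copiso_l:
  assumes X: "copsh f X"
  shows "copiso c (beval ((p \<odot> q) \<odot> r) X) (beval p (beval q (beval r X))) (\<lambda>z. bnest p q (bnest (p \<odot> q) r z))"
  by (rule copiso_comp[OF PQ_R.bnest_copiso[OF X] PQ.bnest_copiso[OF R.copsh_beval[OF X]]])

lemma copiso_r:
  assumes X: "copsh f X"
  shows "copiso c (beval (p \<odot> (q \<odot> r)) X) (beval p (beval q (beval r X))) (\<lambda>z. papp (carrier p) (bnest q r) (bnest p (q \<odot> r) z))"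
  by (rule copiso_comp[OF P_QR.bnest_copiso[OF X]
        P.papp_copiso[OF QR_.copsh_beval[OF X] Q.copsh_beval[OF R.copsh_beval[OF X]] QR.bnest_copiso[OF X]]])

text \<open>Both bracketings are identified with
  \<open>p\<langle>q\<langle>r\<langle>X\<rangle>\<rangle>\<rangle>\<close> by
  \<open>copiso_l\<close> and \<open>copiso_r\<close>; these play the roles of \<open>B\<close> and
  \<open>A\<close> in \<open>pfactor_cell\<close>.\<close>

lemma assoc_bicell:
  shows "assoc p q r \<in> bicells ((p \<odot> q) \<odot> r) (p \<odot> (q \<odot> r))"
    "z \<in> pelts (carrier ((p \<odot> q) \<odot> r)) \<Longrightarrow>
      papp (carrier p) (bnest q r) (bnest p (q \<odot> r) (peval (bmap (assoc p q r)) z)) = bnest p q (bnest (p \<odot> q) r z)"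
proof -
  interpret T: bicomod_pair c f "(p \<odot> q) \<odot> r" "p \<odot> (q \<odot> r)" by unfold_locales
  let ?h = "passoc (carrier p) (carrier q) (carrier r) \<circ>\<^sub>p el"
  have assoc: "assoc p q r = \<lparr>bdom = (p \<odot> q) \<odot> r, bcod = p \<odot> (q \<odot> r), bmap = pfactor er ?h\<rparr>"
    unfolding assoc_def
    by (simp add: pcomp_assoc[OF PQ_R.bincl ptrim_phom[OF PQ.bincl pid_phom] passoc_phom])
  have h: "?h \<in> phom (carrier ((p \<odot> q) \<odot> r)) (carrier p \<lhd> (carrier q \<lhd> carrier r))"
    by (rule pcomp_phom[OF el(1) passoc_phom])
  have nh: "papp (carrier p) (nest (carrier q) (carrier r)) (nest (carrier p) (carrier q \<lhd> carrier r) (peval ?h z))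
      = bnest p q (bnest (p \<odot> q) r z)"
    if z: "z \<in> pelts (carrier ((p \<odot> q) \<odot> r))"
    for z :: "(('i \<times> ('a \<Rightarrow> 'j)) \<times> (('a \<times> 'b) set \<Rightarrow> 'k)) \<times> ((('a \<times> 'b) set \<times> 'u) set \<Rightarrow> 'z)"
    unfolding peval_pcomp[OF el(1) passoc_phom z] nest_passoc[OF peval_pelts[OF el(1) z]] nest_el[OF z] ..
  note X = PQ_R_.copsh_fib
  have AB: "peval er z = peval ?h w"
    if "z \<in> cel (beval (p \<odot> (q \<odot> r)) (fib ((p \<odot> q) \<odot> r) I))" "w \<in> cel (beval ((p \<odot> q) \<odot> r) (fib ((p \<odot> q) \<odot> r) I))"
      "papp (carrier p) (bnest q r) (bnest p (q \<odot> r) z) = bnest p q (bnest (p \<odot> q) r w)" for I z w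
    using that(3) unfolding nh[OF beval_pelts[OF that(2)], symmetric] nest_er[OF beval_pelts[OF that(1)], symmetric]
    by (rule nest_nest_inj[OF peval_pelts[OF er(1) beval_pelts[OF that(1)]] peval_pelts[OF h beval_pelts[OF that(2)]]])
  note pf = T.pfactor_cell[OF er h copisoD(1)[OF copiso_l[OF X]] copiso_r[OF X] AB, folded assoc]
  show "assoc p q r \<in> bicells ((p \<odot> q) \<odot> r) (p \<odot> (q \<odot> r))" by (rule pf(3)) auto
  have 1: "pfactor er ?h \<in> phom (carrier ((p \<odot> q) \<odot> r)) (carrier (p \<odot> (q \<odot> r)))" by (rule pf(1)) auto
  have 2: "er \<circ>\<^sub>p pfactor er ?h = ?h" by (rule pf(2)) auto
  show "papp (carrier p) (bnest q r) (bnest p (q \<odot> r) (peval (bmap (assoc p q r)) z)) = bnest p q (bnest (p \<odot> q) r z)"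
    if z: "z \<in> pelts (carrier ((p \<odot> q) \<odot> r))"
    unfolding nh[OF z, symmetric] assoc bicell.simps nest_er[OF peval_pelts[OF 1 z], symmetric]
      peval_pcomp[OF 1 er(1) z, symmetric] 2 ..
qed

lemma assoc_inv_bicell:
  shows "assoc_inv p q r \<in> bicells (p \<odot> (q \<odot> r)) ((p \<odot> q) \<odot> r)"
    "z \<in> pelts (carrier (p \<odot> (q \<odot> r))) \<Longrightarrow>
      bnest p q (bnest (p \<odot> q) r (peval (bmap (assoc_inv p q r)) z)) = papp (carrier p) (bnest q r) (bnest p (q \<odot> r) z)"
proof -
  interpret T: bicomod_pair c f "p \<odot> (q \<odot> r)" "(p \<odot> q) \<odot> r" by unfold_locales
  let ?h = "passoc_inv (carrier p) (carrier q) (carrier r) \<circ>\<^sub>p er"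
  have assoc: "assoc_inv p q r = \<lparr>bdom = p \<odot> (q \<odot> r), bcod = (p \<odot> q) \<odot> r, bmap = pfactor el ?h\<rparr>"
    unfolding assoc_inv_def
    by (simp add: pcomp_assoc[OF P_QR.bincl ptrim_phom[OF pid_phom QR.bincl] passoc_inv_phom])
  have h: "?h \<in> phom (carrier (p \<odot> (q \<odot> r))) ((carrier p \<lhd> carrier q) \<lhd> carrier r)"
    by (rule pcomp_phom[OF er(1) passoc_inv_phom])
  have nh: "nest (carrier p) (carrier q) (nest (carrier p \<lhd> carrier q) (carrier r) (peval ?h z))
      = papp (carrier p) (bnest q r) (bnest p (q \<odot> r) z)"
    if z: "z \<in> pelts (carrier (p \<odot> (q \<odot> r)))"
    for z :: "('i \<times> ('a \<Rightarrow> 'j \<times> ('b \<Rightarrow> 'k))) \<times> (('a \<times> ('b \<times> 'u) set) set \<Rightarrow> 'z)"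
    unfolding peval_pcomp[OF er(1) passoc_inv_phom z] nest_passoc_inv[OF peval_pelts[OF er(1) z]] nest_er[OF z] ..
  note X = P_QR_.copsh_fib
  have AB: "peval el z = peval ?h w"
    if "z \<in> cel (beval ((p \<odot> q) \<odot> r) (fib (p \<odot> (q \<odot> r)) I))" "w \<in> cel (beval (p \<odot> (q \<odot> r)) (fib (p \<odot> (q \<odot> r)) I))"
      "bnest p q (bnest (p \<odot> q) r z) = papp (carrier p) (bnest q r) (bnest p (q \<odot> r) w)" for I z w
  proof (rule nest_inj[OF peval_pelts[OF el(1) beval_pelts[OF that(1)]] peval_pelts[OF h beval_pelts[OF that(2)]]])
    show "nest (carrier p \<lhd> carrier q) (carrier r) (peval el z) = nest (carrier p \<lhd> carrier q) (carrier r) (peval ?h w)"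
      using that(3) unfolding nh[OF beval_pelts[OF that(2)], symmetric] nest_el[OF beval_pelts[OF that(1)], symmetric]
      by (rule nest_inj[OF nest_pelts[OF peval_pelts[OF el(1) beval_pelts[OF that(1)]]] nest_pelts[OF peval_pelts[OF h beval_pelts[OF that(2)]]]])
  qed
  note pf = T.pfactor_cell[OF el h copisoD(1)[OF copiso_r[OF X]] copiso_l[OF X] AB, folded assoc]
  show "assoc_inv p q r \<in> bicells (p \<odot> (q \<odot> r)) ((p \<odot> q) \<odot> r)" by (rule pf(3)) auto
  have 1: "pfactor el ?h \<in> phom (carrier (p \<odot> (q \<odot> r))) (carrier ((p \<odot> q) \<odot> r))" by (rule pf(1)) auto
  have 2: "el \<circ>\<^sub>p pfactor el ?h = ?h" by (rule pf(2)) auto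
  show "bnest p q (bnest (p \<odot> q) r (peval (bmap (assoc_inv p q r)) z)) = papp (carrier p) (bnest q r) (bnest p (q \<odot> r) z)"
    if z: "z \<in> pelts (carrier (p \<odot> (q \<odot> r)))"
    unfolding nh[OF z, symmetric] assoc bicell.simps nest_el[OF peval_pelts[OF 1 z], symmetric]
      peval_pcomp[OF 1 el(1) z, symmetric] 2 ..
qed

end

section \<open>The right coclosure\<close>

lemma phom_empty_eq: "f \<in> phom P Q \<Longrightarrow> g \<in> phom P Q \<Longrightarrow> pos P = {} \<Longrightarrow> f = g"
  by (rule phom_eqI[of f P Q g]) auto

lemma zero_simps: "cpoly zero_comonoid = \<lparr>pos = {}, dirs = (\<lambda>_. {})\<rparr>"
  by (simp add: zero_comonoid_def Let_def)

lemma comonoid_zero: "comonoid zero_comonoid"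
proof -
  let ?z = "cpoly zero_comonoid"
  have p: "pos ?z = {}" by (simp add: zero_simps)
  have c: "counit zero_comonoid \<in> phom ?z yon" and d: "comult zero_comonoid \<in> phom ?z (?z \<lhd> ?z)"
    unfolding zero_simps by (auto simp: zero_comonoid_def Let_def intro!: mk_pmap_phom)
  show ?thesis
    unfolding comonoid_def
    by (intro conjI c d
        phom_empty_eq[OF pcomp_phom[OF d pcomp_phom[OF ptrim_phom[OF c pid_phom] plunit_phom]] pid_phom p]
        phom_empty_eq[OF pcomp_phom[OF d pcomp_phom[OF ptrim_phom[OF pid_phom c] prunit_phom]] pid_phom p]
        phom_empty_eq[OF pcomp_phom[OF d pcomp_phom[OF ptrim_phom[OF d pid_phom] passoc_phom]]
          pcomp_phom[OF d ptrim_phom[OF pid_phom d]] p])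
qed

text \<open>A fibre has no directions, so laws about directions are vacuous; what remains of the
  left laws are the copresheaf laws of \<open>p[I]\<close>.\<close>

lemma (in bicomod)
  assumes I: "I \<in> pp"
  shows bicomod_fiber: "bicomod d zero_comonoid (fiber p I)"
    and pos_fiber: "pos (carrier (fiber p I)) = pd I"
    and lob_fiber: "i \<in> pd I \<Longrightarrow> lob (fiber p I) i = rob p I i"
    and lact_fiber: "i \<in> pd I \<Longrightarrow> g \<in> dirs (cpoly d) (rob p I i) \<Longrightarrow> lact (fiber p I) i g = ract p I i g"
proof -
  let ?S = "\<lparr>pos = pd I, dirs = (\<lambda>_. {})\<rparr> :: ('a, unit) poly" and ?F = "fiber p I"
  let ?z = "cpoly zero_comonoid"
  have S: "carrier ?F = ?S" and b: "lbase ?F = d" "rbase ?F = zero_comonoid"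
    by (simp_all add: fiber_def Let_def)
  have l: "lcoact ?F = mk_pmap ?S (cpoly d \<lhd> ?S) (\<lambda>i. (rob p I i, \<lambda>g\<in>dirs (cpoly d) (rob p I i). ract p I i g)) (\<lambda>_. snd)"
    by (simp add: fiber_def Let_def rob_def ract_def)
  have r: "rcoact ?F = mk_pmap ?S (?S \<lhd> ?z) (\<lambda>i. (i, \<lambda>_. undefined)) (\<lambda>_. fst)"
    by (simp add: fiber_def Let_def)
  show pos: "pos (carrier ?F) = pd I" by (simp add: S)
  have dirs: "dirs (carrier ?F) i = {}" for i by (simp add: S)
  show lob: "lob ?F i = rob p I i" if "i \<in> pd I" for i
    using that by (simp add: l lob_def)
  show lact: "lact ?F i g = ract p I i g" if "i \<in> pd I" "g \<in> dirs (cpoly d) (rob p I i)" for i g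
    using that by (simp add: l lact_def)
  have lp: "lcoact ?F \<in> phom (carrier ?F) (cpoly d \<lhd> carrier ?F)"
    unfolding l S by (rule mk_pmap_phom) (use I in \<open>auto simp: ptri_pos\<close>)
  have rp: "rcoact ?F \<in> phom (carrier ?F) (carrier ?F \<lhd> ?z)"
    unfolding r S by (rule mk_pmap_phom) (auto simp: ptri_pos zero_simps)
  have r1: "fst (onpos (rcoact ?F) i) = i" if "i \<in> pd I" for i using that by (simp add: r)
  show "bicomod d zero_comonoid ?F"
    unfolding bicomod_def bicomodule_iff
    using comon(2) comonoid_zero b lp rp r1 I
    by (auto simp: pos dirs lob lact ract_ract)
qed

section \<open>The coclosure as a bicomodule, its unit and its universal property\<close>

locale coclosure_pair = Q: bicomod d e q + P: bicomod c e p
  for c :: "('c, 'f) comonoid" and d :: "('d, 'g) comonoid" and e :: "('e, 'h) comonoid"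
    and q :: "('j, 'b, 'd, 'g, 'e, 'h) bicom" and p :: "('i, 'a, 'c, 'f, 'e, 'h) bicom"
begin

abbreviation "L \<equiv> coclosure q p"

text \<open>A position of \<open>q \<odot> fiber p I\<close> is a position \<open>K\<close> of
  \<open>q\<close> with a copresheaf map \<open>q[K] \<rightarrow> p[I]\<close>, which is the same
  data as an element of \<open>q\<langle>p[I]\<rangle>\<close>. This removes the empty category from
  the description of \<open>L[I]\<close>.\<close>

lemma pos_qfib: "I \<in> P.pp \<Longrightarrow> pos (carrier (q \<odot> fiber p I)) = cel (beval q (fib p I))"
  and lob_qfib: "I \<in> P.pp \<Longrightarrow> s \<in> cel (beval q (fib p I)) \<Longrightarrow> lob (q \<odot> fiber p I) s = cob (beval q (fib p I)) s"
  and lact_qfib: "I \<in> P.pp \<Longrightarrow> s \<in> cel (beval q (fib p I)) \<Longrightarrow> g \<in> dirs (cpoly d) (cob (beval q (fib p I)) s) \<Longrightarrow>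
    lact (q \<odot> fiber p I) s g = cact (beval q (fib p I)) s g"
proof -
  assume I: "I \<in> P.pp"
  interpret F: bicomod e zero_comonoid "fiber p I" by (rule P.bicomod_fiber[OF I])
  interpret A: bicomod2 d e zero_comonoid q "fiber p I" by unfold_locales
  have mem: "(K, h) \<in> pos (carrier (q \<odot> fiber p I)) \<longleftrightarrow> (K, h) \<in> cel (beval q (fib p I))" for K h
    unfolding A.pos_bcomp_iff beval_simps copmap_def P.pos_fiber[OF I]
    by (auto simp: PiE_iff P.lob_fiber[OF I] P.lact_fiber[OF I])
  then show pos: "pos (carrier (q \<odot> fiber p I)) = cel (beval q (fib p I))" by auto
  assume s: "s \<in> cel (beval q (fib p I))"
  obtain K h where s': "s = (K, h)" by (cases s)
  have m: "(K, h) \<in> pos (carrier (q \<odot> fiber p I))" using s mem by (simp add: s')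
  show "lob (q \<odot> fiber p I) s = cob (beval q (fib p I)) s" by (simp add: s' A.lob_bcomp[OF m])
  assume g: "g \<in> dirs (cpoly d) (cob (beval q (fib p I)) s)"
  then show "lact (q \<odot> fiber p I) s g = cact (beval q (fib p I)) s g"
    by (simp add: s' A.lact_bcomp[OF m])
qed

lemma pos_L [simp]: "pos (carrier L) = P.pp"
  and dirs_L: "I \<in> P.pp \<Longrightarrow> dirs (carrier L) I = cel (beval q (fib p I))"
  and base_L [simp]: "lbase L = c" "rbase L = d"
  by (simp_all add: coclosure_def Let_def pos_qfib)

lemma cact_mem:
  "I \<in> P.pp \<Longrightarrow> s \<in> cel (beval q (fib p I)) \<Longrightarrow> g \<in> dirs (cpoly d) (cob (beval q (fib p I)) s) \<Longrightarrow>
    cact (beval q (fib p I)) s g \<in> cel (beval q (fib p I))"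
  by (rule copshD(3)[OF Q.copsh_beval[OF P.copsh_fib]])

lemma copmap_lback:
  "I \<in> P.pp \<Longrightarrow> f \<in> dirs (cpoly c) (lob p I) \<Longrightarrow>
    copmap d (beval q (fib p (lact p I f))) (beval q (fib p I)) (papp (carrier q) (lback p I f))"
  by (rule Q.papp_beval[OF P.copsh_fib[OF P.lact] P.copmap_lback])

lemma lcoact_L: "lcoact L \<in> phom (carrier L) (cpoly c \<lhd> carrier L)"
  and lob_L: "I \<in> P.pp \<Longrightarrow> lob L I = lob p I"
  and lact_L: "I \<in> P.pp \<Longrightarrow> f \<in> dirs (cpoly c) (lob p I) \<Longrightarrow> lact L I f = lact p I f"
  and lback_L: "I \<in> P.pp \<Longrightarrow> f \<in> dirs (cpoly c) (lob p I) \<Longrightarrow> s \<in> cel (beval q (fib p (lact p I f))) \<Longrightarrow>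
    lback L I f s = papp (carrier q) (lback p I f) s"
proof -
  have l: "lcoact L = mk_pmap (carrier L) (cpoly c \<lhd> carrier L) (onpos (lcoact p))
        (\<lambda>I (f, K, h). (K, \<lambda>j\<in>dirs (carrier q) K. ondir (lcoact p) I (f, h j)))"
    by (simp add: coclosure_def Let_def)
  have eq: "(case (f, s) of (f, K, h) \<Rightarrow> (K, \<lambda>j\<in>dirs (carrier q) K. ondir (lcoact p) I (f, h j))) =
     papp (carrier q) (lback p I f) s" for f s I
    by (cases s) (simp add: papp_def lback_def)
  show "lcoact L \<in> phom (carrier L) (cpoly c \<lhd> carrier L)"
    unfolding l
  proof (rule mk_pmap_phom)
    fix I assume "I \<in> pos (carrier L)"
    then have I: "I \<in> P.pp" by simp
    then show "onpos (lcoact p) I \<in> pos (cpoly c \<lhd> carrier L)"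
      by (auto simp: P.onpos_lcoact ptri_pos)
    fix k assume "k \<in> dirs (cpoly c \<lhd> carrier L) (onpos (lcoact p) I)"
    then obtain f s where k: "k = (f, s)" and f: "f \<in> dirs (cpoly c) (lob p I)"
      and s: "s \<in> cel (beval q (fib p (lact p I f)))"
      by (auto simp: P.onpos_lcoact I dirs_L)
    show "(case k of (f, K, h) \<Rightarrow> (K, \<lambda>j\<in>dirs (carrier q) K. ondir (lcoact p) I (f, h j))) \<in> dirs (carrier L) I"
      unfolding k eq dirs_L[OF I] by (rule copmapD(1)[OF copmap_lback[OF I f] s])
  qed
  show lob: "lob L I = lob p I" if "I \<in> P.pp" for I
    using that by (simp add: lob_def l)
  show lact: "lact L I f = lact p I f" if "I \<in> P.pp" "f \<in> dirs (cpoly c) (lob p I)" for I f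
    using that by (simp add: lact_def l)
  show "lback L I f s = papp (carrier q) (lback p I f) s"
    if I: "I \<in> P.pp" and f: "f \<in> dirs (cpoly c) (lob p I)" and s: "s \<in> cel (beval q (fib p (lact p I f)))"
  proof -
    have "(f, s) \<in> dirs (cpoly c \<lhd> carrier L) (onpos (lcoact p) I)"
      using I f s by (simp add: P.onpos_lcoact dirs_L)
    then show ?thesis
      unfolding eq[symmetric] lback_def[of L] l using I by (subst mk_pmap_simps(4)) auto
  qed
qed

lemma rcoact_L: "rcoact L \<in> phom (carrier L) (carrier L \<lhd> cpoly d)"
  and fst_rcoact_L: "I \<in> P.pp \<Longrightarrow> fst (onpos (rcoact L) I) = I"
  and rob_L: "I \<in> P.pp \<Longrightarrow> s \<in> cel (beval q (fib p I)) \<Longrightarrow> rob L I s = cob (beval q (fib p I)) s"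
  and ract_L: "I \<in> P.pp \<Longrightarrow> s \<in> cel (beval q (fib p I)) \<Longrightarrow> g \<in> dirs (cpoly d) (cob (beval q (fib p I)) s) \<Longrightarrow>
    ract L I s g = cact (beval q (fib p I)) s g"
proof -
  have r: "rcoact L = mk_pmap (carrier L) (carrier L \<lhd> cpoly d)
        (\<lambda>I. (I, \<lambda>s\<in>dirs (carrier L) I. lob (q \<odot> fiber p I) s)) (\<lambda>I (s, f). lact (q \<odot> fiber p I) s f)"
    by (simp add: coclosure_def Let_def lob_def lact_def)
  show "rcoact L \<in> phom (carrier L) (carrier L \<lhd> cpoly d)"
    unfolding r
  proof (rule mk_pmap_phom)
    fix I assume "I \<in> pos (carrier L)"
    then have I: "I \<in> P.pp" by simp
    note c = copshD(1)[OF Q.copsh_beval[OF P.copsh_fib[OF I]]]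
    show "(I, \<lambda>s\<in>dirs (carrier L) I. lob (q \<odot> fiber p I) s) \<in> pos (carrier L \<lhd> cpoly d)"
      using I c by (auto simp: ptri_pos dirs_L lob_qfib)
    fix k assume "k \<in> dirs (carrier L \<lhd> cpoly d) (I, \<lambda>s\<in>dirs (carrier L) I. lob (q \<odot> fiber p I) s)"
    then obtain s g where "k = (s, g)" "s \<in> cel (beval q (fib p I))" "g \<in> dirs (cpoly d) (cob (beval q (fib p I)) s)"
      by (cases k) (auto simp: I dirs_L lob_qfib simp del: beval_simps)
    then show "(case k of (s, f) \<Rightarrow> lact (q \<odot> fiber p I) s f) \<in> dirs (carrier L) I"
      using cact_mem[OF I] I by (simp add: dirs_L lact_qfib)
  qed
  show "fst (onpos (rcoact L) I) = I" if "I \<in> P.pp" for I using that by (simp add: r)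
  show rob: "rob L I s = cob (beval q (fib p I)) s" if "I \<in> P.pp" "s \<in> cel (beval q (fib p I))" for I s
    using that by (simp add: rob_def r dirs_L lob_qfib del: beval_simps)
  show "ract L I s g = cact (beval q (fib p I)) s g"
    if "I \<in> P.pp" "s \<in> cel (beval q (fib p I))" "g \<in> dirs (cpoly d) (cob (beval q (fib p I)) s)" for I s g
    using that by (simp add: ract_def r dirs_L lob_qfib lact_qfib del: beval_simps)
qed

text \<open>The left laws are the functor \<open>q\<langle>-\<rangle>\<close> applied to those of
  \<open>p\<close>, since the back maps of \<open>L\<close> are
  \<open>papp (carrier q) (lback p I f)\<close>; the right laws say that
  \<open>q\<langle>p[I]\<rangle>\<close> is a copresheaf.\<close>

lemma bicomodule_L: "bicomodule c d L"
  unfolding bicomodule_iff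
proof (intro conjI ballI base_L lcoact_L rcoact_L P.comon Q.comon)
  fix I assume "I \<in> pos (carrier L)"
  then have I [simp]: "I \<in> P.pp" by simp
  note X = P.copsh_fib[OF I]
  note Y = copshD[OF Q.copsh_beval[OF X]]
  show "lact L I (cidm c (lob L I)) = I" by (simp add: lob_L lact_L)
  show "fst (onpos (rcoact L) I) = I" by (simp add: fst_rcoact_L)
  have b: "papp (carrier q) (lback p I (cidm c (lob p I))) s = s" if "s \<in> cel (beval q (fib p I))" for s
    by (rule trans[OF papp_cong_beval[OF that, of _ "\<lambda>x. x"] papp_id[OF beval_pelts[OF that]]]) simp
  show "lback L I (cidm c (lob L I)) s = s" if "s \<in> dirs (carrier L) I" for s
    using that lback_L[OF I, of "cidm c (lob p I)" s] b by (simp add: lob_L dirs_L)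
  { fix s assume "s \<in> dirs (carrier L) I"
    then have s: "s \<in> cel (beval q (fib p I))" by (simp add: dirs_L)
    show "ract L I s (cidm d (rob L I s)) = s"
      using Y(1,2)[OF s] s by (simp add: rob_L ract_L)
    fix g assume "g \<in> dirs (cpoly d) (rob L I s)"
    then have g: "g \<in> dirs (cpoly d) (cob (beval q (fib p I)) s)" using s by (simp add: rob_L)
    show "rob L I (ract L I s g) = ccod d (rob L I s) g"
      using Y(3,4)[OF s g] s g by (simp add: rob_L ract_L)
    fix h assume "h \<in> dirs (cpoly d) (ccod d (rob L I s) g)"
    then have h: "h \<in> dirs (cpoly d) (ccod d (cob (beval q (fib p I)) s) g)" using s by (simp add: rob_L)
    show "ract L I (ract L I s g) h = ract L I s (ccmp d (rob L I s) g h)"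
      using Y(1)[OF s] Y(3,4)[OF s g] Y(5)[OF s g h] s g h by (simp add: rob_L ract_L) }
  fix f assume "f \<in> dirs (cpoly c) (lob L I)"
  then have f [simp]: "f \<in> dirs (cpoly c) (lob p I)" by (simp add: lob_L)
  note F = copmapD[OF copmap_lback[OF I f]]
  show "lob L (lact L I f) = ccod c (lob L I) f" by (simp add: lob_L lact_L)
  { fix s assume "s \<in> dirs (carrier L) (lact L I f)"
    then have s: "s \<in> cel (beval q (fib p (lact p I f)))" by (simp add: lact_L dirs_L)
    show "rob L I (lback L I f s) = rob L (lact L I f) s"
      using F(1,2)[OF s] s by (simp add: lact_L rob_L lback_L)
    fix g assume "g \<in> dirs (cpoly d) (rob L (lact L I f) s)"
    then have g: "g \<in> dirs (cpoly d) (cob (beval q (fib p (lact p I f))) s)" using s by (simp add: lact_L rob_L)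
    show "ract L I (lback L I f s) g = lback L I f (ract L (lact L I f) s g)"
      using F(1,2)[OF s] F(3)[OF s g] cact_mem[OF P.lact[OF I f] s g] s g by (simp add: lact_L lback_L ract_L) }
  fix g assume "g \<in> dirs (cpoly c) (ccod c (lob L I) f)"
  then have g [simp]: "g \<in> dirs (cpoly c) (ccod c (lob p I) f)" by (simp add: lob_L)
  show "lact L I (ccmp c (lob L I) f g) = lact L (lact L I f) g"
    by (simp add: lob_L lact_L P.lact_lact)
  fix s assume "s \<in> dirs (carrier L) (lact L I (ccmp c (lob L I) f g))"
  then have s: "s \<in> cel (beval q (fib p (lact p I (ccmp c (lob p I) f g))))" by (simp add: lob_L lact_L dirs_L)
  then have s': "s \<in> cel (beval q (fib p (lact p (lact p I f) g)))" by (simp add: P.lact_lact)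
  have "papp (carrier q) (lback p I (ccmp c (lob p I) f g)) s =
      papp (carrier q) (lback p I f) (papp (carrier q) (lback p (lact p I f) g) s)"
    unfolding papp_papp by (rule papp_cong_beval[OF s]) (simp add: P.lback_lback)
  moreover have "papp (carrier q) (lback p (lact p I f) g) s \<in> cel (beval q (fib p (lact p I f)))"
    by (rule copmapD(1)[OF copmap_lback s']) auto
  ultimately show "lback L I (ccmp c (lob L I) f g) s = lback L I f (lback L (lact L I f) g s)"
    using s s' by (simp add: lob_L lact_L lback_L)
qed

sublocale L: bicomod c d L by unfold_locales (rule bicomodule_L)
sublocale Lq: bicomod2 c d e L q by unfold_locales
sublocale Lq_: bicomod c e "L \<odot> q" by (rule Lq.bicomod_bcomp)

lemma copmap_fib_L: "I \<in> P.pp \<Longrightarrow> copmap d (fib L I) Y h \<longleftrightarrow> copmap d (beval q (fib p I)) Y h"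
  by (auto simp: copmap_def dirs_L rob_L ract_L simp del: beval_simps)

text \<open>The unit as a map \<open>p\<langle>X\<rangle> \<rightarrow> L\<langle>q\<langle>X\<rangle>\<rangle>\<close>.\<close>

definition ueval :: "'i \<times> ('a \<Rightarrow> 'x) \<Rightarrow> 'i \<times> ('j \<times> ('b \<Rightarrow> 'a) \<Rightarrow> 'j \<times> ('b \<Rightarrow> 'x))" where
  "ueval = (\<lambda>(I, f). (I, \<lambda>s\<in>dirs (carrier L) I. papp (carrier q) f s))"

lemma ueval_pgen: "I \<in> P.pp \<Longrightarrow> ueval (pgen (carrier p) I) = pgen (carrier L) I"
proof -
  assume I: "I \<in> P.pp"
  have "papp (carrier q) (\<lambda>i\<in>P.pd I. i) s = s" if "s \<in> cel (beval q (fib p I))" for s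
    by (rule trans[OF papp_cong_beval[OF that, of _ "\<lambda>x. x"] papp_id[OF beval_pelts[OF that]]]) simp
  then show ?thesis using I by (auto simp: ueval_def pgen_def dirs_L intro!: restrict_ext)
qed

text \<open>Landing in the right place means that \<open>q\<langle>f\<rangle>\<close> is a
  copresheaf map on \<open>L[I]\<close>. Equivariance in \<open>I\<close> is functoriality of
  \<open>q\<langle>-\<rangle>\<close>: applying it to \<open>f\<close> after a back map of
  \<open>p\<close> is \<open>q\<langle>f\<rangle>\<close> after the back map of
  \<open>L\<close>.\<close>

lemma ueval_copmap:
  assumes X: "copsh e X" shows "copmap c (beval p X) (beval L (beval q X)) ueval"
proof (rule copmapI)
  fix z assume z: "z \<in> cel (beval p X)"
  obtain I f where z': "z = (I, f)" by (cases z)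
  have I [simp]: "I \<in> P.pp" and f: "copmap e (fib p I) X f" using z by (auto simp: z')
  note ff = Q.papp_beval[OF P.copsh_fib[OF I] f]
  show "ueval z \<in> cel (beval L (beval q X))"
    using copmap_cong[OF ff Q.copsh_beval[OF P.copsh_fib[OF I]], of "\<lambda>s\<in>dirs (carrier L) I. papp (carrier q) f s"]
    by (simp add: z' ueval_def copmap_fib_L dirs_L del: beval_simps(3))
  show "cob (beval L (beval q X)) (ueval z) = cob (beval p X) z" by (simp add: z' ueval_def lob_L)
  fix g assume "g \<in> dirs (cpoly c) (cob (beval p X) z)"
  then have g [simp]: "g \<in> dirs (cpoly c) (lob p I)" by (simp add: z')
  have "papp (carrier q) (\<lambda>i\<in>P.pd (lact p I g). f (lback p I g i)) s = papp (carrier q) f (lback L I g s) \<and>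
      lback L I g s \<in> dirs (carrier L) I"
    if s: "s \<in> dirs (carrier L) (lact p I g)" for s
  proof -
    have s': "s \<in> cel (beval q (fib p (lact p I g)))" using s by (simp add: dirs_L)
    have "papp (carrier q) (\<lambda>i\<in>P.pd (lact p I g). f (lback p I g i)) s = papp (carrier q) (\<lambda>i. f (lback p I g i)) s"
      by (rule papp_cong_beval[OF s']) simp
    then show ?thesis using copmapD(1)[OF copmap_lback[OF I g] s'] s' by (simp add: lback_L papp_papp dirs_L)
  qed
  then show "ueval (cact (beval p X) z g) = cact (beval L (beval q X)) (ueval z) g"
    by (auto simp: z' ueval_def lact_L intro!: restrict_ext)
qed

lemma unit_bicell:
  shows "coclosure_unit q p \<in> bicells p (L \<odot> q)"
    "z \<in> pelts (carrier p) \<Longrightarrow> bnest L q (peval (bmap (coclosure_unit q p)) z) = ueval z"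
proof -
  interpret T: bicomod_pair c e p "L \<odot> q" by unfold_locales
  let ?h = "mk_pmap (carrier p) (carrier L \<lhd> carrier q) (\<lambda>I. (I, \<lambda>s\<in>dirs (carrier L) I. fst s)) (\<lambda>I (s, j). snd s j)"
  have u: "coclosure_unit q p = \<lparr>bdom = p, bcod = L \<odot> q, bmap = pfactor (bincl L q) ?h\<rparr>"
    by (simp add: coclosure_unit_def Let_def)
  have h: "?h \<in> phom (carrier p) (carrier L \<lhd> carrier q)"
  proof (rule mk_pmap_phom)
    fix I assume I: "I \<in> P.pp"
    show "(I, \<lambda>s\<in>dirs (carrier L) I. fst s) \<in> pos (carrier L \<lhd> carrier q)"
      using I by (auto simp: ptri_pos dirs_L)
    fix k assume "k \<in> dirs (carrier L \<lhd> carrier q) (I, \<lambda>s\<in>dirs (carrier L) I. fst s)"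
    then obtain K h j where k: "k = ((K, h), j)" "(K, h) \<in> cel (beval q (fib p I))" "j \<in> Q.pd K"
      by (cases k) (auto simp: I dirs_L)
    then have "copmap e (fib q K) (fib p I) h" by simp
    from copmapD(1)[OF this, of j] show "(case k of (s, j) \<Rightarrow> snd s j) \<in> P.pd I" using k by simp
  qed
  have nh: "nest (carrier L) (carrier q) (peval ?h z) = ueval z"
    if z: "z \<in> pelts (carrier p)" for z :: "'i \<times> ('a \<Rightarrow> 'z)"
  proof -
    obtain I f where z': "z = (I, f)" by (cases z)
    have I: "I \<in> P.pp" using z by (simp add: z' pelts_def)
    have "papp (carrier q) f s = (fst s, \<lambda>j\<in>Q.pd (fst s). f (snd s j))" for s
      by (cases s) (simp add: papp_def)
    then show ?thesis using I by (auto simp: z' peval_def nest_def ueval_def intro!: restrict_ext)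
  qed
  have AB: "peval (bincl L q) z = peval ?h w"
    if "z \<in> cel (beval (L \<odot> q) (fib p I))" "w \<in> cel (beval p (fib p I))" "bnest L q z = ueval w" for I z w
    using that(3) unfolding nh[OF beval_pelts[OF that(2)], symmetric] unfolding bnest_def
    by (rule nest_inj[OF peval_pelts[OF Lq.bincl beval_pelts[OF that(1)]] peval_pelts[OF h beval_pelts[OF that(2)]]])
  note pf = T.pfactor_cell[OF Lq.bincl Lq.bincl_mono h ueval_copmap[OF P.copsh_fib] Lq.bnest_copiso[OF P.copsh_fib] AB, folded u]
  show "coclosure_unit q p \<in> bicells p (L \<odot> q)" by (rule pf(3)) auto
  have 1: "pfactor (bincl L q) ?h \<in> phom (carrier p) (carrier (L \<odot> q))" by (rule pf(1)) auto
  have 2: "bincl L q \<circ>\<^sub>p pfactor (bincl L q) ?h = ?h" by (rule pf(2)) auto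
  show "bnest L q (peval (bmap (coclosure_unit q p)) z) = ueval z" if z: "z \<in> pelts (carrier p)"
    unfolding nh[OF z, symmetric] u bnest_def using peval_pcomp[OF 1 Lq.bincl z] unfolding 2 by simp
qed

lemma coclosure_eqI:
  assumes "bicomodule c d r" and \<theta>: "\<theta> \<in> bicells L r" and \<theta>': "\<theta>' \<in> bicells L r"
    and eq: "\<And>I z. I \<in> P.pp \<Longrightarrow> z \<in> cel (beval p (fib p I)) \<Longrightarrow> peval (bmap \<theta>) (ueval z) = peval (bmap \<theta>') (ueval z)"
  shows "\<theta> = \<theta>'"
proof -
  have "bmap \<theta> = bmap \<theta>'"
    by (rule phom_eqI_pgen[OF bicellsD(3)[OF \<theta>] bicellsD(3)[OF \<theta>']]) (simp add: ueval_pgen[symmetric] eq P.pgen_beval)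
  then show ?thesis
    using bicellsD[OF \<theta>] bicellsD[OF \<theta>'] by (intro bicell.equality) auto
qed

text \<open>The definite description is resolved by constructing the transpose from the images of
  the universal elements; uniqueness is \<open>coclosure_eqI\<close>.\<close>

lemma adj_bicell:
  assumes r: "bicomodule c d r" and \<phi>: "\<phi> \<in> bicells p (r \<odot> q)"
  shows "coclosure_adj q p r \<phi> \<in> bicells L r"
    "z \<in> pelts (carrier p) \<Longrightarrow> peval (bmap (coclosure_adj q p r \<phi>)) (ueval z) = bnest r q (peval (bmap \<phi>) z)"
proof -
  interpret R: bicomod c d r by unfold_locales (rule r)
  interpret Rq: bicomod2 c d e r q by unfold_locales
  interpret Rq_: bicomod c e "r \<odot> q" by (rule Rq.bicomod_bcomp)
  interpret T: bicomod_pair c e p "r \<odot> q" by unfold_locales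
  interpret S: bicomod_pair c d L r by unfold_locales
  let ?m = "bmap \<phi>"
  have m: "?m \<in> phom (carrier p) (carrier (r \<odot> q))" by (rule bicellsD[OF \<phi>])
  \<comment> \<open>An element of \<open>r\<langle>q\<langle>p[I]\<rangle>\<rangle> =
    r\<langle>L[I]\<rangle>\<close>, that is, a position of \<open>r\<close> with a map from its
    directions to \<open>L[I]\<close>: exactly the component at \<open>I\<close> of a map
    \<open>L \<rightarrow> r\<close>.\<close>
  define t where "t I = bnest r q (peval ?m (pgen (carrier p) I))" for I
  define th where "th = mk_pmap (carrier L) (carrier r) (\<lambda>I. fst (t I)) (\<lambda>I. snd (t I))"
  have T: "copmap c (beval p X) (beval r (beval q X)) (\<lambda>z. bnest r q (peval ?m z))" if "copsh e X" for X :: "('z, 'e, 'h) cps"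
    by (rule copmap_comp[OF T.bicell_copmap[OF \<phi> that] copisoD(1)[OF Rq.bnest_copiso[OF that]]])
  have t: "t I \<in> cel (beval r (beval q (fib p I)))" if "I \<in> P.pp" for I
    unfolding t_def by (rule copmapD(1)[OF T[OF P.copsh_fib[OF that]] P.pgen_beval[OF that]])
  have t': "fst (t I) \<in> R.pp" "k \<in> R.pd (fst (t I)) \<Longrightarrow> snd (t I) k \<in> cel (beval q (fib p I))" if "I \<in> P.pp" for I k
  proof -
    obtain K h where *: "t I = (K, h)" by (cases "t I")
    have "K \<in> R.pp" "copmap d (fib r K) (beval q (fib p I)) h" using t[OF that] by (auto simp: *)
    then show "fst (t I) \<in> R.pp" "k \<in> R.pd (fst (t I)) \<Longrightarrow> snd (t I) k \<in> cel (beval q (fib p I))"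
      using copmapD(1)[of d "fib r K" "beval q (fib p I)" h k] by (simp_all add: *)
  qed
  have th: "th \<in> phom (carrier L) (carrier r)"
    unfolding th_def by (rule mk_pmap_phom) (auto simp: t' dirs_L simp del: beval_simps)
  have evth: "peval th (I, F) = papp (carrier r) F (t I)" if "I \<in> P.pp" for I and F :: "'j \<times> ('b \<Rightarrow> 'a) \<Rightarrow> 'z"
  proof -
    have "papp (carrier r) F (t I) = (fst (t I), \<lambda>k\<in>R.pd (fst (t I)). F (snd (t I) k))"
      by (cases "t I") (simp add: papp_def)
    then show ?thesis using that
      by (auto simp: peval_def phomD[OF th]) (auto simp: th_def intro!: restrict_ext)
  qed
  let ?\<theta> = "\<lparr>bdom = L, bcod = r, bmap = th\<rparr>"
  have \<theta>: "?\<theta> \<in> bicells L r"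
  proof (rule S.bicellI)
    \<comment> \<open>\<open>I0\<close> only fixes the test copresheaf \<open>L[I0]\<close>; the
      position \<open>I\<close> of the element \<open>z\<close> is independent of it.\<close>
    fix I0 assume "I0 \<in> pos (carrier L)"
    then have I0: "I0 \<in> P.pp" by simp
    let ?Y = "fib L I0"
    show "copmap c (beval L ?Y) (beval r ?Y) (peval (bmap ?\<theta>))"
    proof (rule copmapI)
      fix z assume z: "z \<in> cel (beval L ?Y)"
      obtain I F where z': "z = (I, F)" by (cases z)
      have I [simp]: "I \<in> P.pp" and F: "copmap d (beval q (fib p I)) ?Y F" using z by (auto simp: z' copmap_fib_L)
      note fF = copmapD[OF R.papp_beval[OF Q.copsh_beval[OF P.copsh_fib[OF I]] F] t[OF I]]
      note tI = copmapD[OF T[OF P.copsh_fib[OF I]] P.pgen_beval[OF I], folded t_def]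
      have cb: "cob (beval r (beval q (fib p I))) (t I) = lob p I" using tI(2) by (simp add: pgen_def)
      have ez: "peval (bmap ?\<theta>) z = papp (carrier r) F (t I)" by (simp add: z' evth)
      show "peval (bmap ?\<theta>) z \<in> cel (beval r ?Y)" unfolding ez by (rule fF(1))
      show "cob (beval r ?Y) (peval (bmap ?\<theta>) z) = cob (beval L ?Y) z"
        unfolding ez using fF(2) cb by (simp add: z' lob_L)
      fix g assume "g \<in> dirs (cpoly c) (cob (beval L ?Y) z)"
      then have g [simp]: "g \<in> dirs (cpoly c) (lob p I)" by (simp add: z' lob_L)
      have g2: "pgen (carrier p) (lact p I g) \<in> pelts (carrier p)" by simp
      \<comment> \<open>A morphism \<open>g\<close> takes the universal element at \<open>I\<close>
        to the image of the universal element at \<open>lact p I g\<close> under the back map. This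
        makes the family \<open>t\<close> compatible with the left actions.\<close>
      have gg: "cact (beval p (fib p I)) (pgen (carrier p) I) g = papp (carrier p) (lback p I g) (pgen (carrier p) (lact p I g))"
        by (auto simp: pgen_def papp_def intro!: restrict_ext)
      have tg: "cact (beval r (beval q (fib p I))) (t I) g = papp (carrier r) (papp (carrier q) (lback p I g)) (t (lact p I g))"
        using tI(3)[of g] unfolding gg peval_papp[OF m g2] Rq.bnest_papp[OF peval_pelts[OF m g2]] t_def[symmetric] by (simp add: pgen_def)
      have "peval (bmap ?\<theta>) (cact (beval L ?Y) z g) = papp (carrier r) (\<lambda>s\<in>dirs (carrier L) (lact p I g). F (lback L I g s)) (t (lact p I g))"
        by (simp add: z' lact_L evth)
      also have "\<dots> = papp (carrier r) (\<lambda>s. F (papp (carrier q) (lback p I g) s)) (t (lact p I g))"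
        by (rule papp_cong_beval[OF t[OF P.lact[OF I g]]]) (simp add: dirs_L lback_L del: beval_simps)
      also have "\<dots> = papp (carrier r) F (cact (beval r (beval q (fib p I))) (t I) g)"
        unfolding tg papp_papp ..
      also have "\<dots> = cact (beval r ?Y) (peval (bmap ?\<theta>) z) g"
        unfolding ez by (rule fF(3)) (simp add: cb)
      finally show "peval (bmap ?\<theta>) (cact (beval L ?Y) z g) = cact (beval r ?Y) (peval (bmap ?\<theta>) z) g" .
    qed
  qed (use th in auto)
  have sem: "peval th (ueval z) = bnest r q (peval ?m z)" if z: "z \<in> pelts (carrier p)" for z :: "'i \<times> ('a \<Rightarrow> 'z)"
  proof -
    obtain I f where z': "z = (I, f)" by (cases z)
    have I: "I \<in> P.pp" using z by (simp add: z' pelts_def)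
    have "peval th (ueval z) = papp (carrier r) (\<lambda>s\<in>dirs (carrier L) I. papp (carrier q) f s) (t I)"
      by (simp add: z' ueval_def evth I)
    also have "\<dots> = papp (carrier r) (papp (carrier q) f) (t I)"
      by (rule papp_cong_beval[OF t[OF I]]) (simp add: dirs_L I del: beval_simps)
    also have "\<dots> = bnest r q (papp (carrier (r \<odot> q)) f (peval ?m (pgen (carrier p) I)))"
      unfolding t_def Rq.bnest_papp[OF peval_pelts[OF m pgen_pelts[OF I]]] ..
    also have "\<dots> = bnest r q (peval ?m z)"
      unfolding peval_papp[OF m pgen_pelts[OF I], symmetric] papp_pgen[OF z[unfolded z']] z' ..
    finally show ?thesis .
  qed
  \<comment> \<open>In evaluated form, whiskering with \<open>q\<close> and composing with the unit
    is restriction along \<open>ueval\<close>; both existence and uniqueness are read off from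
    this.\<close>
  have comp: "bnest r q (peval (bmap ((\<theta> \<odot>\<^sub>b cid q) \<circ>\<^sub>b coclosure_unit q p)) z) = peval (bmap \<theta>) (ueval z)"
    if \<theta>: "\<theta> \<in> bicells L r" and z: "z \<in> cel (beval p (fib p I))" and I: "I \<in> P.pp" for \<theta> I z
  proof -
    note hc = hcomp_bicell[OF bicomodule_L r Q.bicomodule Q.bicomodule \<theta> cid_bicell[OF Q.bicomodule]]
    note vc = vcomp_bicell[OF P.bicomodule Lq_.bicomodule Rq_.bicomodule unit_bicell(1) hc(1)]
    note X = P.copsh_fib[OF I]
    have uz: "ueval z \<in> cel (beval L (beval q (fib p I)))" by (rule copmapD(1)[OF ueval_copmap[OF X] z])
    have uz': "peval (bmap (coclosure_unit q p)) z \<in> pelts (carrier (L \<odot> q))"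
      by (rule peval_pelts[OF bicellsD(3)[OF unit_bicell(1)] beval_pelts[OF z]])
    have "papp (carrier L) (peval (bmap (cid q))) (ueval z) = ueval z"
      by (rule trans[OF papp_cong_beval[OF uz, of _ "\<lambda>x. x"] papp_id[OF beval_pelts[OF uz]]])
        (simp add: cid_def peval_pid beval_pelts del: beval_simps)
    then show "bnest r q (peval (bmap ((\<theta> \<odot>\<^sub>b cid q) \<circ>\<^sub>b coclosure_unit q p)) z) = peval (bmap \<theta>) (ueval z)"
      unfolding vc(2)[OF beval_pelts[OF z]] hc(2)[OF uz'] unit_bicell(2)[OF beval_pelts[OF z]] by simp
  qed
  have cc: "(?\<theta> \<odot>\<^sub>b cid q) \<circ>\<^sub>b coclosure_unit q p \<in> bicells p (r \<odot> q)"
    by (rule vcomp_bicell(1)[OF P.bicomodule Lq_.bicomodule Rq_.bicomodule unit_bicell(1)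
      hcomp_bicell(1)[OF bicomodule_L r Q.bicomodule Q.bicomodule \<theta> cid_bicell[OF Q.bicomodule]]])
  have 1: "(?\<theta> \<odot>\<^sub>b cid q) \<circ>\<^sub>b coclosure_unit q p = \<phi>"
  proof (rule T.bicell_eqI[OF cc \<phi>])
    fix I z assume I: "I \<in> P.pp" and z: "z \<in> cel (beval p (fib p I))"
    show "peval (bmap ((?\<theta> \<odot>\<^sub>b cid q) \<circ>\<^sub>b coclosure_unit q p)) z = peval ?m z"
    proof (rule Rq.bnest_inj[OF peval_pelts[OF bicellsD(3)[OF cc] beval_pelts[OF z]] peval_pelts[OF m beval_pelts[OF z]]])
      show "bnest r q (peval (bmap ((?\<theta> \<odot>\<^sub>b cid q) \<circ>\<^sub>b coclosure_unit q p)) z) = bnest r q (peval ?m z)"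
        unfolding comp[OF \<theta> z I] using sem[OF beval_pelts[OF z]] by simp
    qed
  qed
  have adj: "coclosure_adj q p r \<phi> = ?\<theta>"
    unfolding coclosure_adj_def
  proof (rule the_equality)
    show "?\<theta> \<in> bicells L r \<and> (?\<theta> \<odot>\<^sub>b cid q) \<circ>\<^sub>b coclosure_unit q p = \<phi>" using \<theta> 1 by simp
    fix \<theta>' assume *: "\<theta>' \<in> bicells L r \<and> (\<theta>' \<odot>\<^sub>b cid q) \<circ>\<^sub>b coclosure_unit q p = \<phi>"
    show "\<theta>' = ?\<theta>"
    proof (rule coclosure_eqI[OF r])
      show "\<theta>' \<in> bicells L r" "?\<theta> \<in> bicells L r" using * \<theta> by auto
      fix I z assume I: "I \<in> P.pp" and z: "z \<in> cel (beval p (fib p I))"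
      show "peval (bmap \<theta>') (ueval z) = peval (bmap ?\<theta>) (ueval z)"
        using comp[of \<theta>', OF _ z I] comp[OF \<theta> z I] * 1 by simp
    qed
  qed
  show "coclosure_adj q p r \<phi> \<in> bicells L r" using adj \<theta> by simp
  show "peval (bmap (coclosure_adj q p r \<phi>)) (ueval z) = bnest r q (peval ?m z)" if "z \<in> pelts (carrier p)"
    using sem[OF that] by (simp add: adj)
qed

end

section \<open>The comonad and its comodules\<close>

lemma copiso_surj:
  assumes "copiso d X Y h" "y \<in> cel Y"
  obtains x where "x \<in> cel X" "h x = y"
proof -
  have "y \<in> h ` cel X" using copisoD(3)[OF assms(1)] assms(2) by simp
  then show ?thesis using that by auto
qed

text \<open>The inverse of \<open>bnest\<close>, unique because \<open>bnest\<close> is injective on \<open>pelts\<close> of the composite.\<close>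

definition bnest_inv :: "('i, 'a, 'c, 'f, 'd, 'g) bicom \<Rightarrow> ('j, 'b, 'd, 'g, 'e, 'h) bicom \<Rightarrow>
    'i \<times> ('a \<Rightarrow> 'j \<times> ('b \<Rightarrow> 'x)) \<Rightarrow> ('i \<times> ('a \<Rightarrow> 'j)) \<times> (('a \<times> 'b) set \<Rightarrow> 'x)" where
  "bnest_inv p q w = (THE z. z \<in> pelts (carrier (p \<odot> q)) \<and> bnest p q z = w)"

context bicomod2
begin

lemma bnest_inv_bnest: "z \<in> pelts (carrier (p \<odot> q)) \<Longrightarrow> bnest_inv p q (bnest p q z) = z"
  unfolding bnest_inv_def by (rule the_equality) (auto intro: bnest_inj)

lemma
  assumes X: "copsh e X" and w: "w \<in> cel (beval p (beval q X))"
  shows bnest_inv_mem: "bnest_inv p q w \<in> cel (beval (p \<odot> q) X)" and bnest_bnest_inv: "bnest p q (bnest_inv p q w) = w"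
proof -
  obtain z where z: "z \<in> cel (beval (p \<odot> q) X)" "bnest p q z = w"
    by (rule copiso_surj[OF bnest_copiso[OF X] w])
  then have "bnest_inv p q w = z" using bnest_inv_bnest[OF beval_pelts[OF z(1)]] by simp
  then show "bnest_inv p q w \<in> cel (beval (p \<odot> q) X)" "bnest p q (bnest_inv p q w) = w" using z by auto
qed

lemma bnest_inv_copmap:
  assumes X: "copsh e X" shows "copmap c (beval p (beval q X)) (beval (p \<odot> q) X) (bnest_inv p q)"
proof (rule copmapI)
  interpret PQ: bicomod c e "p \<odot> q" by (rule bicomod_bcomp)
  fix w assume w: "w \<in> cel (beval p (beval q X))"
  note m = bnest_inv_mem[OF X w] and a = bnest_bnest_inv[OF X w] and A = copmapD[OF copisoD(1)[OF bnest_copiso[OF X]]]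
  show "bnest_inv p q w \<in> cel (beval (p \<odot> q) X)" by (rule m)
  show cob: "cob (beval (p \<odot> q) X) (bnest_inv p q w) = cob (beval p (beval q X)) w" using A(2)[OF m] a by simp
  fix g assume g: "g \<in> dirs (cpoly c) (cob (beval p (beval q X)) w)"
  have mg: "cact (beval (p \<odot> q) X) (bnest_inv p q w) g \<in> cel (beval (p \<odot> q) X)"
    by (rule copshD(3)[OF PQ.copsh_beval[OF X] m]) (simp add: cob g)
  have "bnest p q (cact (beval (p \<odot> q) X) (bnest_inv p q w) g) = cact (beval p (beval q X)) w g"
    using A(3)[OF m, of g] a g cob by simp
  then show "bnest_inv p q (cact (beval p (beval q X)) w g) = cact (beval (p \<odot> q) X) (bnest_inv p q w) g"
    using bnest_inv_bnest[OF beval_pelts[OF mg]] by simp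
qed

end

lemma hcomp_cid_left:
  assumes "bicomodule c d p" "bicomodule d e q" "bicomodule d e q'" and \<psi>: "\<psi> \<in> bicells q q'"
  shows "cid p \<odot>\<^sub>b \<psi> \<in> bicells (p \<odot> q) (p \<odot> q')"
    "z \<in> pelts (carrier (p \<odot> q)) \<Longrightarrow> bnest p q' (peval (bmap (cid p \<odot>\<^sub>b \<psi>)) z) = papp (carrier p) (peval (bmap \<psi>)) (bnest p q z)"
proof -
  interpret bicomod2 c d e p q by unfold_locales (rule assms)+
  note h = hcomp_bicell[OF assms(1,1,2,3) cid_bicell[OF assms(1)] \<psi>]
  show "cid p \<odot>\<^sub>b \<psi> \<in> bicells (p \<odot> q) (p \<odot> q')" by (rule h(1))
  show "z \<in> pelts (carrier (p \<odot> q)) \<Longrightarrow> bnest p q' (peval (bmap (cid p \<odot>\<^sub>b \<psi>)) z) = papp (carrier p) (peval (bmap \<psi>)) (bnest p q z)"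
    using h(2)[of z] peval_pid[OF papp_pelts[OF bnest_pelts], of z] by (simp add: cid_def)
qed

lemma hcomp_cid_right:
  assumes "bicomodule c d p" "bicomodule c d p'" "bicomodule d e q" and \<phi>: "\<phi> \<in> bicells p p'"
  shows "\<phi> \<odot>\<^sub>b cid q \<in> bicells (p \<odot> q) (p' \<odot> q)"
    "z \<in> pelts (carrier (p \<odot> q)) \<Longrightarrow> bnest p' q (peval (bmap (\<phi> \<odot>\<^sub>b cid q)) z) = peval (bmap \<phi>) (bnest p q z)"
proof -
  interpret bicomod2 c d e p q by unfold_locales (rule assms)+
  note h = hcomp_bicell[OF assms(1,2,3,3) \<phi> cid_bicell[OF assms(3)]]
  show "\<phi> \<odot>\<^sub>b cid q \<in> bicells (p \<odot> q) (p' \<odot> q)" by (rule h(1))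
  show "z \<in> pelts (carrier (p \<odot> q)) \<Longrightarrow> bnest p' q (peval (bmap (\<phi> \<odot>\<^sub>b cid q)) z) = peval (bmap \<phi>) (bnest p q z)"
    using h(2)[of z] papp_peval_pid[OF peval_pelts[OF bincl], of z] by (simp add: cid_def bnest_def)
qed

lemma orbit_nat:
  assumes "copmap c Y Z h" "y \<in> cel Y"
  shows "papp (carrier (bid c)) h (orbit c Y y) = orbit c Z (h y)"
  using copmapD[OF assms] by (auto simp: papp_def orbit_def bid_def intro!: restrict_ext)

lemma peval_cell_papp:
  "\<phi> \<in> bicells p q \<Longrightarrow> z \<in> cel (beval p X) \<Longrightarrow> peval (bmap \<phi>) (papp (carrier p) h z) = papp (carrier q) h (peval (bmap \<phi>) z)"
  by (rule peval_papp[OF bicellsD(3) beval_pelts])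

text \<open>The module action \<open>m\<langle>x\<langle>X\<rangle>\<rangle> \<rightarrow> x\<langle>X\<rangle>\<close> and the monad unit \<open>X \<rightarrow> m\<langle>X\<rangle>\<close>.\<close>

definition mact :: "('i, 'a, 'c, 'f, 'c, 'f) bicom \<Rightarrow> ('j, 'b, 'c, 'f, 'd, 'g) bicom \<Rightarrow>
   ('i \<times> ('a \<Rightarrow> 'j), ('a \<times> 'b) set, 'j, 'b, 'c, 'f, 'd, 'g) bicell \<Rightarrow>
   'i \<times> ('a \<Rightarrow> 'j \<times> ('b \<Rightarrow> 'x)) \<Rightarrow> 'j \<times> ('b \<Rightarrow> 'x)" where
  "mact m x \<psi> w = peval (bmap \<psi>) (bnest_inv m x w)"

definition munit :: "('c, 'f) comonoid \<Rightarrow> ('c, 'f, 'i, 'a, 'c, 'f, 'c, 'f) bicell \<Rightarrow> ('x, 'c, 'f) cps \<Rightarrow> 'x \<Rightarrow> 'i \<times> ('a \<Rightarrow> 'x)" where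
  "munit c \<eta> X y = peval (bmap \<eta>) (orbit c X y)"

section \<open>Module laws as equations between elements\<close>

locale module_data =
  fixes c :: "('c, 'f) comonoid" and b :: "('o, 'n) comonoid" and m :: "('i, 'a, 'c, 'f, 'c, 'f) bicom"
    and \<eta> :: "('c, 'f, 'i, 'a, 'c, 'f, 'c, 'f) bicell"
    and \<mu> :: "('i \<times> ('a \<Rightarrow> 'i), ('a \<times> 'a) set, 'i, 'a, 'c, 'f, 'c, 'f) bicell"
    and x :: "('j, 'u, 'c, 'f, 'o, 'n) bicom"
    and \<psi> :: "('i \<times> ('a \<Rightarrow> 'j), ('a \<times> 'u) set, 'j, 'u, 'c, 'f, 'o, 'n) bicell"
  assumes module: "left_module c b m \<eta> \<mu> x \<psi>"
begin

lemma monad: "monad_on c m \<eta> \<mu>" and bic: "bicomodule c c m" "bicomodule c b x"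
  and cells: "\<eta> \<in> bicells (bid c) m" "\<mu> \<in> bicells (m \<odot> m) m" "\<psi> \<in> bicells (m \<odot> x) x"
  using module by (auto simp: left_module_def monad_on_def)

sublocale M: bicomod c c m by unfold_locales (rule bic)
sublocale X: bicomod c b x by unfold_locales (rule bic)
sublocale MMX: bicomod3 c c c b m m x by unfold_locales

lemma munit_copmap:
  assumes "copsh c Y" shows "copmap c Y (beval m Y) (munit c \<eta> Y)"
proof -
  interpret T: bicomod_pair c c "bid c" m by unfold_locales
  show ?thesis unfolding munit_def
    by (rule copmap_comp[OF copisoD(1)[OF M.C.orbit_copiso[OF assms]] T.bicell_copmap[OF cells(1) assms]])
qed

lemma mact_copmap:
  assumes X: "copsh b X" shows "copmap c (beval m (beval x X)) (beval x X) (mact m x \<psi>)"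
proof -
  interpret T: bicomod_pair c b "m \<odot> x" x by unfold_locales
  show ?thesis unfolding mact_def
    by (rule copmap_comp[OF MMX.QR.bnest_inv_copmap[OF X] T.bicell_copmap[OF cells(3) X]])
qed

text \<open>The module unit law evaluated at \<open>y\<close>: the unitor turns \<open>y\<close>
  into its orbit and \<open>\<eta>\<close> acts on that orbit, which together is
  \<open>munit\<close>.\<close>

lemma mact_munit:
  assumes X: "copsh b X" and y: "y \<in> cel (beval x X)"
  shows "mact m x \<psi> (munit c \<eta> (beval x X) y) = y"
proof -
  interpret CX: bicomod2 c c b "bid c" x by unfold_locales
  interpret CX_: bicomod c b "bid c \<odot> x" by (rule CX.bicomod_bcomp)
  note l = X.lunitor_inv_bicell
  note h = hcomp_cid_right[OF M.C.B.bicomodule M.bicomodule X.bicomodule cells(1)]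
  note v1 = vcomp_bicell[OF CX_.bicomodule MMX.QR_.bicomodule X.bicomodule h(1) cells(3)]
  note v2 = vcomp_bicell[OF X.bicomodule CX_.bicomodule X.bicomodule l(1) v1(1)]
  have ly: "peval (bmap (lunitor_inv x)) y \<in> pelts (carrier (bid c \<odot> x))"
    by (rule peval_pelts[OF bicellsD(3)[OF l(1)] beval_pelts[OF y]])
  let ?z = "peval (bmap (\<eta> \<odot>\<^sub>b cid x)) (peval (bmap (lunitor_inv x)) y)"
  have zr: "?z \<in> pelts (carrier (m \<odot> x))" by (rule peval_pelts[OF bicellsD(3)[OF h(1)] ly])
  have "bnest m x ?z = munit c \<eta> (beval x X) y"
    unfolding h(2)[OF ly] l(2)[OF y] munit_def ..
  then have z: "bnest_inv m x (munit c \<eta> (beval x X) y) = ?z" using MMX.QR.bnest_inv_bnest[OF zr] by simp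
  have "\<psi> \<circ>\<^sub>b (\<eta> \<odot>\<^sub>b cid x) \<circ>\<^sub>b lunitor_inv x = cid x" using module by (simp add: left_module_def)
  then have "peval (bmap (\<psi> \<circ>\<^sub>b (\<eta> \<odot>\<^sub>b cid x) \<circ>\<^sub>b lunitor_inv x)) y = y"
    using peval_pid[OF beval_pelts[OF y]] by (simp add: cid_def)
  then show ?thesis
    unfolding v2(2)[OF beval_pelts[OF y]] v1(2)[OF ly] mact_def z .
qed

text \<open>The module associativity law is an equation of cells out of
  \<open>(m \<odot> m) \<odot> x\<close>. Each \<open>bnest_inv\<close> occurring in
  \<open>mact\<close> is identified with the image of a single element there, so the law can be
  applied at that element.\<close>

lemma mact_mact:
  assumes X: "copsh b X" and w: "w \<in> cel (beval m (beval m (beval x X)))"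
  shows "mact m x \<psi> (mact m m \<mu> w) = mact m x \<psi> (papp (carrier m) (mact m x \<psi>) w)"
proof -
  note a = MMX.assoc_bicell
  note h1 = hcomp_cid_right[OF MMX.PQ_.bicomodule M.bicomodule X.bicomodule cells(2)]
  note h2 = hcomp_cid_left[OF M.bicomodule MMX.QR_.bicomodule X.bicomodule cells(3)]
  note v1 = vcomp_bicell[OF MMX.PQ_R_.bicomodule MMX.QR_.bicomodule X.bicomodule h1(1) cells(3)]
  note v2 = vcomp_bicell[OF MMX.P_QR_.bicomodule MMX.QR_.bicomodule X.bicomodule h2(1) cells(3)]
  note v3 = vcomp_bicell[OF MMX.PQ_R_.bicomodule MMX.P_QR_.bicomodule X.bicomodule a(1) v2(1)]
  note XX = X.copsh_beval[OF X]
  \<comment> \<open>Every nested element comes from the threefold composite, which supplies the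
    point at which the law of cells is evaluated.\<close>
  obtain z where z: "z \<in> cel (beval ((m \<odot> m) \<odot> x) X)" "bnest m m (bnest (m \<odot> m) x z) = w"
    by (rule copiso_surj[OF MMX.copiso_l[OF X] w])
  note zr = beval_pelts[OF z(1)]
  have ar: "peval (bmap (assoc m m x)) z \<in> pelts (carrier (m \<odot> (m \<odot> x)))"
    by (rule peval_pelts[OF bicellsD(3)[OF a(1)] zr])
  have az: "peval (bmap (assoc m m x)) z \<in> cel (beval (m \<odot> (m \<odot> x)) X)"
  proof -
    interpret T: bicomod_pair c b "(m \<odot> m) \<odot> x" "m \<odot> (m \<odot> x)" by unfold_locales
    show ?thesis by (rule copmapD(1)[OF T.bicell_copmap[OF a(1) X] z(1)])
  qed
  have 1: "bnest_inv m m w = bnest (m \<odot> m) x z"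
    using MMX.PQ.bnest_inv_bnest[OF MMX.PQ_R.bnest_pelts[OF zr]] z(2) by simp
  let ?z1 = "peval (bmap (\<mu> \<odot>\<^sub>b cid x)) z"
  have z1r: "?z1 \<in> pelts (carrier (m \<odot> x))" by (rule peval_pelts[OF bicellsD(3)[OF h1(1)] zr])
  have L: "bnest_inv m x (mact m m \<mu> w) = ?z1"
    using MMX.QR.bnest_inv_bnest[OF z1r] unfolding h1(2)[OF zr] mact_def 1 .
  let ?y = "bnest m (m \<odot> x) (peval (bmap (assoc m m x)) z)"
  have y: "?y \<in> cel (beval m (beval (m \<odot> x) X))"
    by (rule copmapD(1)[OF copisoD(1)[OF MMX.P_QR.bnest_copiso[OF X]] az])
  have "papp (carrier m) (bnest_inv m x) w = papp (carrier m) (\<lambda>v. bnest_inv m x (bnest m x v)) ?y"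
    unfolding z(2)[symmetric] a(2)[OF zr, symmetric] papp_papp ..
  also have "\<dots> = ?y"
    by (rule trans[OF papp_cong_beval[OF y, of _ "\<lambda>x. x"] papp_id[OF beval_pelts[OF y]]])
      (rule MMX.QR.bnest_inv_bnest[OF beval_pelts])
  finally have wy: "papp (carrier m) (bnest_inv m x) w = ?y" .
  let ?z2 = "peval (bmap (cid m \<odot>\<^sub>b \<psi>)) (peval (bmap (assoc m m x)) z)"
  have z2r: "?z2 \<in> pelts (carrier (m \<odot> x))" by (rule peval_pelts[OF bicellsD(3)[OF h2(1)] ar])
  have "bnest m x ?z2 = papp (carrier m) (mact m x \<psi>) w"
    unfolding h2(2)[OF ar] wy[symmetric] papp_papp mact_def ..
  then have R: "bnest_inv m x (papp (carrier m) (mact m x \<psi>) w) = ?z2"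
    using MMX.QR.bnest_inv_bnest[OF z2r] by simp
  have "\<psi> \<circ>\<^sub>b (\<mu> \<odot>\<^sub>b cid x) = \<psi> \<circ>\<^sub>b (cid m \<odot>\<^sub>b \<psi>) \<circ>\<^sub>b assoc m m x" using module by (simp add: left_module_def)
  then have "peval (bmap (\<psi> \<circ>\<^sub>b (\<mu> \<odot>\<^sub>b cid x))) z = peval (bmap (\<psi> \<circ>\<^sub>b (cid m \<odot>\<^sub>b \<psi>) \<circ>\<^sub>b assoc m m x)) z" by simp
  then show ?thesis
    unfolding v1(2)[OF zr] v3(2)[OF zr] v2(2)[OF ar] unfolding mact_def[of m x] L[unfolded mact_def[of m m]] R[unfolded mact_def[of m x]]
      mact_def[of m m] .
qed

end

text \<open>For \<open>x = m\<close> the module laws are the left unit law and associativity of the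
  monad; the right unit law is treated separately in \<open>papp_munit_mact\<close>.\<close>

lemma monad_modl: "monad_on c m \<eta> \<mu> \<Longrightarrow> module_data c c m \<eta> \<mu> m \<mu>"
  by unfold_locales (simp add: left_module_def monad_on_def)

section \<open>The monad in evaluated form and the counit of the coclosure\<close>

locale monad_coclosure =
  fixes c :: "('c, 'f) comonoid" and d :: "('d, 'g) comonoid" and m :: "('i, 'a, 'c, 'f, 'c, 'f) bicom"
    and \<eta> :: "('c, 'f, 'i, 'a, 'c, 'f, 'c, 'f) bicell"
    and \<mu> :: "('i \<times> ('a \<Rightarrow> 'i), ('a \<times> 'a) set, 'i, 'a, 'c, 'f, 'c, 'f) bicell"
    and p :: "('k, 'e, 'd, 'g, 'c, 'f) bicom"
  assumes monad: "monad_on c m \<eta> \<mu>" and bicp: "bicomodule d c p"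
begin

sublocale MM: module_data c c m \<eta> \<mu> m \<mu> by (rule monad_modl[OF monad])
sublocale P: bicomod d c p by unfold_locales (rule bicp)
sublocale PMM: bicomod3 d c c c p m m by unfold_locales
sublocale K: coclosure_pair d d c "p \<odot> m" p by unfold_locales

abbreviation "q \<equiv> p \<odot> m"
abbreviation "L \<equiv> coclosure q p"
abbreviation "u \<equiv> coclosure_unit q p"
abbreviation "coun \<equiv> coclosure_counit p m \<eta>"
abbreviation "comul \<equiv> coclosure_comult p m \<mu>"

sublocale LL: bicomod2 d d d L L by unfold_locales
sublocale LL_: bicomod d d "L \<odot> L" by (rule LL.bicomod_bcomp)

text \<open>The right unit law of the monad: the right unitor forms orbits inside \<open>m\<close>,
  and \<open>\<eta>\<close> turns them into values of \<open>munit\<close>. The counit law on the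
  first factor of \<open>L \<odot> L\<close> depends on it.\<close>

lemma papp_munit_mact:
  assumes X: "copsh c X" and z: "z \<in> cel (beval m X)"
  shows "mact m m \<mu> (papp (carrier m) (munit c \<eta> X) z) = z"
proof -
  interpret MC: bicomod2 c c c m "bid c" by unfold_locales
  interpret MC_: bicomod c c "m \<odot> bid c" by (rule MC.bicomod_bcomp)
  note l = MM.M.runitor_inv_bicell
  note h = hcomp_cid_left[OF MM.M.bicomodule MM.M.C.B.bicomodule MM.M.bicomodule MM.cells(1)]
  note v1 = vcomp_bicell[OF MC_.bicomodule MM.MMX.PQ_.bicomodule MM.M.bicomodule h(1) MM.cells(2)]
  note v2 = vcomp_bicell[OF MM.M.bicomodule MC_.bicomodule MM.M.bicomodule l(1) v1(1)]
  have lz: "peval (bmap (runitor_inv m)) z \<in> pelts (carrier (m \<odot> bid c))"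
    by (rule peval_pelts[OF bicellsD(3)[OF l(1)] beval_pelts[OF z]])
  let ?z = "peval (bmap (cid m \<odot>\<^sub>b \<eta>)) (peval (bmap (runitor_inv m)) z)"
  have zr: "?z \<in> pelts (carrier (m \<odot> m))" by (rule peval_pelts[OF bicellsD(3)[OF h(1)] lz])
  have "bnest m m ?z = papp (carrier m) (munit c \<eta> X) z"
    unfolding h(2)[OF lz] l(2)[OF z] munit_def papp_papp ..
  then have z': "bnest_inv m m (papp (carrier m) (munit c \<eta> X) z) = ?z" using MM.MMX.PQ.bnest_inv_bnest[OF zr] by simp
  have "\<mu> \<circ>\<^sub>b (cid m \<odot>\<^sub>b \<eta>) \<circ>\<^sub>b runitor_inv m = cid m" using monad by (simp add: monad_on_def)
  then have "peval (bmap (\<mu> \<circ>\<^sub>b (cid m \<odot>\<^sub>b \<eta>) \<circ>\<^sub>b runitor_inv m)) z = z"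
    using peval_pid[OF beval_pelts[OF z]] by (simp add: cid_def)
  then show ?thesis
    unfolding v2(2)[OF beval_pelts[OF z]] v1(2)[OF lz] mact_def z' .
qed

text \<open>The unit as a map \<open>p\<langle>X\<rangle> \<rightarrow> L\<langle>p\<langle>m\<langle>X\<rangle>\<rangle>\<rangle>\<close>.\<close>

definition umeval :: "'k \<times> ('e \<Rightarrow> 'x) \<Rightarrow> 'k \<times> (('k \<times> ('e \<Rightarrow> 'i)) \<times> (('e \<times> 'a) set \<Rightarrow> 'e) \<Rightarrow> 'k \<times> ('e \<Rightarrow> 'i \<times> ('a \<Rightarrow> 'x)))" where
  "umeval z = papp (carrier L) (bnest p m) (K.ueval z)"

lemma umeval_copmap:
  assumes X: "copsh c X" shows "copmap d (beval p X) (beval L (beval p (beval m X))) umeval"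
  unfolding umeval_def
  by (rule copmap_comp[OF K.ueval_copmap[OF X] K.L.papp_beval[OF PMM.PQ_.copsh_beval[OF X] copisoD(1)[OF PMM.PQ.bnest_copiso[OF X]]]])

text \<open>Naturality of the unit in the copresheaf. With \<open>h\<close> an action of
  \<open>m\<close>, it moves the action made before a unit to the inside of
  \<open>L\<langle>p\<langle>m\<langle>-\<rangle>\<rangle>\<rangle>\<close>, where it meets the
  action made after it.\<close>

lemma umeval_papp:
  assumes X: "copsh c X" and z: "z \<in> cel (beval p X)"
  shows "umeval (papp (carrier p) h z) = papp (carrier L) (papp (carrier p) (papp (carrier m) h)) (umeval z)"
proof -
  obtain I f where z': "z = (I, f)" by (cases z)
  have I: "I \<in> P.pp" and f: "copmap c (fib p I) X f" using z by (auto simp: z')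
  have *: "papp (carrier q) (\<lambda>i\<in>P.pd I. h (f i)) s = papp (carrier q) h (papp (carrier q) f s)"
    if s: "s \<in> dirs (carrier L) I" for s
  proof -
    have s': "s \<in> cel (beval q (fib p I))" using s I by (simp add: K.dirs_L)
    show ?thesis unfolding papp_papp by (rule papp_cong_beval[OF s']) simp
  qed
  have 1: "K.ueval (papp (carrier p) h z) = papp (carrier L) (papp (carrier q) h) (K.ueval z)"
    using * by (auto simp: z' K.ueval_def papp_def[of "carrier p"] papp_def[of "carrier L"] intro!: restrict_ext)
  note uz = copmapD(1)[OF K.ueval_copmap[OF X] z]
  show ?thesis
    unfolding umeval_def 1 papp_papp
    by (rule papp_cong_beval[OF uz]) (rule PMM.PQ.bnest_papp[OF beval_pelts])
qed

text \<open>Passing from \<open>ueval\<close> to \<open>umeval\<close> applies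
  \<open>bnest p m\<close> inside \<open>r\<close>, by naturality of the cells; this is injective by
  \<open>papp_copiso\<close>, so nothing is lost.\<close>

lemma coclosure_eqI_umeval:
  assumes r: "bicomodule d d r" and \<theta>: "\<theta> \<in> bicells L r" and \<theta>': "\<theta>' \<in> bicells L r"
    and eq: "\<And>I z. I \<in> P.pp \<Longrightarrow> z \<in> cel (beval p (fib p I)) \<Longrightarrow> peval (bmap \<theta>) (umeval z) = peval (bmap \<theta>') (umeval z)"
  shows "\<theta> = \<theta>'"
proof (rule K.coclosure_eqI[OF r \<theta> \<theta>'])
  interpret T: bicomod_pair d d L r by unfold_locales (rule r)
  fix I z assume I: "I \<in> P.pp" and z: "z \<in> cel (beval p (fib p I))"
  note X = P.copsh_fib[OF I]
  note Y = PMM.PQ_.copsh_beval[OF X]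
  note uz = copmapD(1)[OF K.ueval_copmap[OF X] z]
  have "papp (carrier r) (bnest p m) (peval (bmap \<theta>) (K.ueval z)) = papp (carrier r) (bnest p m) (peval (bmap \<theta>') (K.ueval z))"
    using eq[OF I z] unfolding umeval_def peval_cell_papp[OF \<theta> uz] peval_cell_papp[OF \<theta>' uz] .
  then show "peval (bmap \<theta>) (K.ueval z) = peval (bmap \<theta>') (K.ueval z)"
    by (rule inj_onD[OF copisoD(2)[OF T.Q.papp_copiso[OF Y P.copsh_beval[OF MM.M.copsh_beval[OF X]] PMM.PQ.bnest_copiso[OF X]]]])
      (rule copmapD(1)[OF T.bicell_copmap[OF _ Y] uz], rule \<theta> \<theta>')+
qed

text \<open>Of the three factors of the adjoint cell, the right unitor and \<open>\<eta>\<close>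
  amount to \<open>munit\<close> inside \<open>p\<close>, and the left unitor takes the orbit of the
  result. Naturality of orbits lets \<open>bnest p m\<close> pass.\<close>

lemma coun:
  shows coun_cell: "coun \<in> bicells L (bid d)"
    and coun_umeval: "copsh c X \<Longrightarrow> z \<in> cel (beval p X) \<Longrightarrow>
      peval (bmap coun) (umeval z) = orbit d (beval p (beval m X)) (papp (carrier p) (munit c \<eta> X) z)"
proof -
  interpret PC: bicomod2 d c c p "bid c" by unfold_locales
  interpret PC_: bicomod d c "p \<odot> bid c" by (rule PC.bicomod_bcomp)
  interpret DQ: bicomod2 d d c "bid d" q by unfold_locales
  interpret DQ_: bicomod d c "bid d \<odot> q" by (rule DQ.bicomod_bcomp)
  interpret TQ: bicomod_pair d c "p \<odot> bid c" q by unfold_locales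
  interpret TP: bicomod_pair d c p "p \<odot> bid c" by unfold_locales
  let ?phi = "lunitor_inv q \<circ>\<^sub>b (cid p \<odot>\<^sub>b \<eta>) \<circ>\<^sub>b runitor_inv p"
  note l = P.runitor_inv_bicell and lq = PMM.PQ_.lunitor_inv_bicell
  note h = hcomp_cid_left[OF P.bicomodule MM.M.C.B.bicomodule MM.M.bicomodule MM.cells(1)]
  note v1 = vcomp_bicell[OF PC_.bicomodule PMM.PQ_.bicomodule DQ_.bicomodule h(1) lq(1)]
  note v2 = vcomp_bicell[OF P.bicomodule PC_.bicomodule DQ_.bicomodule l(1) v1(1)]
  have e: "coun = coclosure_adj q p (bid d) ?phi" by (simp add: coclosure_counit_def)
  note adj = K.adj_bicell[OF P.C.B.bicomodule v2(1), folded e]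
  show ec: "coun \<in> bicells L (bid d)" by (rule adj(1))
  assume X: "copsh c X" and z: "z \<in> cel (beval p X)"
  have lz: "peval (bmap (runitor_inv p)) z \<in> cel (beval (p \<odot> bid c) X)"
    by (rule copmapD(1)[OF TP.bicell_copmap[OF l(1) X] z])
  let ?y = "peval (bmap (cid p \<odot>\<^sub>b \<eta>)) (peval (bmap (runitor_inv p)) z)"
  have y: "?y \<in> cel (beval q X)" by (rule copmapD(1)[OF TQ.bicell_copmap[OF h(1) X] lz])
  have ay: "bnest p m ?y = papp (carrier p) (munit c \<eta> X) z"
    unfolding h(2)[OF beval_pelts[OF lz]] l(2)[OF z] munit_def papp_papp ..
  note uz = copmapD(1)[OF K.ueval_copmap[OF X] z]
  have "peval (bmap coun) (K.ueval z) = orbit d (beval q X) ?y"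
    unfolding adj(2)[OF beval_pelts[OF z]] v2(2)[OF beval_pelts[OF z]] v1(2)[OF beval_pelts[OF lz]] by (rule lq(2)[OF y])
  then have "peval (bmap coun) (umeval z) = papp (carrier (bid d)) (bnest p m) (orbit d (beval q X) ?y)"
    unfolding umeval_def peval_cell_papp[OF ec uz] by simp
  also have "\<dots> = orbit d (beval p (beval m X)) (bnest p m ?y)"
    by (rule orbit_nat[OF copisoD(1)[OF PMM.PQ.bnest_copiso[OF X]] y])
  finally show "peval (bmap coun) (umeval z) = orbit d (beval p (beval m X)) (papp (carrier p) (munit c \<eta> X) z)" unfolding ay .
qed

end

text \<open>The coaction as a map \<open>p\<langle>x\<langle>X\<rangle>\<rangle> \<rightarrow> L\<langle>p\<langle>x\<langle>X\<rangle>\<rangle>\<rangle>\<close>.\<close>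

definition (in monad_coclosure) coact_eval where
  "coact_eval x \<psi> v = papp (carrier L) (papp (carrier p) (mact m x \<psi>)) (umeval v)"

section \<open>The coaction and comultiplication in evaluated form\<close>

locale coclosure_module = monad_coclosure c d m \<eta> \<mu> p + MX: module_data c b m \<eta> \<mu> x \<psi>
  for c :: "('c, 'f) comonoid" and d :: "('d, 'g) comonoid" and m :: "('i, 'a, 'c, 'f, 'c, 'f) bicom"
    and \<eta> :: "('c, 'f, 'i, 'a, 'c, 'f, 'c, 'f) bicell"
    and \<mu> :: "('i \<times> ('a \<Rightarrow> 'i), ('a \<times> 'a) set, 'i, 'a, 'c, 'f, 'c, 'f) bicell"
    and p :: "('k, 'e, 'd, 'g, 'c, 'f) bicom"
    and b :: "('o, 'n) comonoid"
    and x :: "('j, 'u, 'c, 'f, 'o, 'n) bicom"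
    and \<psi> :: "('i \<times> ('a \<Rightarrow> 'j), ('a \<times> 'u) set, 'j, 'u, 'c, 'f, 'o, 'n) bicell"
begin

sublocale PMX: bicomod3 d c c b p m x by unfold_locales
sublocale PX: bicomod2 d c b p x by unfold_locales
sublocale PX_: bicomod d b "p \<odot> x" by (rule PX.bicomod_bcomp)
sublocale LQX: bicomod3 d d c b L q x by unfold_locales
sublocale LPX: bicomod2 d d b L "p \<odot> x" by unfold_locales
sublocale LPX_: bicomod d b "L \<odot> (p \<odot> x)" by (rule LPX.bicomod_bcomp)
sublocale LPMX: bicomod2 d d b L "p \<odot> (m \<odot> x)" by unfold_locales
sublocale LPMX_: bicomod d b "L \<odot> (p \<odot> (m \<odot> x))" by (rule LPMX.bicomod_bcomp)

abbreviation "coact \<equiv> (cid L \<odot>\<^sub>b (cid p \<odot>\<^sub>b \<psi>)) \<circ>\<^sub>b (cid L \<odot>\<^sub>b assoc p m x) \<circ>\<^sub>b assoc L q x \<circ>\<^sub>b (u \<odot>\<^sub>b cid x)"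

lemma coact_eval_copmap:
  assumes X: "copsh b X"
  shows "copmap d (beval p (beval x X)) (beval L (beval p (beval x X))) (coact_eval x \<psi>)"
  unfolding coact_eval_def
  by (intro copmap_comp[OF umeval_copmap K.L.papp_beval[OF _ P.papp_beval[OF _ MX.mact_copmap]]] X
      MX.X.copsh_beval P.copsh_beval MM.M.copsh_beval)

text \<open>The associators in the coaction only rebracket and vanish once everything is unnested,
  leaving the unit followed by the module action.\<close>

lemma coact:
  shows coact_cell: "coact \<in> bicells (p \<odot> x) (L \<odot> (p \<odot> x))"
    and coact_coact_eval: "copsh b X \<Longrightarrow> y \<in> cel (beval (p \<odot> x) X) \<Longrightarrow>
      papp (carrier L) (bnest p x) (bnest L (p \<odot> x) (peval (bmap coact) y)) = coact_eval x \<psi> (bnest p x y)"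
proof -
  note u = K.unit_bicell
  note h1 = hcomp_cid_right[OF P.bicomodule K.Lq_.bicomodule MX.X.bicomodule u(1)]
  note a1 = LQX.assoc_bicell
  note a2 = PMX.assoc_bicell
  note h2 = hcomp_cid_left[OF K.bicomodule_L PMX.PQ_R_.bicomodule PMX.P_QR_.bicomodule a2(1)]
  note h3 = hcomp_cid_left[OF P.bicomodule MX.MMX.QR_.bicomodule MX.X.bicomodule MX.cells(3)]
  note h4 = hcomp_cid_left[OF K.bicomodule_L PMX.P_QR_.bicomodule PX_.bicomodule h3(1)]
  note v1 = vcomp_bicell[OF LQX.P_QR_.bicomodule LPMX_.bicomodule LPX_.bicomodule h2(1) h4(1)]
  note v2 = vcomp_bicell[OF LQX.PQ_R_.bicomodule LQX.P_QR_.bicomodule LPX_.bicomodule a1(1) v1(1)]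
  note v3 = vcomp_bicell[OF PX_.bicomodule LQX.PQ_R_.bicomodule LPX_.bicomodule h1(1) v2(1)]
  show "coact \<in> bicells (p \<odot> x) (L \<odot> (p \<odot> x))" by (rule v3(1))
  assume X: "copsh b X" and y: "y \<in> cel (beval (p \<odot> x) X)"
  interpret T1: bicomod_pair d b "p \<odot> x" "(L \<odot> q) \<odot> x" by unfold_locales
  interpret T2: bicomod_pair d b "(L \<odot> q) \<odot> x" "L \<odot> (q \<odot> x)" by unfold_locales
  interpret T3: bicomod_pair d b "q \<odot> x" "p \<odot> (m \<odot> x)" by unfold_locales
  let ?y1 = "peval (bmap (u \<odot>\<^sub>b cid x)) y"
  let ?y2 = "peval (bmap (assoc L q x)) ?y1"
  let ?y3 = "peval (bmap (cid L \<odot>\<^sub>b assoc p m x)) ?y2"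
  have y1: "?y1 \<in> cel (beval ((L \<odot> q) \<odot> x) X)" by (rule copmapD(1)[OF T1.bicell_copmap[OF h1(1) X] y])
  have y2: "?y2 \<in> cel (beval (L \<odot> (q \<odot> x)) X)" by (rule copmapD(1)[OF T2.bicell_copmap[OF a1(1) X] y1])
  have y3: "?y3 \<in> pelts (carrier (L \<odot> (p \<odot> (m \<odot> x))))"
    by (rule peval_pelts[OF bicellsD(3)[OF h2(1)] beval_pelts[OF y2]])
  note ay2 = copmapD(1)[OF copisoD(1)[OF LQX.P_QR.bnest_copiso[OF X]] y2]
  \<comment> \<open>\<open>mact\<close> is \<open>\<psi>\<close> after \<open>bnest_inv\<close>,
    which cancels the \<open>bnest m x\<close> brought in by the associator.\<close>
  have step: "bnest p x (peval (bmap (cid p \<odot>\<^sub>b \<psi>)) (peval (bmap (assoc p m x)) s)) =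
      papp (carrier p) (mact m x \<psi>) (bnest p m (bnest q x s))" if s: "s \<in> cel (beval (q \<odot> x) X)" for s
  proof -
    let ?t = "peval (bmap (assoc p m x)) s"
    have t: "?t \<in> cel (beval (p \<odot> (m \<odot> x)) X)" by (rule copmapD(1)[OF T3.bicell_copmap[OF a2(1) X] s])
    note at = copmapD(1)[OF copisoD(1)[OF PMX.P_QR.bnest_copiso[OF X]] t]
    have "papp (carrier p) (mact m x \<psi>) (bnest p m (bnest q x s)) = papp (carrier p) (\<lambda>v. mact m x \<psi> (bnest m x v)) (bnest p (m \<odot> x) ?t)"
      unfolding a2(2)[OF beval_pelts[OF s], symmetric] papp_papp ..
    also have "\<dots> = papp (carrier p) (peval (bmap \<psi>)) (bnest p (m \<odot> x) ?t)"
      by (rule papp_cong_beval[OF at]) (simp add: mact_def MX.MMX.QR.bnest_inv_bnest[OF beval_pelts] del: beval_simps)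
    finally show ?thesis unfolding h3(2)[OF beval_pelts[OF t]] by simp
  qed
  have "papp (carrier L) (bnest p x) (bnest L (p \<odot> x) (peval (bmap coact) y)) =
      papp (carrier L) (\<lambda>s. bnest p x (peval (bmap (cid p \<odot>\<^sub>b \<psi>)) (peval (bmap (assoc p m x)) s))) (bnest L (q \<odot> x) ?y2)"
    unfolding v3(2)[OF beval_pelts[OF y]] v2(2)[OF beval_pelts[OF y1]] v1(2)[OF beval_pelts[OF y2]]
      h4(2)[OF y3] h2(2)[OF beval_pelts[OF y2]] papp_papp ..
  also have "\<dots> = papp (carrier L) (\<lambda>s. papp (carrier p) (mact m x \<psi>) (bnest p m (bnest q x s))) (bnest L (q \<odot> x) ?y2)"
    by (rule papp_cong_beval[OF ay2 step])
  also have "\<dots> = papp (carrier L) (\<lambda>s. papp (carrier p) (mact m x \<psi>) (bnest p m s)) (bnest L q (bnest (L \<odot> q) x ?y1))"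
    unfolding a1(2)[OF beval_pelts[OF y1], symmetric] papp_papp ..
  also have "\<dots> = coact_eval x \<psi> (bnest p x y)"
    unfolding h1(2)[OF beval_pelts[OF y]] u(2)[OF PX.bnest_pelts[OF beval_pelts[OF y]]] coact_eval_def umeval_def papp_papp ..
  finally show "papp (carrier L) (bnest p x) (bnest L (p \<odot> x) (peval (bmap coact) y)) = coact_eval x \<psi> (bnest p x y)" .
qed

text \<open>Naturality moves the module action past the counit, which has inserted the unit of the
  monad; the module unit law then cancels the two.\<close>

lemma coun_coact_eval:
  assumes X: "copsh b X" and v: "v \<in> cel (beval p (beval x X))"
  shows "peval (bmap coun) (coact_eval x \<psi> v) = orbit d (beval p (beval x X)) v"
proof -
  note Y = MX.X.copsh_beval[OF X]
  note uv = copmapD(1)[OF umeval_copmap[OF Y] v]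
  have nv: "papp (carrier p) (munit c \<eta> (beval x X)) v \<in> cel (beval p (beval m (beval x X)))"
    by (rule copmapD(1)[OF P.papp_beval[OF Y MM.munit_copmap[OF Y]] v])
  have "peval (bmap coun) (coact_eval x \<psi> v) = papp (carrier (bid d)) (papp (carrier p) (mact m x \<psi>)) (peval (bmap coun) (umeval v))"
    unfolding coact_eval_def by (rule peval_cell_papp[OF coun_cell uv])
  also have "\<dots> = orbit d (beval p (beval x X)) (papp (carrier p) (mact m x \<psi>) (papp (carrier p) (munit c \<eta> (beval x X)) v))"
    unfolding coun_umeval[OF Y v]
    by (rule orbit_nat[OF P.papp_beval[OF MM.M.copsh_beval[OF Y] MX.mact_copmap[OF X]] nv])
  also have "papp (carrier p) (mact m x \<psi>) (papp (carrier p) (munit c \<eta> (beval x X)) v) = v"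
    unfolding papp_papp
    by (rule trans[OF papp_cong_beval[OF v, of _ "\<lambda>x. x"] papp_id[OF beval_pelts[OF v]]]) (rule MX.mact_munit[OF X])
  finally show ?thesis .
qed

end

context monad_coclosure
begin

text \<open>The adjoint cell that defines the comultiplication is the unit followed, inside
  \<open>L\<close>, by the coaction on \<open>p \<odot> m\<close> belonging to the monad as a module
  over itself. Hence \<open>coact_eval m \<mu>\<close> appears.\<close>

lemma del:
  shows comul_cell: "comul \<in> bicells L (L \<odot> L)"
    and comul_umeval: "copsh c X \<Longrightarrow> z \<in> cel (beval p X) \<Longrightarrow>
      bnest L L (peval (bmap comul) (umeval z)) = papp (carrier L) (coact_eval m \<mu>) (umeval z)"
proof -
  interpret S: coclosure_module c d m \<eta> \<mu> p c m \<mu> by unfold_locales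
  interpret LLQ: bicomod3 d d d c L L q by unfold_locales
  interpret A2: bicomod2 d d c L "(L \<odot> q) \<odot> m" by unfold_locales
  interpret A2_: bicomod d c "L \<odot> ((L \<odot> q) \<odot> m)" by (rule A2.bicomod_bcomp)
  interpret A3: bicomod2 d d c L "L \<odot> (q \<odot> m)" by unfold_locales
  interpret A3_: bicomod d c "L \<odot> (L \<odot> (q \<odot> m))" by (rule A3.bicomod_bcomp)
  interpret A4: bicomod2 d d c L "L \<odot> (p \<odot> (m \<odot> m))" by unfold_locales
  interpret A4_: bicomod d c "L \<odot> (L \<odot> (p \<odot> (m \<odot> m)))" by (rule A4.bicomod_bcomp)
  note bq = PMM.PQ_.bicomodule and bL = K.bicomodule_L
  note b1 = K.Lq_.bicomodule
  note bs2 = S.LQX.PQ_R_.bicomodule and bs3 = S.LQX.P_QR_.bicomodule and bs4 = S.LPMX_.bicomodule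
  note b2 = A2_.bicomodule and b3 = A3_.bicomodule and b4 = A4_.bicomodule and b5 = LLQ.P_QR_.bicomodule
  note u = K.unit_bicell
  note h1 = hcomp_cid_right[OF P.bicomodule b1 MM.M.bicomodule u(1)]
  note a1 = S.LQX.assoc_bicell
  note a2 = PMM.assoc_bicell
  note h2 = hcomp_cid_left[OF bL PMM.PQ_R_.bicomodule PMM.P_QR_.bicomodule a2(1)]
  note h3 = hcomp_cid_left[OF P.bicomodule MM.MMX.PQ_.bicomodule MM.M.bicomodule MM.cells(2)]
  note h4 = hcomp_cid_left[OF bL PMM.P_QR_.bicomodule bq h3(1)]
  note s1 = vcomp_bicell[OF bs3 bs4 b1 h2(1) h4(1)]
  note s2 = vcomp_bicell[OF bs2 bs3 b1 a1(1) s1(1)]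
  note s3 = vcomp_bicell[OF bq bs2 b1 h1(1) s2(1)]
  note k1 = hcomp_cid_left[OF bL bq bs2 h1(1)]
  note k2 = hcomp_cid_left[OF bL bs2 bs3 a1(1)]
  note k3 = hcomp_cid_left[OF bL bs3 bs4 h2(1)]
  note k4 = hcomp_cid_left[OF bL bs4 b1 h4(1)]
  note ai = LLQ.assoc_inv_bicell
  note b6 = LLQ.PQ_R_.bicomodule
  let ?phi = "assoc_inv L L q \<circ>\<^sub>b (cid L \<odot>\<^sub>b (cid L \<odot>\<^sub>b (cid p \<odot>\<^sub>b \<mu>)))
    \<circ>\<^sub>b (cid L \<odot>\<^sub>b (cid L \<odot>\<^sub>b assoc p m m)) \<circ>\<^sub>b (cid L \<odot>\<^sub>b assoc L q m) \<circ>\<^sub>b (cid L \<odot>\<^sub>b (u \<odot>\<^sub>b cid m)) \<circ>\<^sub>b u"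
  note v5 = vcomp_bicell[OF b4 b5 b6 k4(1) ai(1)]
  note v4 = vcomp_bicell[OF b3 b4 b6 k3(1) v5(1)]
  note v3 = vcomp_bicell[OF b2 b3 b6 k2(1) v4(1)]
  note v2 = vcomp_bicell[OF b1 b2 b6 k1(1) v3(1)]
  note v1 = vcomp_bicell[OF P.bicomodule b1 b6 u(1) v2(1)]
  have e: "comul = coclosure_adj q p (L \<odot> L) ?phi" by (simp add: coclosure_comult_def Let_def)
  note adj = K.adj_bicell[OF LL_.bicomodule v1(1), folded e]
  show dc: "comul \<in> bicells L (L \<odot> L)" by (rule adj(1))
  assume X: "copsh c X" and z: "z \<in> cel (beval p X)"
  have y1: "peval (bmap u) z \<in> pelts (carrier (L \<odot> q))" by (rule peval_pelts[OF bicellsD(3)[OF u(1)] beval_pelts[OF z]])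
  have y2: "peval (bmap (cid L \<odot>\<^sub>b (u \<odot>\<^sub>b cid m))) (peval (bmap u) z) \<in> pelts (carrier (L \<odot> ((L \<odot> q) \<odot> m)))" (is "?y2 \<in> _")
    by (rule peval_pelts[OF bicellsD(3)[OF k1(1)] y1])
  have y3: "peval (bmap (cid L \<odot>\<^sub>b assoc L q m)) ?y2 \<in> pelts (carrier (L \<odot> (L \<odot> (q \<odot> m))))" (is "?y3 \<in> _")
    by (rule peval_pelts[OF bicellsD(3)[OF k2(1)] y2])
  have y4: "peval (bmap (cid L \<odot>\<^sub>b (cid L \<odot>\<^sub>b assoc p m m))) ?y3 \<in> pelts (carrier (L \<odot> (L \<odot> (p \<odot> (m \<odot> m)))))" (is "?y4 \<in> _")
    by (rule peval_pelts[OF bicellsD(3)[OF k3(1)] y3])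
  have y5: "peval (bmap (cid L \<odot>\<^sub>b (cid L \<odot>\<^sub>b (cid p \<odot>\<^sub>b \<mu>)))) ?y4 \<in> pelts (carrier (L \<odot> (L \<odot> q)))" (is "?y5 \<in> _")
    by (rule peval_pelts[OF bicellsD(3)[OF k4(1)] y4])
  note uz = copmapD(1)[OF K.ueval_copmap[OF X] z]
  \<comment> \<open>The four whiskered cells inside the first \<open>L\<close> are the four factors
    of the coaction for \<open>x = m\<close>, which \<open>S.coact\<close> names.\<close>
  have coact: "peval (bmap (cid L \<odot>\<^sub>b (cid p \<odot>\<^sub>b \<mu>))) (peval (bmap (cid L \<odot>\<^sub>b assoc p m m)) (peval (bmap (assoc L q m)) (peval (bmap (u \<odot>\<^sub>b cid m)) s)))
      = peval (bmap S.coact) s" if s: "s \<in> pelts (carrier q)" for s :: "('k \<times> ('e \<Rightarrow> 'i)) \<times> (('e \<times> 'a) set \<Rightarrow> 'z)"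
  proof -
    note t1 = peval_pelts[OF bicellsD(3)[OF h1(1)] s]
    note t2 = peval_pelts[OF bicellsD(3)[OF a1(1)] t1]
    show ?thesis unfolding s3(2)[OF s] s2(2)[OF t1] s1(2)[OF t2] ..
  qed
  have "bnest L L (peval (bmap comul) (K.ueval z)) = papp (carrier L) (bnest L q) (bnest L (L \<odot> q) ?y5)"
    unfolding adj(2)[OF beval_pelts[OF z]] v1(2)[OF beval_pelts[OF z]] v2(2)[OF y1] v3(2)[OF y2] v4(2)[OF y3] v5(2)[OF y4]
      ai(2)[OF y5] ..
  also have "\<dots> = papp (carrier L) (\<lambda>s. bnest L q (peval (bmap S.coact) s)) (K.ueval z)"
    unfolding k4(2)[OF y4] k3(2)[OF y3] k2(2)[OF y2] k1(2)[OF y1] u(2)[OF beval_pelts[OF z]] papp_papp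
    by (rule papp_cong_beval[OF uz]) (simp only: coact[OF beval_pelts])
  finally have 1: "bnest L L (peval (bmap comul) (K.ueval z)) = \<dots>" .
  have dr: "peval (bmap comul) (K.ueval z) \<in> pelts (carrier (L \<odot> L))"
    by (rule peval_pelts[OF bicellsD(3)[OF dc] beval_pelts[OF uz]])
  have "bnest L L (peval (bmap comul) (umeval z)) = papp (carrier L) (papp (carrier L) (bnest p m)) (bnest L L (peval (bmap comul) (K.ueval z)))"
    unfolding umeval_def peval_cell_papp[OF dc uz] by (rule LL.bnest_papp[OF dr])
  also have "\<dots> = papp (carrier L) (\<lambda>s. coact_eval m \<mu> (bnest p m s)) (K.ueval z)"
    unfolding 1 papp_papp by (rule papp_cong_beval[OF uz S.coact_coact_eval[OF X]])
  finally show "bnest L L (peval (bmap comul) (umeval z)) = papp (carrier L) (coact_eval m \<mu>) (umeval z)"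
    unfolding umeval_def papp_papp .
qed

end

context coclosure_module
begin

text \<open>Coassociativity for elements. Naturality of the comultiplication exposes
  \<open>comul_umeval\<close>, after which only a computation inside the outer \<open>L\<close> is
  left.\<close>

lemma comul_coact_eval:
  assumes X: "copsh b X" and v: "v \<in> cel (beval p (beval x X))"
  shows "bnest L L (peval (bmap comul) (coact_eval x \<psi> v)) = papp (carrier L) (coact_eval x \<psi>) (coact_eval x \<psi> v)"
proof -
  note Y = MX.X.copsh_beval[OF X]
  note mY = MM.M.copsh_beval[OF Y]
  note uv = copmapD(1)[OF umeval_copmap[OF Y] v]
  have du: "peval (bmap comul) (umeval v) \<in> pelts (carrier (L \<odot> L))"
    by (rule peval_pelts[OF bicellsD(3)[OF comul_cell] beval_pelts[OF uv]])
  have "bnest L L (peval (bmap comul) (coact_eval x \<psi> v)) =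
      papp (carrier L) (papp (carrier L) (papp (carrier p) (mact m x \<psi>))) (bnest L L (peval (bmap comul) (umeval v)))"
    unfolding coact_eval_def peval_cell_papp[OF comul_cell uv] by (rule LL.bnest_papp[OF du])
  also have "\<dots> = papp (carrier L) (\<lambda>w. papp (carrier L) (papp (carrier p) (\<lambda>t. mact m x \<psi> (mact m m \<mu> t))) (umeval w)) (umeval v)"
    unfolding comul_umeval[OF Y v] papp_papp coact_eval_def ..
  \<comment> \<open>Module associativity replaces multiplication in \<open>m\<close> by a second
    action, and naturality of \<open>umeval\<close> pulls this inner action out in front of the
    unit.\<close>
  also have "\<dots> = papp (carrier L) (\<lambda>w. coact_eval x \<psi> (papp (carrier p) (mact m x \<psi>) w)) (umeval v)"
  proof (rule papp_cong_beval[OF uv])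
    fix w assume w: "w \<in> cel (beval p (beval m (beval x X)))"
    note uw = copmapD(1)[OF umeval_copmap[OF mY] w]
    have "papp (carrier L) (papp (carrier p) (\<lambda>t. mact m x \<psi> (mact m m \<mu> t))) (umeval w) =
        papp (carrier L) (papp (carrier p) (\<lambda>t. mact m x \<psi> (papp (carrier m) (mact m x \<psi>) t))) (umeval w)"
      by (intro papp_cong_beval[OF uw] papp_cong_beval[where p=p] MX.mact_mact[OF X])
    then show "papp (carrier L) (papp (carrier p) (\<lambda>t. mact m x \<psi> (mact m m \<mu> t))) (umeval w) = coact_eval x \<psi> (papp (carrier p) (mact m x \<psi>) w)"
      unfolding coact_eval_def umeval_papp[OF mY w] papp_papp .
  qed
  also have "\<dots> = papp (carrier L) (coact_eval x \<psi>) (coact_eval x \<psi> v)"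
    unfolding coact_eval_def[of _ _ v] papp_papp ..
  finally show ?thesis .
qed

end

section \<open>Comonad and comodule laws\<close>

context monad_coclosure
begin

text \<open>\<open>coclosure_eqI_umeval\<close> leaves equations at the elements
  \<open>umeval z\<close>, where the comultiplication is \<open>coact_eval m \<mu>\<close> inside
  \<open>L\<close>.\<close>

lemma comonad_L: "comonad_on d L coun comul"
proof -
  interpret S: coclosure_module c d m \<eta> \<mu> p c m \<mu> by unfold_locales
  interpret DL: bicomod2 d d d "bid d" L by unfold_locales
  interpret DL_: bicomod d d "bid d \<odot> L" by (rule DL.bicomod_bcomp)
  interpret LD: bicomod2 d d d L "bid d" by unfold_locales
  interpret LD_: bicomod d d "L \<odot> bid d" by (rule LD.bicomod_bcomp)
  interpret LLL: bicomod3 d d d d L L L by unfold_locales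
  note bL = K.bicomodule_L and bLL = LL_.bicomodule and bD = P.C.B.bicomodule
  note h1 = hcomp_cid_right[OF bL bD bL coun_cell]
  note h2 = hcomp_cid_left[OF bL bL bD coun_cell]
  note h3 = hcomp_cid_right[OF bL bLL bL comul_cell]
  note h4 = hcomp_cid_left[OF bL bL bLL comul_cell]
  note a = LLL.assoc_bicell
  note v1 = vcomp_bicell[OF bL bLL DL_.bicomodule comul_cell h1(1)]
  note v2 = vcomp_bicell[OF bL bLL LD_.bicomodule comul_cell h2(1)]
  note v3' = vcomp_bicell[OF bLL LLL.PQ_R_.bicomodule LLL.P_QR_.bicomodule h3(1) a(1)]
  note v3 = vcomp_bicell[OF bL bLL LLL.P_QR_.bicomodule comul_cell v3'(1)]
  note v4 = vcomp_bicell[OF bL bLL LLL.P_QR_.bicomodule comul_cell h4(1)]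
  note l = K.L.lunitor_inv_bicell and r = K.L.runitor_inv_bicell
  interpret TLL: bicomod_pair d d L "L \<odot> L" by unfold_locales
  interpret TD: bicomod_pair d d L "bid d" by unfold_locales
  { fix I and z assume I: "I \<in> P.pp" and z: "z \<in> cel (beval p (fib p I))"
    let ?X = "fib p I"
    note X = P.copsh_fib[OF I]
    note mX = MM.M.copsh_beval[OF X]
    note pmX = P.copsh_beval[OF mX]
    note uz = copmapD(1)[OF umeval_copmap[OF X] z]
    note uzr = beval_pelts[OF uz]
    have dz: "peval (bmap comul) (umeval z) \<in> cel (beval (L \<odot> L) (beval p (beval m ?X)))"
      by (rule copmapD(1)[OF TLL.bicell_copmap[OF comul_cell pmX] uz])
    note dzr = beval_pelts[OF dz]
    have du: "bnest L L (peval (bmap comul) (umeval z)) = papp (carrier L) (coact_eval m \<mu>) (umeval z)" by (rule comul_umeval[OF X z])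
    have nz: "papp (carrier p) (munit c \<eta> ?X) z \<in> cel (beval p (beval m ?X))"
      by (rule copmapD(1)[OF P.papp_beval[OF X MM.munit_copmap[OF X]] z])
    \<comment> \<open>The first counit law: the counit inserts the unit of the monad in front of the
      coaction, and after naturality of \<open>umeval\<close> the multiplication absorbs it by the
      right unit law.\<close>
    have "coact_eval m \<mu> (papp (carrier p) (munit c \<eta> ?X) z) =
        papp (carrier L) (papp (carrier p) (\<lambda>t. mact m m \<mu> (papp (carrier m) (munit c \<eta> ?X) t))) (umeval z)"
      unfolding coact_eval_def umeval_papp[OF X z] papp_papp ..
    also have "\<dots> = papp (carrier L) (papp (carrier p) (\<lambda>t. t)) (umeval z)"
      by (intro papp_cong_beval[OF uz] papp_cong_beval[where p=p] papp_munit_mact[OF X])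
    also have "\<dots> = papp (carrier L) (\<lambda>t. t) (umeval z)"
      by (rule papp_cong_beval[OF uz]) (rule papp_id[OF beval_pelts])
    also have "\<dots> = umeval z" by (rule papp_id[OF uzr])
    finally have sn: "coact_eval m \<mu> (papp (carrier p) (munit c \<eta> ?X) z) = umeval z" .
    have "bnest (bid d) L (peval (bmap ((coun \<odot>\<^sub>b cid L) \<circ>\<^sub>b comul)) (umeval z)) = peval (bmap coun) (papp (carrier L) (coact_eval m \<mu>) (umeval z))"
      unfolding v1(2)[OF uzr] h1(2)[OF dzr] du ..
    also have "\<dots> = orbit d (beval L (beval p (beval m ?X))) (umeval z)"
      unfolding peval_cell_papp[OF coun_cell uz] coun_umeval[OF X z] orbit_nat[OF S.coact_eval_copmap[OF X] nz] sn ..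
    also have "\<dots> = bnest (bid d) L (peval (bmap (lunitor_inv L)) (umeval z))"
      by (rule l(2)[OF uz, symmetric])
    finally have 1: "peval (bmap ((coun \<odot>\<^sub>b cid L) \<circ>\<^sub>b comul)) (umeval z) = peval (bmap (lunitor_inv L)) (umeval z)"
      by (rule DL.bnest_inj[OF peval_pelts[OF bicellsD(3)[OF v1(1)] uzr] peval_pelts[OF bicellsD(3)[OF l(1)] uzr]])
    have "bnest L (bid d) (peval (bmap ((cid L \<odot>\<^sub>b coun) \<circ>\<^sub>b comul)) (umeval z)) = papp (carrier L) (\<lambda>v. peval (bmap coun) (coact_eval m \<mu> v)) (umeval z)"
      unfolding v2(2)[OF uzr] h2(2)[OF dzr] du papp_papp ..
    \<comment> \<open>The second counit law is \<open>coun_coact_eval\<close> for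
      \<open>x = m\<close>, applied inside \<open>L\<close>.\<close>
    also have "\<dots> = papp (carrier L) (orbit d (beval p (beval m ?X))) (umeval z)"
      by (rule papp_cong_beval[OF uz S.coun_coact_eval[OF X]])
    also have "\<dots> = bnest L (bid d) (peval (bmap (runitor_inv L)) (umeval z))"
      by (rule r(2)[OF uz, symmetric])
    finally have 2: "peval (bmap ((cid L \<odot>\<^sub>b coun) \<circ>\<^sub>b comul)) (umeval z) = peval (bmap (runitor_inv L)) (umeval z)"
      by (rule LD.bnest_inj[OF peval_pelts[OF bicellsD(3)[OF v2(1)] uzr] peval_pelts[OF bicellsD(3)[OF r(1)] uzr]])
    let ?R = "\<lambda>w. papp (carrier L) (bnest L L) (bnest L (L \<odot> L) w)"
    have y: "peval (bmap (comul \<odot>\<^sub>b cid L)) (peval (bmap comul) (umeval z)) \<in> pelts (carrier ((L \<odot> L) \<odot> L))"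
      by (rule peval_pelts[OF bicellsD(3)[OF h3(1)] dzr])
    \<comment> \<open>Vertical composition associates to the left, so the premise below is an
      instance of reflexivity; it displays the grouping to which \<open>v3\<close> and
      \<open>v3'\<close> refer.\<close>
    have "?R (peval (bmap (assoc L L L \<circ>\<^sub>b (comul \<odot>\<^sub>b cid L) \<circ>\<^sub>b comul)) (umeval z)) =
        bnest L L (peval (bmap comul) (papp (carrier L) (coact_eval m \<mu>) (umeval z)))"
      if "assoc L L L \<circ>\<^sub>b (comul \<odot>\<^sub>b cid L) \<circ>\<^sub>b comul = (assoc L L L \<circ>\<^sub>b (comul \<odot>\<^sub>b cid L)) \<circ>\<^sub>b comul"
      unfolding v3(2)[OF uzr] v3'(2)[OF dzr] a(2)[OF y] h3(2)[OF dzr] du ..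
    then have "?R (peval (bmap (assoc L L L \<circ>\<^sub>b (comul \<odot>\<^sub>b cid L) \<circ>\<^sub>b comul)) (umeval z)) =
        bnest L L (peval (bmap comul) (papp (carrier L) (coact_eval m \<mu>) (umeval z)))" by simp
    also have "\<dots> = papp (carrier L) (papp (carrier L) (coact_eval m \<mu>)) (bnest L L (peval (bmap comul) (umeval z)))"
      unfolding peval_cell_papp[OF comul_cell uz] by (rule LL.bnest_papp[OF dzr])
    also have "\<dots> = papp (carrier L) (\<lambda>v. papp (carrier L) (coact_eval m \<mu>) (coact_eval m \<mu> v)) (umeval z)"
      unfolding du papp_papp ..
    also have "\<dots> = papp (carrier L) (\<lambda>v. bnest L L (peval (bmap comul) (coact_eval m \<mu> v))) (umeval z)"
      by (rule papp_cong_beval[OF uz S.comul_coact_eval[OF X, symmetric]])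
    also have "\<dots> = ?R (peval (bmap ((cid L \<odot>\<^sub>b comul) \<circ>\<^sub>b comul)) (umeval z))"
      unfolding v4(2)[OF uzr] h4(2)[OF dzr] du papp_papp ..
    finally have 3: "peval (bmap (assoc L L L \<circ>\<^sub>b (comul \<odot>\<^sub>b cid L) \<circ>\<^sub>b comul)) (umeval z) = peval (bmap ((cid L \<odot>\<^sub>b comul) \<circ>\<^sub>b comul)) (umeval z)"
      by (rule inj_onD[OF copisoD(2)[OF LLL.copiso_r[OF pmX]]])
        (rule copmapD(1)[OF _ uz], rule bicomod_pair.bicell_copmap[OF _ _ pmX],
          rule bicomod_pair.intro[OF K.L.bicomod_axioms LLL.P_QR_.bicomod_axioms], rule v3(1) v4(1))+
    note 1 2 3 }
  note eq = this
  show ?thesis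
    unfolding comonad_on_def
    by (intro conjI bL coun_cell comul_cell coclosure_eqI_umeval[OF DL_.bicomodule v1(1) l(1) eq(1)]
        coclosure_eqI_umeval[OF LD_.bicomodule v2(1) r(1) eq(2)] coclosure_eqI_umeval[OF LLL.P_QR_.bicomodule v3(1) v4(1) eq(3)])
qed

end

context coclosure_module
begin

text \<open>Cells out of \<open>p \<odot> x\<close> are compared on its evaluation at
  \<open>X\<close>, unnested one step further by \<open>bnest p x\<close> into
  \<open>p\<langle>x\<langle>X\<rangle>\<rangle>\<close>, where the coaction is
  \<open>coact_eval x \<psi>\<close> and both laws are known.\<close>

lemma comodule: "left_comodule d b L coun comul (p \<odot> x) coact"
proof -
  let ?z = "p \<odot> x"
  interpret DZ: bicomod2 d d b "bid d" ?z by unfold_locales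
  interpret DZ_: bicomod d b "bid d \<odot> ?z" by (rule DZ.bicomod_bcomp)
  interpret LLZ: bicomod3 d d d b L L ?z by unfold_locales
  note bL = K.bicomodule_L and bLL = LL_.bicomodule and bD = P.C.B.bicomodule and bZ = PX_.bicomodule
  note bLZ = LPX_.bicomodule
  note h1 = hcomp_cid_right[OF bL bD bZ coun_cell]
  note h3 = hcomp_cid_right[OF bL bLL bZ comul_cell]
  note h4 = hcomp_cid_left[OF bL bZ bLZ coact_cell]
  note a = LLZ.assoc_bicell
  note v1 = vcomp_bicell[OF bZ bLZ DZ_.bicomodule coact_cell h1(1)]
  note v3' = vcomp_bicell[OF bLZ LLZ.PQ_R_.bicomodule LLZ.P_QR_.bicomodule h3(1) a(1)]
  note v3 = vcomp_bicell[OF bZ bLZ LLZ.P_QR_.bicomodule coact_cell v3'(1)]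
  note v4 = vcomp_bicell[OF bZ bLZ LLZ.P_QR_.bicomodule coact_cell h4(1)]
  note l = PX_.lunitor_inv_bicell
  interpret T1: bicomod_pair d b ?z "bid d \<odot> ?z" by unfold_locales
  interpret T2: bicomod_pair d b ?z "L \<odot> ?z" by unfold_locales
  interpret T3: bicomod_pair d b ?z "L \<odot> (L \<odot> ?z)" by unfold_locales
  { fix I and y assume I: "I \<in> pos (carrier ?z)" and y: "y \<in> cel (beval ?z (fib ?z I))"
    let ?X = "fib ?z I"
    note X = PX_.copsh_fib[OF I]
    note zX = PX_.copsh_beval[OF X] and pxX = P.copsh_beval[OF MX.X.copsh_beval[OF X]]
    note yr = beval_pelts[OF y]
    have sy: "peval (bmap coact) y \<in> cel (beval (L \<odot> ?z) ?X)"
      by (rule copmapD(1)[OF T2.bicell_copmap[OF coact_cell X] y])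
    note syr = beval_pelts[OF sy]
    let ?t = "bnest L ?z (peval (bmap coact) y)"
    have t: "?t \<in> cel (beval L (beval ?z ?X))" by (rule copmapD(1)[OF copisoD(1)[OF LPX.bnest_copiso[OF X]] sy])
    have ft: "papp (carrier L) (bnest p x) ?t = coact_eval x \<psi> (bnest p x y)" by (rule coact_coact_eval[OF X y])
    have ay: "bnest p x y \<in> cel (beval p (beval x ?X))" by (rule copmapD(1)[OF copisoD(1)[OF PX.bnest_copiso[OF X]] y])
    have 1: "peval (bmap ((coun \<odot>\<^sub>b cid ?z) \<circ>\<^sub>b coact)) y = peval (bmap (lunitor_inv ?z)) y"
    proof (rule DZ.bnest_inj[OF peval_pelts[OF bicellsD(3)[OF v1(1)] yr] peval_pelts[OF bicellsD(3)[OF l(1)] yr]])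
      have e: "bnest (bid d) ?z (peval (bmap ((coun \<odot>\<^sub>b cid ?z) \<circ>\<^sub>b coact)) y) = peval (bmap coun) ?t"
        unfolding v1(2)[OF yr] h1(2)[OF syr] ..
      \<comment> \<open>The counit law is known after unnesting \<open>p \<odot> x\<close> inside
        the identity bicomodule; that unnesting is injective, so the law descends.\<close>
      have "papp (carrier (bid d)) (bnest p x) (peval (bmap coun) ?t) = papp (carrier (bid d)) (bnest p x) (orbit d (beval ?z ?X) y)"
        unfolding peval_cell_papp[OF coun_cell t, symmetric] ft coun_coact_eval[OF X ay]
          orbit_nat[OF copisoD(1)[OF PX.bnest_copiso[OF X]] y] ..
      then have "peval (bmap coun) ?t = orbit d (beval ?z ?X) y"
      proof (rule inj_onD[OF copisoD(2)[OF P.C.B.papp_copiso[OF zX pxX PX.bnest_copiso[OF X]]]])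
        interpret TD: bicomod_pair d d L "bid d" by unfold_locales
        show "peval (bmap coun) ?t \<in> cel (beval (bid d) (beval ?z ?X))"
          by (rule copmapD(1)[OF TD.bicell_copmap[OF coun_cell zX] t])
        show "orbit d (beval ?z ?X) y \<in> cel (beval (bid d) (beval ?z ?X))"
          by (rule copmapD(1)[OF copisoD(1)[OF P.C.orbit_copiso[OF zX]] y])
      qed
      then show "bnest (bid d) ?z (peval (bmap ((coun \<odot>\<^sub>b cid ?z) \<circ>\<^sub>b coact)) y) = bnest (bid d) ?z (peval (bmap (lunitor_inv ?z)) y)"
        unfolding e l(2)[OF y] .
    qed
    let ?R = "\<lambda>w. papp (carrier L) (bnest L ?z) (bnest L (L \<odot> ?z) w)"
    let ?w3 = "peval (bmap (assoc L L ?z \<circ>\<^sub>b (comul \<odot>\<^sub>b cid ?z) \<circ>\<^sub>b coact)) y" and ?w4 = "peval (bmap ((cid L \<odot>\<^sub>b coact) \<circ>\<^sub>b coact)) y"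
    have w3: "?w3 \<in> cel (beval (L \<odot> (L \<odot> ?z)) ?X)" by (rule copmapD(1)[OF T3.bicell_copmap[OF v3(1) X] y])
    have w4: "?w4 \<in> cel (beval (L \<odot> (L \<odot> ?z)) ?X)" by (rule copmapD(1)[OF T3.bicell_copmap[OF v4(1) X] y])
    have ys: "peval (bmap (comul \<odot>\<^sub>b cid ?z)) (peval (bmap coact) y) \<in> pelts (carrier ((L \<odot> L) \<odot> ?z))"
      by (rule peval_pelts[OF bicellsD(3)[OF h3(1)] syr])
    have dt: "peval (bmap comul) ?t \<in> pelts (carrier (L \<odot> L))"
      by (rule peval_pelts[OF bicellsD(3)[OF comul_cell] beval_pelts[OF t]])
    have R3: "?R ?w3 = bnest L L (peval (bmap comul) ?t)"
      unfolding v3(2)[OF yr] v3'(2)[OF syr] a(2)[OF ys] h3(2)[OF syr] ..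
    have R4: "?R ?w4 = papp (carrier L) (\<lambda>s. bnest L ?z (peval (bmap coact) s)) ?t"
      unfolding v4(2)[OF yr] h4(2)[OF syr] papp_papp ..
    have "papp (carrier L) (papp (carrier L) (bnest p x)) (?R ?w3) = bnest L L (peval (bmap comul) (coact_eval x \<psi> (bnest p x y)))"
      unfolding R3 ft[symmetric] peval_cell_papp[OF comul_cell t] by (rule LL.bnest_papp[OF dt, symmetric])
    also have "\<dots> = papp (carrier L) (\<lambda>s. coact_eval x \<psi> (bnest p x s)) ?t"
      unfolding comul_coact_eval[OF X ay] unfolding ft[symmetric] papp_papp ..
    also have "\<dots> = papp (carrier L) (\<lambda>s. papp (carrier L) (bnest p x) (bnest L ?z (peval (bmap coact) s))) ?t"
      by (rule papp_cong_beval[OF t coact_coact_eval[OF X, symmetric]])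
    also have "\<dots> = papp (carrier L) (papp (carrier L) (bnest p x)) (?R ?w4)"
      unfolding R4 papp_papp ..
    finally have RR: "papp (carrier L) (papp (carrier L) (bnest p x)) (?R ?w3) = papp (carrier L) (papp (carrier L) (bnest p x)) (?R ?w4)" .
    \<comment> \<open>Unnesting \<open>p \<odot> x\<close> below two copies of \<open>L\<close> is
      injective, so the two sides of coassociativity already agree before it.\<close>
    note i = K.L.papp_copiso[OF K.L.copsh_beval[OF zX] K.L.copsh_beval[OF pxX] K.L.papp_copiso[OF zX pxX PX.bnest_copiso[OF X]]]
    note iR = LLZ.copiso_r[OF X]
    have "?R ?w3 = ?R ?w4"
      by (rule inj_onD[OF copisoD(2)[OF i] RR copmapD(1)[OF copisoD(1)[OF iR] w3] copmapD(1)[OF copisoD(1)[OF iR] w4]])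
    then have 2: "?w3 = ?w4" by (rule inj_onD[OF copisoD(2)[OF iR] _ w3 w4])
    note 1 2 }
  note eq = this
  show ?thesis
    unfolding left_comodule_def
    by (intro conjI comonad_L bZ coact_cell T1.bicell_eqI[OF v1(1) l(1) eq(1)] T3.bicell_eqI[OF v3(1) v4(1) eq(2)])
qed

end

theorem theorem4p4:
  fixes b :: "('bo, 'bm) comonoid"
    and c :: "('co, 'cm) comonoid"
    and d :: "('do, 'dm) comonoid"
    and m :: "('mi, 'ma, 'co, 'cm, 'co, 'cm) bicom"
    and \<eta> :: "('co, 'cm, 'mi, 'ma, 'co, 'cm, 'co, 'cm) bicell"
    and \<mu> :: "('mi \<times> ('ma \<Rightarrow> 'mi), ('ma \<times> 'ma) set, 'mi, 'ma, 'co, 'cm, 'co, 'cm) bicell"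
    and p :: "('pi, 'pa, 'do, 'dm, 'co, 'cm) bicom"
    and x :: "('xi, 'xa, 'co, 'cm, 'bo, 'bm) bicom"
    and \<psi> :: "('mi \<times> ('ma \<Rightarrow> 'xi), ('ma \<times> 'xa) set, 'xi, 'xa, 'co, 'cm, 'bo, 'bm) bicell"
  assumes "comonoid b" and "comonoid c" and "comonoid d"
    and "monad_on c m \<eta> \<mu>"
    and "bicomodule d c p"
    and "bicomodule c b x"
    and "left_module c b m \<eta> \<mu> x \<psi>"
  shows "let L = coclosure (p \<odot> m) p; u = coclosure_unit (p \<odot> m) p in
    left_comodule d b L (coclosure_counit p m \<eta>) (coclosure_comult p m \<mu>) (p \<odot> x)
      ((cid L \<odot>\<^sub>b (cid p \<odot>\<^sub>b \<psi>))
       \<circ>\<^sub>b (cid L \<odot>\<^sub>b assoc p m x) \<circ>\<^sub>b assoc L (p \<odot> m) x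
       \<circ>\<^sub>b (u \<odot>\<^sub>b cid x))"
proof -
  interpret coclosure_module c d m \<eta> \<mu> p b x \<psi>
    using assms by unfold_locales
  show ?thesis unfolding Let_def by (rule comodule)
qed

end
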